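(* Let $\varphi\in H(\widetilde{\mathbb{Y}})$ be a harmonic function on the filtered Young graph $\widetilde{\mathbb{Y}}$, and let $\hat\varphi:\Gamma\to\mathbb{R}$ be the linear functional with $\hat\varphi(\tilde G_\lambda):=\varphi(\lambda)$ for all partitions $\lambda$. Then $\varphi\in\partial\widetilde{\mathbb{Y}}$ (i.e. $\varphi$ is an extreme point of $H(\widetilde{\mathbb{Y}})$) if and only if $\hat\varphi$ is a normalized $G$-positive homomorphism of $\Gamma$.
   Context: Let $\mathcal{P}$ be the set of partitions. The filtered Young graph $\widetilde{\mathbb{Y}}$ has vertex set $\mathcal{P}$ and an arc $\lambda\to\mu$ iff $\lambda\subset\mu$, $\mu\neq\lambda$, and the skew shape $\mu/\lambda$ is a rook strip, i.e. no two of its boxes lie in the same row or in the same column. A function $\varphi:\mathcal{P}\to\mathbb{R}_{\ge0}$ is harmonic on $\widetilde{\mathbb{Y}}$ if $\varphi(\varnothing)=1$ and $\varphi(\lambda)=\sum_{\mu:\lambda\to\mu}\varphi(\mu)$ for all $\lambda$. $H(\widetilde{\mathbb{Y}})$ is the convex set of harmonic functions, and the boundary $\partial\widetilde{\mathbb{Y}}$ is the set of its extreme points (those not expressible as nontrivial convex combinations of other harmonic functions). A set-valued tableau of shape $\lambda$ is a filling of the boxes of the Young diagram of $\lambda$ (English notation) by nonempty finite sets of positive integers such that replacing each set by any one of its elements always gives a semistandard Young tableau. Define the formal power series in $x_1,x_2,\ldots$ by $\tilde G_\lambda=\sum_T\prod_{i\ge1}x_i^{\#\,i\text{ in }T}$,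 the sum being over all set-valued tableaux $T$ of shape $\lambda$ ($\tilde G_\varnothing=1$). The $\tilde G_\lambda$ are linearly independent, and every product $\tilde G_\mu\tilde G_\nu$ is a finite linear combination of the $\tilde G_\lambda$ with nonnegative integer coefficients. Hence $\Gamma:=\bigoplus_\lambda\mathbb{R}\cdot\tilde G_\lambda$ is a commutative unital $\mathbb{R}$-algebra. A homomorphism $\psi:\Gamma\to\mathbb{R}$ (unital, $\mathbb{R}$-algebra) is $G$-positive if $\psi(\tilde G_\lambda)\ge0$ for all partitions $\lambda$, and normalized if $\psi(\tilde G_{(1)})=1$. *)

theory Defs
  imports "HOL-Analysis.Analysis" "HOL-Library.Multiset" "HOL-Library.Function_Algebras"
begin

section \<open>Partitions and the filtered Young graph\<close>

text \<open>
  A partition is the infinite sequence of its parts, padded with zeros.  Rows and columns are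
  counted from 0, so \<open>part \<kappa> i\<close> is the length of row \<open>i\<close> of the Young diagram.
\<close>

typedef partition = "{p :: nat \<Rightarrow> nat. antimono p \<and> finite {i. p i \<noteq> 0}}"
  morphisms part Partition
  by (rule exI[of _ "\<lambda>_. 0"]) (auto simp: antimono_def)

definition empty_partition :: partition where
  "empty_partition = Partition (\<lambda>_. 0)"

definition one_box :: partition where
  "one_box = Partition (\<lambda>i. if i = 0 then 1 else 0)"

definition diagram :: "partition \<Rightarrow> (nat \<times> nat) set" where
  "diagram \<kappa> = {(i, j). j < part \<kappa> i}"

definition rook_strip :: "(nat \<times> nat) set \<Rightarrow> bool" where
  "rook_strip S \<longleftrightarrow> (\<forall>b\<in>S. \<forall>c\<in>S. b \<noteq> c \<longrightarrow> fst b \<noteq> fst c \<and> snd b \<noteq> snd c)"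

definition young_arc :: "partition \<Rightarrow> partition \<Rightarrow> bool" where
  "young_arc \<kappa> \<mu> \<longleftrightarrow>
     diagram \<kappa> \<subseteq> diagram \<mu> \<and> \<mu> \<noteq> \<kappa> \<and> rook_strip (diagram \<mu> - diagram \<kappa>)"

lemma part_antimono: "i \<le> j \<Longrightarrow> part \<kappa> j \<le> part \<kappa> i"
  using part[of \<kappa>] by (auto simp: antimono_def)

lemma finite_part_support: "finite {i. part \<kappa> i \<noteq> 0}"
  using part[of \<kappa>] by auto

lemma part_empty_partition [simp]: "part empty_partition i = 0"
  unfolding empty_partition_def by (subst Partition_inverse) (auto simp: antimono_def)

lemma part_one_box [simp]: "part one_box i = (if i = 0 then 1 else 0)"
  unfolding one_box_def by (subst Partition_inverse) (auto simp: antimono_def)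

lemma diagram_empty_partition [simp]: "diagram empty_partition = {}"
  by (simp add: diagram_def)

lemma diagram_one_box [simp]: "diagram one_box = {(0, 0)}"
  by (auto simp: diagram_def split: if_splits)

lemma finite_diagram [simp]: "finite (diagram \<kappa>)"
proof -
  have "diagram \<kappa> \<subseteq> (SIGMA i:{i. part \<kappa> i \<noteq> 0}. {..<part \<kappa> i})"
    by (auto simp: diagram_def)
  then show ?thesis
    using finite_part_support by (rule finite_subset[OF _ finite_SigmaI]) auto
qed

lemma young_arc_part_bounds:
  assumes "young_arc \<kappa> \<mu>"
  shows "part \<mu> i \<le> part \<kappa> i + 1" and "part \<kappa> i = 0 \<Longrightarrow> part \<mu> (Suc i) = 0"
proof -
  have rook: "rook_strip (diagram \<mu> - diagram \<kappa>)"
    using assms by (simp add: young_arc_def)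
  show "part \<mu> i \<le> part \<kappa> i + 1"
  proof (rule ccontr)
    assume "\<not> part \<mu> i \<le> part \<kappa> i + 1"
    then have "(i, part \<kappa> i) \<in> diagram \<mu> - diagram \<kappa>"
      "(i, part \<kappa> i + 1) \<in> diagram \<mu> - diagram \<kappa>"
      by (auto simp: diagram_def)
    then show False
      using rook[unfolded rook_strip_def, rule_format, of "(i, part \<kappa> i)" "(i, part \<kappa> i + 1)"] by simp
  qed
  assume 0: "part \<kappa> i = 0"
  show "part \<mu> (Suc i) = 0"
  proof (rule ccontr)
    assume "part \<mu> (Suc i) \<noteq> 0"
    moreover have "part \<mu> (Suc i) \<le> part \<mu> i" "part \<kappa> (Suc i) \<le> part \<kappa> i"
      by (simp_all add: part_antimono)
    ultimately have "(i, 0) \<in> diagram \<mu> - diagram \<kappa>" "(Suc i, 0) \<in> diagram \<mu> - diagram \<kappa>"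
      using 0 by (auto simp: diagram_def)
    then show False
      using rook[unfolded rook_strip_def, rule_format, of "(i, 0)" "(Suc i, 0)"] by simp
  qed
qed

text \<open>Hence the sum in the definition of harmonicity below ranges over a finite set.\<close>

lemma finite_young_arcs: "finite {\<mu>. young_arc \<kappa> \<mu>}"
proof -
  obtain n where n: "\<And>i. part \<kappa> i \<noteq> 0 \<Longrightarrow> i < n"
    using finite_part_support[of \<kappa>] by (auto simp: finite_nat_set_iff_bounded)
  define B where "B = part \<kappa> 0 + 1"
  have sub: "part ` {\<mu>. young_arc \<kappa> \<mu>} \<subseteq>
      {f. \<forall>i. (i \<in> {..n} \<longrightarrow> f i \<in> {..B}) \<and> (i \<notin> {..n} \<longrightarrow> f i = 0)}"
  proof clarify
    fix \<mu> i assume arc: "young_arc \<kappa> \<mu>"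
    have "part \<mu> i \<le> B"
      using young_arc_part_bounds(1)[OF arc, of i] part_antimono[of 0 i \<kappa>] by (simp add: B_def)
    moreover have "part \<mu> i = 0" if "n < i"
    proof -
      obtain k where k: "i = Suc k" using \<open>n < i\<close> by (cases i) auto
      with \<open>n < i\<close> n[of k] have "part \<kappa> k = 0" by fastforce
      then show ?thesis using young_arc_part_bounds(2)[OF arc, of k] k by simp
    qed
    ultimately show "(i \<in> {..n} \<longrightarrow> part \<mu> i \<in> {..B}) \<and> (i \<notin> {..n} \<longrightarrow> part \<mu> i = 0)"
      by auto
  qed
  have "finite {f :: nat \<Rightarrow> nat. \<forall>i. (i \<in> {..n} \<longrightarrow> f i \<in> {..B}) \<and> (i \<notin> {..n} \<longrightarrow> f i = 0)}"
    by (rule finite_set_of_finite_funs) auto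
  with sub have "finite (part ` {\<mu>. young_arc \<kappa> \<mu>})"
    by (rule finite_subset)
  then show ?thesis
    by (rule finite_imageD) (auto simp: inj_on_def part_inject)
qed


section \<open>Harmonic functions and the boundary\<close>

instantiation "fun" :: (type, real_vector) real_vector
begin

definition scaleR_fun :: "real \<Rightarrow> ('a \<Rightarrow> 'b) \<Rightarrow> 'a \<Rightarrow> 'b" where
  "scaleR_fun c f = (\<lambda>x. c *\<^sub>R f x)"

instance
  by standard (auto simp: scaleR_fun_def fun_eq_iff scaleR_add_right scaleR_add_left)

end

definition harmonic_functions :: "(partition \<Rightarrow> real) set" where
  "harmonic_functions =
     {\<phi>. (\<forall>\<kappa>. 0 \<le> \<phi> \<kappa>) \<and> \<phi> empty_partition = 1 \<and>
          (\<forall>\<kappa>. \<phi> \<kappa> = (\<Sum>\<mu> | young_arc \<kappa> \<mu>. \<phi> \<mu>))}"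

definition young_boundary :: "(partition \<Rightarrow> real) set" where
  "young_boundary = {\<phi>. \<phi> extreme_point_of harmonic_functions}"


section \<open>Formal power series in infinitely many variables\<close>

text \<open>
  Monomials are finite multisets of variable indices: the multiset \<open>M\<close> stands for the product of
  the \<open>x\<^sub>i\<close> with exponents \<open>count M i\<close>.  All natural numbers are allowed as indices; the variable
  \<open>x\<^sub>0\<close> does not occur in any of the series considered below.
\<close>

typedef power_series = "UNIV :: (nat multiset \<Rightarrow> real) set"
  morphisms coefficient Power_Series ..

setup_lifting type_definition_power_series

lemma finite_submultisets: "finite {A. A \<subseteq># (M :: 'a multiset)}"
proof (induction M)
  case (add x M)
  have "{A. A \<subseteq># add_mset x M} \<subseteq> {A. A \<subseteq># M} \<union> add_mset x ` {A. A \<subseteq># M}"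
  proof
    fix A assume A: "A \<in> {A. A \<subseteq># add_mset x M}"
    show "A \<in> {A. A \<subseteq># M} \<union> add_mset x ` {A. A \<subseteq># M}"
    proof (cases "x \<in># A")
      case True
      then obtain B where "A = add_mset x B" by (metis mset_add)
      with A show ?thesis by auto
    next
      case False
      have "count A y \<le> count M y" for y
      proof (cases "y = x")
        case False
        then show ?thesis using A mset_subset_eq_count[of A "add_mset x M" y] by simp
      qed (use \<open>x \<notin># A\<close> in \<open>simp add: not_in_iff\<close>)
      then have "A \<subseteq># M" by (simp add: subseteq_mset_def)
      then show ?thesis by simp
    qed
  qed
  with add show ?case by (meson finite_UnI finite_imageI finite_subset)
qed simp

lemma finite_mset_decompositions: "finite {(A, B). A + B = (M :: 'a multiset)}"
proof (rule finite_subset)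
  show "{(A, B). A + B = M} \<subseteq> {A. A \<subseteq># M} \<times> {B. B \<subseteq># M}" by auto
  show "finite ({A. A \<subseteq># M} \<times> {B. B \<subseteq># M})"
    by (simp add: finite_submultisets)
qed

lemma sum_mset_decompositions:
  "(\<Sum>(A, B) | A + B = (M :: 'a multiset). f A B) = (\<Sum>A | A \<subseteq># M. f A (M - A) :: real)"
  by (rule sum.reindex_bij_witness[of _ "\<lambda>A. (A, M - A)" fst]) auto

instantiation power_series :: "{comm_ring_1, real_algebra_1}"
begin

lift_definition zero_power_series :: power_series is "\<lambda>_. 0" .
lift_definition one_power_series :: power_series is "\<lambda>M. if M = {#} then 1 else 0" .
lift_definition plus_power_series :: "power_series \<Rightarrow> power_series \<Rightarrow> power_series"
  is "\<lambda>f g M. f M + g M" .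
lift_definition minus_power_series :: "power_series \<Rightarrow> power_series \<Rightarrow> power_series"
  is "\<lambda>f g M. f M - g M" .
lift_definition uminus_power_series :: "power_series \<Rightarrow> power_series" is "\<lambda>f M. - f M" .
lift_definition scaleR_power_series :: "real \<Rightarrow> power_series \<Rightarrow> power_series"
  is "\<lambda>c f M. c * f M" .
lift_definition times_power_series :: "power_series \<Rightarrow> power_series \<Rightarrow> power_series"
  is "\<lambda>f g M. \<Sum>(A, B) | A + B = M. f A * g B" .

instance
proof
  fix a b c :: power_series and r s :: real
  show "a * b * c = a * (b * c)"
  proof transfer
    fix f g h :: "nat multiset \<Rightarrow> real"
    show "(\<lambda>M. \<Sum>(D, C) | D + C = M. (\<Sum>(A, B) | A + B = D. f A * g B) * h C)
        = (\<lambda>M. \<Sum>(A, D) | A + D = M. f A * (\<Sum>(B, C) | B + C = D. g B * h C))"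
    proof
      fix M :: "nat multiset"
      have "(\<Sum>(D, C) | D + C = M. (\<Sum>(A, B) | A + B = D. f A * g B) * h C)
          = (\<Sum>p\<in>{(D, C). D + C = M}. \<Sum>q\<in>{(A, B). A + B = fst p}.
               f (fst q) * g (snd q) * h (snd p))"
        by (simp add: case_prod_unfold sum_distrib_right)
      also have "\<dots> = (\<Sum>(p, q)\<in>(SIGMA p:{(D, C). D + C = M}. {(A, B). A + B = fst p}).
               f (fst q) * g (snd q) * h (snd p))"
        by (rule sum.Sigma) (auto simp: finite_mset_decompositions)
      also have "\<dots> = (\<Sum>(p, q)\<in>(SIGMA p:{(A, D). A + D = M}. {(B, C). B + C = snd p}).
               f (fst p) * (g (fst q) * h (snd q)))"
        by (rule sum.reindex_bij_witness[of _
              "\<lambda>((A, D), (B, C)). ((A + B, C), (A, B))" "\<lambda>((D, C), (A, B)). ((A, B + C), (B, C))"])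
           (auto simp: add_ac mult_ac)
      also have "\<dots> = (\<Sum>p\<in>{(A, D). A + D = M}. \<Sum>q\<in>{(B, C). B + C = snd p}.
               f (fst p) * (g (fst q) * h (snd q)))"
        by (rule sum.Sigma[symmetric]) (auto simp: finite_mset_decompositions)
      also have "\<dots> = (\<Sum>(A, D) | A + D = M. f A * (\<Sum>(B, C) | B + C = D. g B * h C))"
        by (simp add: case_prod_unfold sum_distrib_left)
      finally show "(\<Sum>(D, C) | D + C = M. (\<Sum>(A, B) | A + B = D. f A * g B) * h C)
          = (\<Sum>(A, D) | A + D = M. f A * (\<Sum>(B, C) | B + C = D. g B * h C))" .
    qed
  qed
  show comm: "a * b = b * a" for a b :: power_series
    by transfer (rule ext, rule sum.reindex_bij_witness[of _ prod.swap prod.swap],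
        auto simp: add_ac mult_ac)
  show one: "1 * a = a" for a :: power_series
  proof transfer
    fix f :: "nat multiset \<Rightarrow> real"
    have "(\<Sum>A | A \<subseteq># M. (if A = {#} then 1 else 0) * f (M - A)) = f M" for M
    proof -
      have "(\<Sum>A | A \<subseteq># M. (if A = {#} then 1 else 0) * f (M - A))
          = (\<Sum>A\<in>{{#}}. (if A = {#} then 1 else 0) * f (M - A))"
        by (rule sum.mono_neutral_right) (auto simp: finite_submultisets)
      then show ?thesis by simp
    qed
    then show "(\<lambda>M. \<Sum>(A, B) | A + B = M. (if A = {#} then 1 else 0) * f B) = f"
      by (simp add: fun_eq_iff sum_mset_decompositions)
  qed
  show distrib: "(a + b) * c = a * c + b * c" for a b c :: power_series
    by transfer (simp add: case_prod_unfold distrib_right sum.distrib)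
  show "a * 1 = a" "a * (b + c) = a * b + a * c"
    by (simp_all add: comm[of a] one distrib)
  show "r *\<^sub>R a * b = r *\<^sub>R (a * b)"
    by transfer (simp add: case_prod_unfold sum_distrib_left mult_ac)
  show "a * r *\<^sub>R b = r *\<^sub>R (a * b)"
    by transfer (simp add: case_prod_unfold sum_distrib_left mult_ac)
  show "(0 :: power_series) \<noteq> 1"
    by transfer (auto dest: fun_cong[of _ _ "{#}"])
  show "a + b + c = a + (b + c)" "a + b = b + a" "0 + a = a" "- a + a = 0" "a - b = a + - b"
    by (transfer; simp add: add_ac)+
  show "r *\<^sub>R (a + b) = r *\<^sub>R a + r *\<^sub>R b" "(r + s) *\<^sub>R a = r *\<^sub>R a + s *\<^sub>R a"
    "r *\<^sub>R s *\<^sub>R a = (r * s) *\<^sub>R a" "1 *\<^sub>R a = a"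
    by (transfer; simp add: algebra_simps)+
qed

end


section \<open>Set-valued tableaux and the algebra \<open>\<Gamma_alg>\<close>\<close>

text \<open>
  Fillings are functions on all of \<open>nat \<times> nat\<close>.  For set-valued tableaux the value outside the
  diagram is fixed to be \<open>{}\<close>, so that distinct functions are distinct tableaux.
\<close>

definition semistandard :: "partition \<Rightarrow> (nat \<times> nat \<Rightarrow> nat) \<Rightarrow> bool" where
  "semistandard \<kappa> t \<longleftrightarrow>
     (\<forall>b\<in>diagram \<kappa>. 0 < t b) \<and>
     (\<forall>i j. (i, Suc j) \<in> diagram \<kappa> \<longrightarrow> t (i, j) \<le> t (i, Suc j)) \<and>
     (\<forall>i j. (Suc i, j) \<in> diagram \<kappa> \<longrightarrow> t (i, j) < t (Suc i, j))"

definition set_valued_tableau :: "partition \<Rightarrow> (nat \<times> nat \<Rightarrow> nat set) \<Rightarrow> bool" where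
  "set_valued_tableau \<kappa> T \<longleftrightarrow>
     (\<forall>b\<in>diagram \<kappa>. T b \<noteq> {} \<and> finite (T b) \<and> T b \<subseteq> {1..}) \<and>
     (\<forall>b. b \<notin> diagram \<kappa> \<longrightarrow> T b = {}) \<and>
     (\<forall>t. (\<forall>b\<in>diagram \<kappa>. t b \<in> T b) \<longrightarrow> semistandard \<kappa> t)"

text \<open>The monomial of a tableau: \<open>i\<close> occurs once for every box whose set contains \<open>i\<close>.\<close>

definition tableau_weight :: "partition \<Rightarrow> (nat \<times> nat \<Rightarrow> nat set) \<Rightarrow> nat multiset" where
  "tableau_weight \<kappa> T = (\<Sum>b\<in>diagram \<kappa>. mset_set (T b))"

text \<open>
  The sum of the monomials of all tableaux is taken coefficientwise; each monomial is the weight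
  of only finitely many tableaux.
\<close>

definition G_tilde :: "partition \<Rightarrow> power_series" where
  "G_tilde \<kappa> = Power_Series
     (\<lambda>M. real (card {T. set_valued_tableau \<kappa> T \<and> tableau_weight \<kappa> T = M}))"

lemma finite_tableaux_of_weight:
  "finite {T. set_valued_tableau \<kappa> T \<and> tableau_weight \<kappa> T = M}"
proof (rule finite_subset)
  show "{T. set_valued_tableau \<kappa> T \<and> tableau_weight \<kappa> T = M} \<subseteq>
      {T. \<forall>b. (b \<in> diagram \<kappa> \<longrightarrow> T b \<in> Pow (set_mset M)) \<and> (b \<notin> diagram \<kappa> \<longrightarrow> T b = {})}"
    by (auto simp: set_valued_tableau_def tableau_weight_def set_mset_sum)
  show "finite {T. \<forall>b. (b \<in> diagram \<kappa> \<longrightarrow> T b \<in> Pow (set_mset M)) \<and>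
      (b \<notin> diagram \<kappa> \<longrightarrow> T b = {})}"
    by (rule finite_set_of_finite_funs) auto
qed

lemma count_tableau_weight:
  assumes "set_valued_tableau \<kappa> T"
  shows "count (tableau_weight \<kappa> T) i = card {b \<in> diagram \<kappa>. i \<in> T b}"
proof -
  have "count (tableau_weight \<kappa> T) i = (\<Sum>b\<in>diagram \<kappa>. if i \<in> T b then 1 else 0)"
    unfolding tableau_weight_def count_sum
    by (rule sum.cong) (use assms in \<open>auto simp: set_valued_tableau_def count_mset_set'\<close>)
  then show ?thesis by (simp add: sum.If_cases Int_def)
qed

lemma G_tilde_empty: "G_tilde empty_partition = 1"
proof -
  have "{T. set_valued_tableau empty_partition T \<and> tableau_weight empty_partition T = M}
      = (if M = {#} then {\<lambda>_. {}} else {})" for M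
    by (auto simp: set_valued_tableau_def tableau_weight_def semistandard_def)
  then show ?thesis
    unfolding G_tilde_def one_power_series_def by (intro arg_cong[of _ _ Power_Series]) auto
qed

definition Gamma_alg :: "power_series set" where
  "Gamma_alg = span (range G_tilde)"

text \<open>
  A functional on \<open>\<Gamma_alg>\<close> is represented by a function on all power series; only its values on \<open>\<Gamma_alg>\<close>
  matter.
\<close>

definition linear_on_Gamma :: "(power_series \<Rightarrow> real) \<Rightarrow> bool" where
  "linear_on_Gamma \<psi> \<longleftrightarrow>
     (\<forall>f\<in>Gamma_alg. \<forall>g\<in>Gamma_alg. \<psi> (f + g) = \<psi> f + \<psi> g) \<and>
     (\<forall>c. \<forall>f\<in>Gamma_alg. \<psi> (c *\<^sub>R f) = c * \<psi> f)"

definition Gamma_hom :: "(power_series \<Rightarrow> real) \<Rightarrow> bool" where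
  "Gamma_hom \<psi> \<longleftrightarrow>
     linear_on_Gamma \<psi> \<and> \<psi> 1 = 1 \<and> (\<forall>f\<in>Gamma_alg. \<forall>g\<in>Gamma_alg. \<psi> (f * g) = \<psi> f * \<psi> g)"

definition G_positive :: "(power_series \<Rightarrow> real) \<Rightarrow> bool" where
  "G_positive \<psi> \<longleftrightarrow> (\<forall>\<kappa>. 0 \<le> \<psi> (G_tilde \<kappa>))"

definition normalized :: "(power_series \<Rightarrow> real) \<Rightarrow> bool" where
  "normalized \<psi> \<longleftrightarrow> \<psi> (G_tilde one_box) = 1"

end

theory Submission
  imports Defs
begin

text \<open>
  The product \<open>G\<^sub>\<nu> G\<^sub>\<mu>\<close> is expanded positively by a \<open>K\<close>-theoretic version of Stembridge's proof of the
  Littlewood--Richardson rule: in \<open>n\<close> variables, multiplying the bialternant numerator of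
  \<open>G\<^sub>\<nu>\<close> by \<open>G\<^sub>\<mu>\<close> gives a sum of alternants over all set-valued tableaux of shape \<open>\<mu>\<close>, in which
  the tableaux violating the Yamanouchi condition cancel in groups of four (exchange \<open>k\<close> and
  \<open>k + 1\<close> to the left of the first violation, and toggle one \<open>k\<close>).  The case of one box is the
  Pieri rule, which says that harmonic functions are the normalized positive functionals on \<open>\<Gamma>\<close>
  that are invariant under multiplication by \<open>G\<^sub>1\<close>.

  If \<open>\<phi>\<close> is extreme and \<open>0 < \<phi> c < 1\<close> for a basis element \<open>c\<close>, then
  \<open>f \<mapsto> \<phi> (f c) / \<phi> c\<close> is harmonic and \<open>\<phi>\<close> is a convex combination of it and another harmonic
  function, so \<open>\<phi>\<close> is multiplicative.  Conversely, \<open>\<psi> (c\<^sup>2) \<ge> \<psi> (c)\<^sup>2\<close> holds for all harmonic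
  \<open>\<psi>\<close>; for a homomorphism \<open>\<phi> = (1 - u) \<alpha> + u \<beta>\<close>, strict convexity of the square then forces
  \<open>\<alpha> c = \<beta> c\<close>.
\<close>

section \<open>Set-valued tableaux and the Bender--Knuth move\<close>

text \<open>Two obstacles shape the proof. First, det (x_i^\<alpha>_j (1 + x_i)^(j - 1)) is not
  antisymmetric in \<alpha>, because the twist depends on the position j. Since x^a (1 + x)^(k - 1)
  + x^(a + 1) (1 + x)^(k - 1) = x^a (1 + x)^k, adding the term with \<alpha>_k raised by one gives
  the positions k and k + 1 the same twist. So only such pairs change sign, and a tableau must be
  joined with one having an extra k before two of them can cancel. The identities are then evaluated
  at powers of a single variable t, where the common denominator can be cancelled.

  Second, \<psi> (c^2) \<ge> \<psi> (c)^2 is not Cauchy-Schwarz: \<psi> is nonnegative on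
  combinations of the G_\<lambda> with nonnegative coefficients, and (c - s)^2 need not be one. It
  would be Jensen's inequality if \<psi> were an average of multiplicative functionals, but that
  asks for a Choquet representation. Instead the infimum of the defect \<psi> (c^2) - \<psi> (c)^2
  over all such functionals is shown to be nonnegative by conditioning. The complement of c needed
  for this exists because some power of G_1 dominates c, and powers of G_1 act as 1.\<close>

lemma diagram_iff: "(r, c) \<in> diagram \<kappa> \<longleftrightarrow> c < part \<kappa> r"
  by (simp add: diagram_def)

lemma diagram_down_closed:
  assumes "(r, c) \<in> diagram \<kappa>" "r' \<le> r" "c' \<le> c"
  shows "(r', c') \<in> diagram \<kappa>"
  using assms part_antimono[of r' r \<kappa>] by (auto simp: diagram_iff)

text \<open>Selections are independent across boxes: entries \<open>x\<close>, \<open>y\<close> of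
  two different boxes occur together in some selection, so a condition on all selections decouples
  into one on adjacent pairs. Outer boxes are empty, so the last two clauses can range over all
  pairs.\<close>

lemma set_valued_tableau_iff:
  "set_valued_tableau \<kappa> T \<longleftrightarrow>
     (\<forall>b\<in>diagram \<kappa>. T b \<noteq> {} \<and> finite (T b) \<and> T b \<subseteq> {1..}) \<and>
     (\<forall>b. b \<notin> diagram \<kappa> \<longrightarrow> T b = {}) \<and>
     (\<forall>r c x y. x \<in> T (r, c) \<longrightarrow> y \<in> T (r, Suc c) \<longrightarrow> x \<le> y) \<and>
     (\<forall>r c x y. x \<in> T (r, c) \<longrightarrow> y \<in> T (Suc r, c) \<longrightarrow> x < y)"
  (is "?L \<longleftrightarrow> ?A \<and> ?B \<and> ?C \<and> ?D")
proof
  assume L: ?L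
  then have A: ?A and B: ?B
    and ss: "\<And>t. (\<forall>b\<in>diagram \<kappa>. t b \<in> T b) \<Longrightarrow> semistandard \<kappa> t"
    by (auto simp: set_valued_tableau_def)
  have choose: "\<exists>t. (\<forall>b\<in>diagram \<kappa>. t b \<in> T b) \<and> t b1 = x \<and> t b2 = y"
    if "x \<in> T b1" "y \<in> T b2" "b1 \<noteq> b2" for b1 b2 x y
    by (rule exI[of _ "(\<lambda>b. SOME z. z \<in> T b)(b1 := x, b2 := y)"])
      (use that A in \<open>auto simp: some_in_eq\<close>)
  have mem: "b \<in> diagram \<kappa>" if "x \<in> T b" for x b
    using B that by blast
  have ?C
  proof (intro allI impI)
    fix r c x y assume "x \<in> T (r, c)" and y: "y \<in> T (r, Suc c)"
    then obtain t where t: "\<forall>b\<in>diagram \<kappa>. t b \<in> T b" "t (r, c) = x" "t (r, Suc c) = y"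
      using choose[of x "(r, c)" y "(r, Suc c)"] by auto
    then show "x \<le> y"
      using ss[OF t(1)] mem[OF y] by (auto simp: semistandard_def)
  qed
  moreover have ?D
  proof (intro allI impI)
    fix r c x y assume "x \<in> T (r, c)" and y: "y \<in> T (Suc r, c)"
    then obtain t where t: "\<forall>b\<in>diagram \<kappa>. t b \<in> T b" "t (r, c) = x" "t (Suc r, c) = y"
      using choose[of x "(r, c)" y "(Suc r, c)"] by auto
    then show "x < y"
      using ss[OF t(1)] mem[OF y] by (auto simp: semistandard_def)
  qed
  ultimately show "?A \<and> ?B \<and> ?C \<and> ?D"
    using A B by blast
next
  assume R: "?A \<and> ?B \<and> ?C \<and> ?D"
  have "semistandard \<kappa> t" if t: "\<forall>b\<in>diagram \<kappa>. t b \<in> T b" for t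
    unfolding semistandard_def
  proof (intro conjI allI impI ballI)
    fix b assume "b \<in> diagram \<kappa>"
    then have "t b \<in> {1..}" using t R by blast
    then show "0 < t b" by simp
  next
    fix i j assume d: "(i, Suc j) \<in> diagram \<kappa>"
    have "(i, j) \<in> diagram \<kappa>" by (rule diagram_down_closed[OF d]) auto
    with d t have "t (i, j) \<in> T (i, j)" "t (i, Suc j) \<in> T (i, Suc j)" by auto
    with R show "t (i, j) \<le> t (i, Suc j)" by metis
  next
    fix i j assume d: "(Suc i, j) \<in> diagram \<kappa>"
    have "(i, j) \<in> diagram \<kappa>" by (rule diagram_down_closed[OF d]) auto
    with d t have "t (i, j) \<in> T (i, j)" "t (Suc i, j) \<in> T (Suc i, j)" by auto
    with R show "t (i, j) < t (Suc i, j)" by metis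
  qed
  moreover have ?A ?B using R by (rule conjunct1, rule conjunct1[OF conjunct2])
  ultimately show ?L unfolding set_valued_tableau_def by (intro conjI) (assumption | rule allI impI)+
qed

lemma tableau_in_diagram: "set_valued_tableau \<kappa> T \<Longrightarrow> x \<in> T b \<Longrightarrow> b \<in> diagram \<kappa>"
  unfolding set_valued_tableau_def by blast

lemma tableau_nonempty:
  assumes "set_valued_tableau \<kappa> T" "b \<in> diagram \<kappa>" obtains x where "x \<in> T b"
  using assms unfolding set_valued_tableau_def by blast

lemma tableau_entry_pos: "set_valued_tableau \<kappa> T \<Longrightarrow> x \<in> T b \<Longrightarrow> 1 \<le> x"
  unfolding set_valued_tableau_def by (metis atLeast_iff empty_iff subsetD)

lemma tableau_row:
  assumes T: "set_valued_tableau \<kappa> T" and "x \<in> T (r, c)" "y \<in> T (r, c')" "c < c'"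
  shows "x \<le> y"
  using \<open>c < c'\<close> \<open>y \<in> T (r, c')\<close>
proof (induction c' arbitrary: y rule: less_induct)
  case (less c')
  then obtain d where d: "c' = Suc d" by (cases c') auto
  show ?case
  proof (cases "d = c")
    case True
    then show ?thesis using T assms(2) less.prems d by (auto simp: set_valued_tableau_iff)
  next
    case False
    have "(r, d) \<in> diagram \<kappa>"
      using tableau_in_diagram[OF T less.prems(2)] d by (auto intro: diagram_down_closed)
    then obtain z where z: "z \<in> T (r, d)" using T tableau_nonempty by blast
    then have "z \<le> y" using T less.prems d by (auto simp: set_valued_tableau_iff)
    moreover have "x \<le> z" using less.IH[of d z] z False less.prems d by auto
    ultimately show ?thesis by simp
  qed
qed

lemma tableau_col:
  assumes T: "set_valued_tableau \<kappa> T" and "x \<in> T (r, c)" "y \<in> T (r', c)" "r < r'"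
  shows "x < y"
  using \<open>r < r'\<close> \<open>y \<in> T (r', c)\<close>
proof (induction r' arbitrary: y rule: less_induct)
  case (less r')
  then obtain d where d: "r' = Suc d" by (cases r') auto
  show ?case
  proof (cases "d = r")
    case True
    then show ?thesis using T assms(2) less.prems d by (auto simp: set_valued_tableau_iff)
  next
    case False
    have "(d, c) \<in> diagram \<kappa>"
      using tableau_in_diagram[OF T less.prems(2)] d by (auto intro: diagram_down_closed)
    then obtain z where z: "z \<in> T (d, c)" using T tableau_nonempty by blast
    then have "z < y" using T less.prems d by (auto simp: set_valued_tableau_iff)
    moreover have "x < z" using less.IH[of d z] z False less.prems d by auto
    ultimately show ?thesis by simp
  qed
qed

lemma tableau_row_ge: "set_valued_tableau \<kappa> T \<Longrightarrow> x \<in> T (r, c) \<Longrightarrow> Suc r \<le> x"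
proof (induction r arbitrary: x)
  case 0
  then show ?case using tableau_entry_pos by fastforce
next
  case (Suc r)
  have "(r, c) \<in> diagram \<kappa>"
    using tableau_in_diagram[OF Suc.prems] by (auto intro: diagram_down_closed)
  then obtain z where z: "z \<in> T (r, c)" using Suc.prems(1) tableau_nonempty by blast
  then have "z < x" using tableau_col[OF Suc.prems(1) z Suc.prems(2)] by simp
  with Suc.IH[OF Suc.prems(1) z] show ?case by simp
qed

text \<open>The content of the columns from \<open>J\<close> on, that is, of the word read by the
  time column \<open>J\<close> is finished. For a tableau, \<open>J = 0\<close> gives the exponents
  of its monomial.\<close>

definition cell_count :: "(nat \<times> nat \<Rightarrow> nat set) \<Rightarrow> nat \<Rightarrow> nat \<Rightarrow> nat" where
  "cell_count T J i = card {b. J \<le> snd b \<and> i \<in> T b}"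

lemma finite_cells [simp]:
  assumes "set_valued_tableau \<kappa> T" shows "finite {b. P b \<and> i \<in> T b}"
  by (rule finite_subset[OF _ finite_diagram[of \<kappa>]]) (use assms tableau_in_diagram in blast)

text \<open>Columns are strict, so a column holds a letter at most once.\<close>

lemma cell_count_split:
  assumes T: "set_valued_tableau \<kappa> T"
  shows "cell_count T J i = cell_count T (Suc J) i + (if \<exists>r. i \<in> T (r, J) then 1 else 0)"
proof -
  have "{b. J \<le> snd b \<and> i \<in> T b} = {b. Suc J \<le> snd b \<and> i \<in> T b} \<union> {b. snd b = J \<and> i \<in> T b}"
    by auto
  moreover have "card ({b. Suc J \<le> snd b \<and> i \<in> T b} \<union> {b. snd b = J \<and> i \<in> T b})
    = card {b. Suc J \<le> snd b \<and> i \<in> T b} + card {b. snd b = J \<and> i \<in> T b}"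
    using T by (intro card_Un_disjoint) auto
  moreover have "card {b. snd b = J \<and> i \<in> T b} = (if \<exists>r. i \<in> T (r, J) then 1 else 0)"
  proof (cases "\<exists>r. i \<in> T (r, J)")
    case True
    then obtain r where r: "i \<in> T (r, J)" by blast
    have *: "i \<in> T (r', J) \<longleftrightarrow> r' = r" for r'
      using tableau_col[OF T r, of i r'] tableau_col[OF T _ r, of i r'] r
      by (cases r' r rule: linorder_cases) auto
    have "(snd b = J \<and> i \<in> T b) \<longleftrightarrow> b = (r, J)" for b
      using *[of "fst b"] by (cases b) auto
    then have "{b. snd b = J \<and> i \<in> T b} = {(r, J)}" by blast
    with True show ?thesis by simp
  next
    case False
    then have "{b. snd b = J \<and> i \<in> T b} = {}" by force
    with False show ?thesis by (simp only: card.empty if_False)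
  qed
  ultimately show ?thesis by (simp add: cell_count_def)
qed

lemma cell_count_0:
  assumes T: "set_valued_tableau \<kappa> T"
  shows "cell_count T 0 i = count (tableau_weight \<kappa> T) i"
  unfolding cell_count_def count_tableau_weight[OF T]
  by (rule arg_cong[of _ _ card]) (use tableau_in_diagram[OF T] in auto)

text \<open>
  In a fixed row, the boxes of the first \<open>J\<close> columns whose contents in \<open>{k, k + 1}\<close> are free form an
  interval; the Bender--Knuth move reflects this interval and exchanges \<open>k\<close> with \<open>k + 1\<close> in it.
\<close>

definition free_cols :: "nat \<Rightarrow> nat \<Rightarrow> (nat \<times> nat \<Rightarrow> nat set) \<Rightarrow> nat \<Rightarrow> nat set" where
  "free_cols J k T r = {c. c < J \<and> T (r, c) \<inter> {k, Suc k} \<noteq> {} \<and>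
     \<not> (k \<in> T (r, c) \<and> Suc k \<in> T (Suc r, c)) \<and>
     \<not> (Suc k \<in> T (r, c) \<and> (\<exists>r'. r = Suc r' \<and> k \<in> T (r', c)))}"

definition reflect :: "nat set \<Rightarrow> nat \<Rightarrow> nat" where
  "reflect F c = Min F + Max F - c"

text \<open>The free boxes of a row carry k, ..., k, then at most one box with both letters, then k
  + 1, ..., k + 1. Reversing such a list and exchanging the letters gives a list of the same kind.
  Moving the whole intersection with \<open>{k, Suc k}\<close> treats the mixed box
  uniformly.\<close>

definition bender_knuth ::
    "nat \<Rightarrow> nat \<Rightarrow> (nat \<times> nat \<Rightarrow> nat set) \<Rightarrow> nat \<times> nat \<Rightarrow> nat set" where
  "bender_knuth J k T = (\<lambda>(r, c).
     if c \<in> free_cols J k T r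
     then (T (r, c) - {k, Suc k}) \<union>
       Transposition.transpose k (Suc k) ` (T (r, reflect (free_cols J k T r) c) \<inter> {k, Suc k})
     else T (r, c))"

lemma reflect_props:
  assumes "finite F" "\<And>a b c. a \<in> F \<Longrightarrow> b \<in> F \<Longrightarrow> a \<le> c \<Longrightarrow> c \<le> b \<Longrightarrow> c \<in> F" "c \<in> F"
  shows "reflect F c \<in> F" "reflect F (reflect F c) = c"
proof -
  have F: "Min F \<in> F" "Max F \<in> F" "Min F \<le> c" "c \<le> Max F"
    using assms(1,3) by (auto intro: Min_in Max_in)
  have "reflect F c \<in> F"
    by (rule assms(2)[OF F(1,2)]) (use F in \<open>auto simp: reflect_def\<close>)
  then show "reflect F c \<in> F" .
  show "reflect F (reflect F c) = c"
    using F(3,4) by (simp add: reflect_def)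
qed

text \<open>Only columns left of \<open>J\<close> move. A \<open>k\<close> turned into
  \<open>k + 1\<close> in column \<open>J - 1\<close> would clash with a \<open>k\<close> in column
  \<open>J\<close>, hence the last assumption. It will hold in two situations: \<open>J\<close> is
  the column of a violation, or the empty column behind the whole tableau.\<close>

locale bender_knuth_setup =
  fixes \<kappa> :: partition and T :: "nat \<times> nat \<Rightarrow> nat set" and J k :: nat
  assumes T: "set_valued_tableau \<kappa> T" and k: "1 \<le> k" and J: "\<And>r. k \<notin> T (r, J)"
begin

abbreviation "F \<equiv> free_cols J k T"
abbreviation "T' \<equiv> bender_knuth J k T"

lemmas row = tableau_row[OF T] and col = tableau_col[OF T]
lemmas in_diag = tableau_in_diagram[OF T]

lemma finite_F [simp]: "finite (F r)"
  by (rule finite_subset[of _ "{..<J}"]) (auto simp: free_cols_def)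

lemma free_entry: "c \<in> F r \<Longrightarrow> k \<in> T (r, c) \<or> Suc k \<in> T (r, c)"
  by (auto simp: free_cols_def)

text \<open>Strictness of the column leaves only \<open>k\<close> above \<open>k + 1\<close>, and
  such a matched pair is what freeness excludes.\<close>

lemma free_no_below:
  assumes "c \<in> F r" shows "T (Suc r, c) \<inter> {k, Suc k} = {}"
proof -
  have False if y: "y \<in> T (Suc r, c)" "y = k \<or> y = Suc k" for y
  proof -
    from assms obtain x where x: "x \<in> T (r, c)" "x = k \<or> x = Suc k" using free_entry by blast
    have "x < y" using col[OF x(1) y(1)] by simp
    with x y have "x = k" "y = Suc k" by auto
    with x y assms show False by (auto simp: free_cols_def)
  qed
  then show ?thesis by blast
qed

lemma free_no_above:
  assumes "c \<in> F (Suc r)" shows "T (r, c) \<inter> {k, Suc k} = {}"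
proof -
  have False if y: "y \<in> T (r, c)" "y = k \<or> y = Suc k" for y
  proof -
    from assms obtain x where x: "x \<in> T (Suc r, c)" "x = k \<or> x = Suc k" using free_entry by blast
    have "y < x" using col[OF y(1) x(1)] by simp
    with x y have "y = k" "x = Suc k" by auto
    with x y assms show False by (auto simp: free_cols_def)
  qed
  then show ?thesis by blast
qed

text \<open>Matched pairs spread to the left: the row and column inequalities squeeze the upper
  entry to \<open>k\<close> and the lower one to \<open>k + 1\<close>. \<open>fixed_right\<close> is
  the mirror image.\<close>

lemma fixed_left:
  assumes "k \<in> T (r, c')" "Suc k \<in> T (Suc r, c')" "c < c'" "x \<in> T (r, c)" "k \<le> x"
  shows "k \<in> T (r, c)" "Suc k \<in> T (Suc r, c)"
proof -
  have "x = k" using row[OF assms(4,1,3)] assms(5) by simp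
  then show 1: "k \<in> T (r, c)" using assms by simp
  have "(Suc r, c) \<in> diagram \<kappa>"
    using in_diag[OF assms(2)] assms(3) by (auto intro: diagram_down_closed)
  then obtain y where y: "y \<in> T (Suc r, c)" using T tableau_nonempty by blast
  have "y \<le> Suc k" using row[OF y assms(2,3)] .
  moreover have "k < y" using col[OF 1 y] by simp
  ultimately show "Suc k \<in> T (Suc r, c)" using y by (metis Suc_leI le_antisym)
qed

lemma fixed_right:
  assumes "k \<in> T (r, c)" "Suc k \<in> T (Suc r, c)" "c < c'" "x \<in> T (Suc r, c')" "x \<le> Suc k"
  shows "Suc k \<in> T (Suc r, c')" "k \<in> T (r, c')"
proof -
  have "x = Suc k" using row[OF assms(2,4,3)] assms(5) by simp
  then show 1: "Suc k \<in> T (Suc r, c')" using assms by simp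
  have "(r, c') \<in> diagram \<kappa>"
    using in_diag[OF 1] by (auto intro: diagram_down_closed)
  then obtain y where y: "y \<in> T (r, c')" using T tableau_nonempty by blast
  have "k \<le> y" using row[OF assms(1) y assms(3)] .
  moreover have "y < Suc k" using col[OF y 1] by simp
  ultimately show "k \<in> T (r, c')" using y by (metis less_Suc_eq_le le_antisym)
qed

text \<open>Between two free boxes all entries lie in \<open>{k, Suc k}\<close>. If the box in
  between were matched with the box below, \<open>fixed_left\<close> would produce a matched pair in
  column \<open>a\<close>; if with the box above, \<open>fixed_right\<close> would produce one in
  column \<open>b\<close>.\<close>

lemma free_interval:
  assumes "a \<in> F r" "b \<in> F r" "a \<le> c" "c \<le> b"
  shows "c \<in> F r"
proof (cases "a = c \<or> c = b")
  case True
  then show ?thesis using assms by auto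
next
  case False
  then have lt: "a < c" "c < b" using assms by auto
  from assms obtain x where x: "x \<in> T (r, a)" "x = k \<or> x = Suc k" using free_entry by blast
  from assms obtain y where y: "y \<in> T (r, b)" "y = k \<or> y = Suc k" using free_entry by blast
  have "(r, c) \<in> diagram \<kappa>"
    using in_diag[OF y(1)] lt by (auto intro: diagram_down_closed)
  then obtain z where z: "z \<in> T (r, c)" using T tableau_nonempty by blast
  have "z = k \<or> z = Suc k" using row[OF x(1) z lt(1)] row[OF z y(1) lt(2)] x y by auto
  moreover have "\<not> (k \<in> T (r, c) \<and> Suc k \<in> T (Suc r, c))"
    using fixed_left[of r c a x] lt x free_no_below[OF assms(1)] by auto
  moreover have "\<not> (Suc k \<in> T (r, c) \<and> (\<exists>r'. r = Suc r' \<and> k \<in> T (r', c)))"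
    using fixed_right[of _ c b y] lt y free_no_above assms(2) by (metis disjoint_insert(1) inf_commute le_refl lessI less_imp_le)
  ultimately show ?thesis
    using z lt assms(2) by (auto simp: free_cols_def)
qed

lemma reflect_mem: "c \<in> F r \<Longrightarrow> reflect (F r) c \<in> F r"
  and reflect_reflect: "c \<in> F r \<Longrightarrow> reflect (F r) (reflect (F r) c) = c"
  by (rule reflect_props[OF finite_F]; blast intro: free_interval)+

lemma bk_free: "c \<in> F r \<Longrightarrow> T' (r, c) = (T (r, c) - {k, Suc k}) \<union>
    Transposition.transpose k (Suc k) ` (T (r, reflect (F r) c) \<inter> {k, Suc k})"
  and bk_unfree: "c \<notin> F r \<Longrightarrow> T' (r, c) = T (r, c)"
  by (auto simp: bender_knuth_def)

lemma bk_other: "x \<noteq> k \<Longrightarrow> x \<noteq> Suc k \<Longrightarrow> x \<in> T' (r, c) \<longleftrightarrow> x \<in> T (r, c)"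
  by (cases "c \<in> F r") (auto simp: bk_free bk_unfree transpose_def split: if_splits)

lemma bk_k: "c \<in> F r \<Longrightarrow> k \<in> T' (r, c) \<longleftrightarrow> Suc k \<in> T (r, reflect (F r) c)"
  and bk_Suc_k: "c \<in> F r \<Longrightarrow> Suc k \<in> T' (r, c) \<longleftrightarrow> k \<in> T (r, reflect (F r) c)"
  by (auto simp: bk_free in_transpose_image_iff)

lemma bk_right: "J \<le> c \<Longrightarrow> T' (r, c) = T (r, c)"
  by (rule bk_unfree) (auto simp: free_cols_def)

text \<open>Inside the free interval a descent after the move would come from a descent before it.
  At either end the neighbouring box is fixed: an offending letter there would belong to a matched
  pair, which spreads into the free box, or would be a \<open>k\<close> in column
  \<open>J\<close>.\<close>

lemma bk_row:
  assumes x: "x \<in> T' (r, c)" and y: "y \<in> T' (r, Suc c)"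
  shows "x \<le> y"
proof -
  note rw = row[of _ r c _ "Suc c"]
  consider "c \<in> F r" "Suc c \<in> F r" | "c \<in> F r" "Suc c \<notin> F r"
    | "c \<notin> F r" "Suc c \<in> F r" | "c \<notin> F r" "Suc c \<notin> F r" by blast
  then show ?thesis
  proof cases
    case 1
    from 1 obtain x0 where x0: "x0 \<in> T (r, c)" "x0 = k \<or> x0 = Suc k" using free_entry by blast
    from 1 obtain y0 where y0: "y0 \<in> T (r, Suc c)" "y0 = k \<or> y0 = Suc k" using free_entry by blast
    have le: "Suc c \<le> Max (F r)" using 1 by simp
    \<comment> \<open>Reflection reverses neighbours: the columns \<open>c\<close> and
      \<open>c + 1\<close> receive the contents of \<open>d + 1\<close> and
      \<open>d\<close>.\<close>
    define d where "d = reflect (F r) (Suc c)"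
    have d: "reflect (F r) c = Suc d" "d \<in> F r"
      using le reflect_mem[OF 1(2)] unfolding d_def reflect_def by auto
    have "reflect (F r) (Suc c) = d" by (simp add: d_def)
    show ?thesis
    proof (cases "x = k \<or> x = Suc k")
      case x': True
      show ?thesis
      proof (cases "y = k \<or> y = Suc k")
        case y': True
        have "\<not> (x = Suc k \<and> y = k)"
        proof
          assume "x = Suc k \<and> y = k"
          then have "k \<in> T (r, Suc d)" "Suc k \<in> T (r, d)"
            using x y bk_k[OF 1(2)] bk_Suc_k[OF 1(1)] d by (auto simp: d_def)
          then show False using row[of "Suc k" r d k "Suc d"] by simp
        qed
        then show ?thesis using x' y' by auto
      next
        case False
        then have "y \<in> T (r, Suc c)" using y bk_other by blast
        then show ?thesis using rw[OF x0(1)] x0 x' False by fastforce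
      qed
    next
      case False
      then have "x \<in> T (r, c)" using x bk_other by blast
      moreover from this have "x \<le> y0" using rw y0 by blast
      ultimately have "x < k" using y0 False by auto
      show ?thesis
      proof (cases "y = k \<or> y = Suc k")
        case True then show ?thesis using \<open>x < k\<close> by auto
      next
        case False
        then have "y \<in> T (r, Suc c)" using y bk_other by blast
        then show ?thesis using rw[OF \<open>x \<in> T (r, c)\<close>] by blast
      qed
    qed
  next
    case 2
    from 2 obtain x0 where x0: "x0 \<in> T (r, c)" "x0 = k \<or> x0 = Suc k" using free_entry by blast
    have y1: "y \<in> T (r, Suc c)" using y bk_unfree 2 by blast
    show ?thesis
    proof (cases "x = k \<or> x = Suc k")
      case False
      then show ?thesis using x y1 rw bk_other by blast
    next
      case True
      have "k \<le> y" using rw[OF x0(1) y1] x0 by auto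
      moreover have "y \<noteq> k"
      proof
        assume "y = k"
        with J y1 have "Suc c \<noteq> J" by metis
        with 2 have "Suc c < J" by (auto simp: free_cols_def)
        with 2 \<open>y = k\<close> y1 consider "Suc k \<in> T (Suc r, Suc c)"
          | r' where "Suc k \<in> T (r, Suc c)" "r = Suc r'" "k \<in> T (r', Suc c)"
          by (auto simp: free_cols_def)
        then show False
        proof cases
          case 1
          then show False
            using fixed_left[of r "Suc c" c x0] y1 \<open>y = k\<close> x0 free_no_below[OF 2(1)] by auto
        next
          case 2
          then show False using col[of k r' "Suc c" k r] y1 \<open>y = k\<close> by auto
        qed
      qed
      ultimately show ?thesis using True by auto
    qed
  next
    case 3
    from 3 obtain y0 where y0: "y0 \<in> T (r, Suc c)" "y0 = k \<or> y0 = Suc k" using free_entry by blast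
    have x1: "x \<in> T (r, c)" using x bk_unfree 3 by blast
    show ?thesis
    proof (cases "y = k \<or> y = Suc k")
      case False
      then show ?thesis using y x1 rw bk_other by blast
    next
      case True
      have "x \<le> Suc k" using rw[OF x1 y0(1)] y0 by auto
      moreover have "x \<noteq> Suc k"
      proof
        assume "x = Suc k"
        have "c < J" using 3 by (auto simp: free_cols_def)
        with 3 \<open>x = Suc k\<close> x1 consider "k \<in> T (r, c)" "Suc k \<in> T (Suc r, c)"
          | r' where "r = Suc r'" "k \<in> T (r', c)"
          by (auto simp: free_cols_def)
        then show False
        proof cases
          case 1
          then show False using col[of "Suc k" r c "Suc k" "Suc r"] x1 \<open>x = Suc k\<close> by auto
        next
          case 2
          then show False
            using fixed_right[of r' c "Suc c" y0] x1 \<open>x = Suc k\<close> y0 free_no_above 3(2) by auto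
        qed
      qed
      ultimately show ?thesis using True by auto
    qed
  next
    case 4
    then show ?thesis using x y rw bk_unfree by blast
  qed
qed

text \<open>The boxes directly above and below a free box contain neither letter, so their entries
  lie strictly outside the range from \<open>k\<close> to \<open>k + 1\<close> and the exchange is
  harmless.\<close>

lemma bk_col:
  assumes x: "x \<in> T' (r, c)" and y: "y \<in> T' (Suc r, c)"
  shows "x < y"
proof -
  note cl = col[of _ r c _ "Suc r"]
  show ?thesis
  proof (cases "c \<in> F r")
    case True
    then obtain x0 where x0: "x0 \<in> T (r, c)" "x0 = k \<or> x0 = Suc k" using free_entry by blast
    have nf: "c \<notin> F (Suc r)" using free_no_below[OF True] free_entry by blast
    then have y1: "y \<in> T (Suc r, c)" using y bk_unfree by blast
    with free_no_below[OF True] have "y \<noteq> k" "y \<noteq> Suc k" by auto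
    with cl[OF x0(1) y1] x0 have "Suc k < y" by auto
    then show ?thesis using x y1 cl bk_other by (metis Suc_lessD lessI)
  next
    case False
    then have x1: "x \<in> T (r, c)" using x bk_unfree by blast
    show ?thesis
    proof (cases "c \<in> F (Suc r)")
      case True
      then obtain y0 where y0: "y0 \<in> T (Suc r, c)" "y0 = k \<or> y0 = Suc k" using free_entry by blast
      have "x \<noteq> k" "x \<noteq> Suc k" using free_no_above[OF True] x1 by auto
      with cl[OF x1 y0(1)] y0 have "x < k" by auto
      then show ?thesis using y x1 cl bk_other by (metis less_Suc_eq lessI)
    next
      case False
      then show ?thesis using x1 y cl bk_unfree by blast
    qed
  qed
qed

lemma bk_tableau: "set_valued_tableau \<kappa> T'"
  unfolding set_valued_tableau_iff
proof (intro conjI ballI allI impI)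
  fix b assume b: "b \<in> diagram \<kappa>"
  obtain r c where rc: "b = (r, c)" by force
  have fin: "finite (T b')" for b'
    using T unfolding set_valued_tableau_def by (metis finite.emptyI)
  then show "finite (T' b)" by (auto simp: bender_knuth_def rc)
  show "T' b \<noteq> {}"
  proof (cases "c \<in> F r")
    case True
    then show ?thesis using free_entry[OF reflect_mem[OF True]] bk_k bk_Suc_k
      unfolding rc by blast
  next
    case False
    then show ?thesis using T b by (auto simp: rc bk_unfree set_valued_tableau_def)
  qed
  show "T' b \<subseteq> {1..}"
  proof
    fix x assume "x \<in> T' b"
    then show "x \<in> {1..}" using k bk_other tableau_entry_pos[OF T]
      by (cases "x = k \<or> x = Suc k") (auto simp: rc)
  qed
next
  fix b assume b: "b \<notin> diagram \<kappa>"
  obtain r c where rc: "b = (r, c)" by force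
  have "c \<notin> F r" using b free_entry in_diag rc by blast
  then show "T' b = {}" using T b by (auto simp: rc bk_unfree set_valued_tableau_def)
qed (use bk_row bk_col in blast)+

text \<open>This makes the move an involution: otherwise a second application would reflect other
  intervals. Matched pairs consist of fixed boxes and so survive unchanged.\<close>

lemma bk_free_cols: "free_cols J k T' r = F r"
proof (intro set_eqI iffI)
  fix c assume c: "c \<in> F r"
  have "T' (r, c) \<inter> {k, Suc k} \<noteq> {}"
    using free_entry[OF reflect_mem[OF c]] bk_k[OF c] bk_Suc_k[OF c] by blast
  moreover have "c < J" using c by (simp add: free_cols_def)
  moreover have "Suc k \<notin> T' (Suc r, c)"
    using free_no_below[OF c] bk_unfree[of c "Suc r"] free_entry[of c "Suc r"] by auto
  moreover have "k \<notin> T' (r', c)" if "r = Suc r'" for r'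
    using free_no_above[of c r'] c that bk_unfree[of c "r'"] free_entry[of c r'] by auto
  ultimately show "c \<in> free_cols J k T' r" by (auto simp: free_cols_def)
next
  fix c assume c: "c \<in> free_cols J k T' r"
  show "c \<in> F r"
  proof (rule ccontr)
    assume nf: "c \<notin> F r"
    have eq: "T' (r, c) = T (r, c)" using nf by (rule bk_unfree)
    from c nf eq consider "k \<in> T (r, c)" "Suc k \<in> T (Suc r, c)"
      | r' where "Suc k \<in> T (r, c)" "r = Suc r'" "k \<in> T (r', c)"
      by (auto simp: free_cols_def)
    then show False
    proof cases
      case 1
      then have "c \<notin> F (Suc r)" using free_no_above by blast
      then show False using c 1 bk_unfree eq by (auto simp: free_cols_def)
    next
      case 2
      then have "c \<notin> F r'" using free_no_below by blast
      then show False using c 2 bk_unfree eq by (auto simp: free_cols_def)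
    qed
  qed
qed

lemma bk_involution: "bender_knuth J k T' = T"
proof (rule ext)
  fix b :: "nat \<times> nat"
  obtain r c where rc: "b = (r, c)" by force
  show "bender_knuth J k T' b = T b"
  proof (cases "c \<in> F r")
    case True
    note R = reflect_mem[OF True]
    have "x \<in> bender_knuth J k T' (r, c) \<longleftrightarrow> x \<in> T (r, c)" for x
      using bk_k[OF R] bk_Suc_k[OF R] bk_other[of x r c] True
      unfolding bender_knuth_def[of J k T'] prod.case bk_free_cols if_P[OF True]
      by (cases "x = k"; cases "x = Suc k")
        (auto simp: reflect_reflect[OF True] in_transpose_image_iff)
    then show ?thesis by (auto simp: rc)
  next
    case False
    then show ?thesis
      by (auto simp: rc bender_knuth_def[of J k T'] bk_free_cols bk_unfree)
  qed
qed

text \<open>Mixed boxes only travel within their row, so a row without any acquires none. This keeps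
  the set \<open>N\<close> below stable under the move.\<close>

lemma bk_mixed:
  assumes "k \<in> T' (r, c)" "Suc k \<in> T' (r, c)"
  shows "\<exists>c'. k \<in> T (r, c') \<and> Suc k \<in> T (r, c')"
proof (cases "c \<in> F r")
  case True
  then show ?thesis using assms bk_k bk_Suc_k by blast
next
  case False
  then show ?thesis using assms bk_unfree by auto
qed

text \<open>The injection sends a free box to its reflection and a fixed \<open>k\<close> to the
  \<open>k + 1\<close> matched with it one row below. The two kinds of images cannot collide, since
  the matched partner is fixed as well. The opposite inequality uses the inverse map.\<close>

lemma bk_left_count_le: "card {b. snd b < J \<and> k \<in> T' b} \<le> card {b. snd b < J \<and> Suc k \<in> T b}"
proof -
  define f where "f = (\<lambda>(r, c). if c \<in> F r then (r, reflect (F r) c) else (Suc r, c))"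
  have fixed: "Suc k \<in> T (Suc r, c)" "c \<notin> F (Suc r)" if "k \<in> T' (r, c)" "c \<notin> F r" "c < J" for r c
  proof -
    have kT: "k \<in> T (r, c)" using that bk_unfree by simp
    show "Suc k \<in> T (Suc r, c)"
    proof (rule ccontr)
      assume "Suc k \<notin> T (Suc r, c)"
      with that kT obtain r' where "r = Suc r'" "k \<in> T (r', c)" by (auto simp: free_cols_def)
      then show False using col[of k r' c k r] kT by auto
    qed
    show "c \<notin> F (Suc r)" using free_no_above[of c r] kT by auto
  qed
  have "r = r' \<and> c = c'" if a: "c < J" "k \<in> T' (r, c)" "c' < J" "k \<in> T' (r', c')"
      and e: "f (r, c) = f (r', c')" for r c r' c'
  proof (cases "c \<in> F r"; cases "c' \<in> F r'")
    assume "c \<in> F r" "c' \<in> F r'"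
    then have "r = r'" "reflect (F r) c = reflect (F r') c'" using e by (auto simp: f_def)
    then show ?thesis using reflect_reflect \<open>c \<in> F r\<close> \<open>c' \<in> F r'\<close> by metis
  next
    assume c: "c \<in> F r" "c' \<notin> F r'"
    then have "r = Suc r'" "reflect (F r) c = c'" using e by (auto simp: f_def)
    with fixed(2)[OF a(4) c(2)] a reflect_mem[OF c(1)] show ?thesis by auto
  next
    assume c: "c \<notin> F r" "c' \<in> F r'"
    then have "r' = Suc r" "reflect (F r') c' = c" using e by (auto simp: f_def)
    with fixed(2)[OF a(2) c(1)] a reflect_mem[OF c(2)] show ?thesis by auto
  next
    assume "c \<notin> F r" "c' \<notin> F r'"
    then show ?thesis using e by (auto simp: f_def)
  qed
  then have inj: "inj_on f {b. snd b < J \<and> k \<in> T' b}"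
    by (force intro!: inj_onI)
  have "snd (f (r, c)) < J \<and> Suc k \<in> T (f (r, c))" if a: "snd (r, c) < J" "k \<in> T' (r, c)" for r c
  proof (cases "c \<in> F r")
    case True
    then show ?thesis using a bk_k reflect_mem[OF True] by (auto simp: f_def free_cols_def)
  next
    case False
    then show ?thesis using a fixed by (auto simp: f_def)
  qed
  then have sub: "f ` {b. snd b < J \<and> k \<in> T' b} \<subseteq> {b. snd b < J \<and> Suc k \<in> T b}"
    unfolding image_subset_iff by (metis (no_types, lifting) mem_Collect_eq prod.collapse)
  show ?thesis by (rule card_inj_on_le[OF inj sub]) (use T in simp)
qed

lemma bk_left_count_ge: "card {b. snd b < J \<and> Suc k \<in> T b} \<le> card {b. snd b < J \<and> k \<in> T' b}"
proof -
  define f where "f = (\<lambda>(r, c). if c \<in> F r then (r, reflect (F r) c) else (r - 1, c))"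
  have fixed: "k \<in> T (r - 1, c)" "c \<notin> F (r - 1)" "0 < r"
    if "Suc k \<in> T (r, c)" "c \<notin> F r" "c < J" for r c
  proof -
    have "\<exists>r'. r = Suc r' \<and> k \<in> T (r', c)"
    proof (rule ccontr)
      assume "\<not> ?thesis"
      with that have "Suc k \<in> T (Suc r, c)" by (auto simp: free_cols_def)
      then show False using col[of "Suc k" r c "Suc k" "Suc r"] that by auto
    qed
    then obtain r' where r': "r = Suc r'" "k \<in> T (r', c)" by blast
    then show "k \<in> T (r - 1, c)" "0 < r" by auto
    show "c \<notin> F (r - 1)" using free_no_below[of c r'] r' that by auto
  qed
  have "r = r' \<and> c = c'" if a: "c < J" "Suc k \<in> T (r, c)" "c' < J" "Suc k \<in> T (r', c')"
      and e: "f (r, c) = f (r', c')" for r c r' c'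
  proof (cases "c \<in> F r"; cases "c' \<in> F r'")
    assume "c \<in> F r" "c' \<in> F r'"
    then have "r = r'" "reflect (F r) c = reflect (F r') c'" using e by (auto simp: f_def)
    then show ?thesis using reflect_reflect \<open>c \<in> F r\<close> \<open>c' \<in> F r'\<close> by metis
  next
    assume c: "c \<in> F r" "c' \<notin> F r'"
    then have "r = r' - 1" "reflect (F r) c = c'" using e by (auto simp: f_def)
    with fixed(2)[OF a(4) c(2)] a reflect_mem[OF c(1)] show ?thesis by auto
  next
    assume c: "c \<notin> F r" "c' \<in> F r'"
    then have "r' = r - 1" "reflect (F r') c' = c" using e by (auto simp: f_def)
    with fixed(2)[OF a(2) c(1)] a reflect_mem[OF c(2)] show ?thesis by auto
  next
    assume c: "c \<notin> F r" "c' \<notin> F r'"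
    then show ?thesis using e fixed(3)[OF a(2) c(1)] fixed(3)[OF a(4) c(2)] a
      by (auto simp: f_def)
  qed
  then have inj: "inj_on f {b. snd b < J \<and> Suc k \<in> T b}"
    by (force intro!: inj_onI)
  have "snd (f (r, c)) < J \<and> k \<in> T' (f (r, c))" if a: "snd (r, c) < J" "Suc k \<in> T (r, c)" for r c
  proof (cases "c \<in> F r")
    case True
    note R = reflect_mem[OF True]
    have "reflect (F r) c < J" using R by (simp add: free_cols_def)
    then show ?thesis using a True bk_k[OF R] by (simp add: f_def reflect_reflect)
  next
    case False
    then show ?thesis using a fixed(1,2)[of r c] by (auto simp: f_def bk_unfree)
  qed
  then have sub: "f ` {b. snd b < J \<and> Suc k \<in> T b} \<subseteq> {b. snd b < J \<and> k \<in> T' b}"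
    unfolding image_subset_iff by (metis (no_types, lifting) mem_Collect_eq prod.collapse)
  show ?thesis by (rule card_inj_on_le[OF inj sub]) (use bk_tableau in simp)
qed

lemma bk_left_count: "card {b. snd b < J \<and> k \<in> T' b} = card {b. snd b < J \<and> Suc k \<in> T b}"
  using bk_left_count_le bk_left_count_ge by (rule le_antisym)

end

section \<open>Cancellation of non-Yamanouchi tableaux\<close>

lemma tableau_box:
  assumes "set_valued_tableau \<mu> T" "b \<in> diagram \<mu>"
  shows "T b \<noteq> {}" "finite (T b)" "T b \<subseteq> {1..}"
  using assms(1)[unfolded set_valued_tableau_def, THEN conjunct1, rule_format, OF assms(2)]
  by blast+

lemma tableau_outside: "set_valued_tableau \<mu> T \<Longrightarrow> b \<notin> diagram \<mu> \<Longrightarrow> T b = {}"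
  unfolding set_valued_tableau_def by (elim conjE, drule spec, drule mp)

definition bounded_tableaux :: "partition \<Rightarrow> nat \<Rightarrow> (nat \<times> nat \<Rightarrow> nat set) set" where
  "bounded_tableaux \<mu> n = {T. set_valued_tableau \<mu> T \<and> (\<forall>b. T b \<subseteq> {1..n})}"

lemma finite_bounded_tableaux [simp]: "finite (bounded_tableaux \<mu> n)"
proof (rule finite_subset)
  show "bounded_tableaux \<mu> n \<subseteq>
      {T. \<forall>b. (b \<in> diagram \<mu> \<longrightarrow> T b \<in> Pow {1..n}) \<and> (b \<notin> diagram \<mu> \<longrightarrow> T b = {})}"
    unfolding bounded_tableaux_def set_valued_tableau_def by blast
  show "finite {T. \<forall>b. (b \<in> diagram \<mu> \<longrightarrow> T b \<in> Pow {1..n}) \<and> (b \<notin> diagram \<mu> \<longrightarrow> T b = {})}"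
    by (rule finite_set_of_finite_funs) auto
qed

lemma bounded_tableauxD:
  assumes "T \<in> bounded_tableaux \<mu> n"
  shows "set_valued_tableau \<mu> T" "x \<in> T b \<Longrightarrow> 1 \<le> x \<and> x \<le> n"
  using assms unfolding bounded_tableaux_def by fastforce+

lemma cell_count_left:
  assumes T: "set_valued_tableau \<mu> T"
  shows "cell_count T 0 i = card {b. snd b < J \<and> i \<in> T b} + cell_count T J i"
proof -
  have "{b. 0 \<le> snd b \<and> i \<in> T b} = {b. snd b < J \<and> i \<in> T b} \<union> {b. J \<le> snd b \<and> i \<in> T b}"
    by auto
  moreover have "card ({b. snd b < J \<and> i \<in> T b} \<union> {b. J \<le> snd b \<and> i \<in> T b})
    = card {b. snd b < J \<and> i \<in> T b} + card {b. J \<le> snd b \<and> i \<in> T b}"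
    by (rule card_Un_disjoint[OF finite_cells[OF T] finite_cells[OF T]]) auto
  ultimately show ?thesis by (simp only: cell_count_def)
qed

lemma cell_count_cong: "(\<And>b. J \<le> snd b \<Longrightarrow> i \<in> T b \<longleftrightarrow> i \<in> T' b) \<Longrightarrow> cell_count T J i = cell_count T' J i"
  unfolding cell_count_def by (rule arg_cong[of _ _ card]) auto

lemma tableau_unique_row:
  assumes "set_valued_tableau \<mu> T" "x \<in> T (r, c)" "x \<in> T (r', c)"
  shows "r = r'"
  using tableau_col[OF assms(1,2,3)] tableau_col[OF assms(1,3,2)] by (cases r r' rule: linorder_cases) auto

text \<open>
  The word of a tableau is read by columns from right to left, each column from top to bottom and
  each box in decreasing order.  Starting from the shape \<open>\<nu>\<close>, reading a letter \<open>i\<close> adds a box to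
  row \<open>i\<close> (rows numbered from 1).  The predicate below says that the letter \<open>k + 1\<close> read
  in box \<open>(r, j)\<close> violates the partition condition between the rows \<open>k\<close> and \<open>k + 1\<close>.
\<close>

definition violation ::
    "partition \<Rightarrow> (nat \<times> nat \<Rightarrow> nat set) \<Rightarrow> nat \<Rightarrow> nat \<Rightarrow> nat \<Rightarrow> bool" where
  "violation \<nu> T j k r \<longleftrightarrow> 1 \<le> k \<and>
     part \<nu> (k - 1) + cell_count T (Suc j) k = part \<nu> k + cell_count T (Suc j) (Suc k) \<and>
     Suc k \<in> T (r, j) \<and> (\<forall>r'<r. k \<notin> T (r', j))"

definition yamanouchi :: "partition \<Rightarrow> (nat \<times> nat \<Rightarrow> nat set) \<Rightarrow> bool" where
  "yamanouchi \<nu> T \<longleftrightarrow> (\<forall>j k r. \<not> violation \<nu> T j k r)"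

text \<open>The first violation is sought in the rightmost column and there at the largest
  \<open>k\<close>. Toggling a \<open>k\<close> in column \<open>j\<close> may affect violations
  between the letters \<open>k - 1\<close> and \<open>k\<close>, but none between \<open>k'\<close>
  and \<open>k' + 1\<close> with \<open>k' > k\<close>. The row \<open>r\<close> is determined by
  \<open>j\<close> and \<open>k\<close>.\<close>

definition violation_class ::
    "partition \<Rightarrow> partition \<Rightarrow> nat \<Rightarrow> nat \<times> nat \<times> nat \<Rightarrow> (nat \<times> nat \<Rightarrow> nat set) set" where
  "violation_class \<nu> \<mu> n = (\<lambda>(j, k, r). {T \<in> bounded_tableaux \<mu> n. violation \<nu> T j k r \<and>
     (\<forall>j'>j. \<forall>k' r'. \<not> violation \<nu> T j' k' r') \<and> (\<forall>k'>k. \<forall>r'. \<not> violation \<nu> T j k' r')})"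

lemma violation_class_unique:
  assumes "T \<in> violation_class \<nu> \<mu> n p" "T \<in> violation_class \<nu> \<mu> n q"
  shows "p = q"
proof -
  obtain j k r j' k' r' where pq: "p = (j, k, r)" "q = (j', k', r')" by (metis prod_cases3)
  from assms have T: "set_valued_tableau \<mu> T"
    and v: "violation \<nu> T j k r" "violation \<nu> T j' k' r'"
    and m: "\<And>i k r. j < i \<Longrightarrow> \<not> violation \<nu> T i k r" "\<And>i k r. j' < i \<Longrightarrow> \<not> violation \<nu> T i k r"
      "\<And>i r. k < i \<Longrightarrow> \<not> violation \<nu> T j i r" "\<And>i r. k' < i \<Longrightarrow> \<not> violation \<nu> T j' i r"
    by (auto simp: violation_class_def pq bounded_tableaux_def)
  have j: "j = j'" using v m(1,2) by (metis linorder_cases)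
  have k: "k = k'" using v m(3,4) j by (metis linorder_cases)
  have "r = r'" using tableau_unique_row[OF T, of "Suc k" r j r'] v j k by (auto simp: violation_def)
  with j k show ?thesis by (simp add: pq)
qed

lemma violation_class_exists:
  assumes T: "T \<in> bounded_tableaux \<mu> n" and "\<not> yamanouchi \<nu> T"
  shows "\<exists>p. T \<in> violation_class \<nu> \<mu> n p"
proof -
  let ?P = "\<lambda>j. \<exists>k r. violation \<nu> T j k r"
  have "j < part \<mu> 0" if P: "?P j" for j
  proof -
    obtain k r where "Suc k \<in> T (r, j)" using P by (auto simp: violation_def)
    then have "(r, j) \<in> diagram \<mu>" using T tableau_in_diagram bounded_tableauxD(1) by blast
    then have "(0, j) \<in> diagram \<mu>" by (rule diagram_down_closed) auto
    then show ?thesis by (simp add: diagram_iff)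
  qed
  moreover obtain j0 where "?P j0" using assms(2) by (auto simp: yamanouchi_def)
  ultimately have "\<exists>j. ?P j \<and> (\<forall>i. ?P i \<longrightarrow> i \<le> j)"
    by (intro ex_has_greatest_nat[of ?P j0 "\<lambda>j. j" "part \<mu> 0"]) auto
  then obtain j where j: "?P j" "\<And>i. ?P i \<Longrightarrow> i \<le> j" by blast
  let ?Q = "\<lambda>k. \<exists>r. violation \<nu> T j k r"
  have "k < n" if Q: "?Q k" for k
    using Q bounded_tableauxD(2)[OF T, of "Suc k"] by (auto simp: violation_def Suc_le_eq)
  moreover from j(1) obtain k0 where "?Q k0" by blast
  ultimately have "\<exists>k. ?Q k \<and> (\<forall>i. ?Q i \<longrightarrow> i \<le> k)"
    by (intro ex_has_greatest_nat[of ?Q k0 "\<lambda>j. j" n]) auto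
  then obtain k where k: "?Q k" "\<And>i. ?Q i \<Longrightarrow> i \<le> k" by blast
  from k(1) obtain r where "violation \<nu> T j k r" by blast
  then have "T \<in> violation_class \<nu> \<mu> n (j, k, r)"
    using T j(2) k(2) unfolding violation_class_def by (fastforce simp: not_le)
  then show ?thesis by blast
qed

lemma violation_class_cong:
  assumes T: "T \<in> violation_class \<nu> \<mu> n (j, k, r)" and T': "T' \<in> bounded_tableaux \<mu> n"
    and right: "\<And>b. j < snd b \<Longrightarrow> T' b = T b"
    and col: "\<And>r x. x \<noteq> k \<Longrightarrow> x \<in> T' (r, j) \<longleftrightarrow> x \<in> T (r, j)"
    and k: "\<And>r'. r' < r \<Longrightarrow> k \<notin> T' (r', j)"
  shows "T' \<in> violation_class \<nu> \<mu> n (j, k, r)"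
proof -
  have cc: "cell_count T' (Suc i) x = cell_count T (Suc i) x" if "j \<le> i" for i x
    by (rule cell_count_cong) (use right that in auto)
  have v: "violation \<nu> T j k r" and v1: "\<And>j' k' r'. j < j' \<Longrightarrow> \<not> violation \<nu> T j' k' r'"
    and v2: "\<And>k' r'. k < k' \<Longrightarrow> \<not> violation \<nu> T j k' r'"
    using T by (simp_all add: violation_class_def)
  have "violation \<nu> T' j k r"
    using v k col[of "Suc k" r] by (simp add: violation_def cc)
  moreover have "\<not> violation \<nu> T' j' k' r'" if "j < j'" for j' k' r'
    using v1[OF that, of k' r'] that right[of "(_, j')"] by (simp add: violation_def cc)
  moreover have "\<not> violation \<nu> T' j k' r'" if "k < k'" for k' r'
    using v2[OF that, of r'] that col[of k'] col[of "Suc k'"] by (simp add: violation_def cc)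
  ultimately show ?thesis using T' by (simp add: violation_class_def)
qed

lemma tableau_subset:
  assumes "set_valued_tableau \<mu> T" "\<And>b. T' b \<subseteq> T b" "\<And>b. b \<in> diagram \<mu> \<Longrightarrow> T' b \<noteq> {}"
  shows "set_valued_tableau \<mu> T'"
  unfolding set_valued_tableau_iff
proof (intro conjI ballI allI impI)
  fix b assume b: "b \<in> diagram \<mu>"
  show "T' b \<noteq> {}" by (rule assms(3)[OF b])
  show "finite (T' b)" by (rule finite_subset[OF assms(2)]) (rule tableau_box[OF assms(1) b])
  show "T' b \<subseteq> {1..}" by (rule subset_trans[OF assms(2)]) (rule tableau_box[OF assms(1) b])
next
  fix b assume "b \<notin> diagram \<mu>"
  then show "T' b = {}"
    using assms(2)[of b] tableau_in_diagram[OF assms(1)] by blast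
next
  fix r c x y assume "x \<in> T' (r, c)" "y \<in> T' (r, Suc c)"
  then show "x \<le> y" using assms(2) tableau_row[OF assms(1), of x r c y "Suc c"] by blast
next
  fix r c x y assume "x \<in> T' (r, c)" "y \<in> T' (Suc r, c)"
  then show "x < y" using assms(2) tableau_col[OF assms(1), of x r c y "Suc r"] by blast
qed

text \<open>The row lengths of \<nu>, the staircase and the content of the tableau. Letters count
  from 1 and rows from 0, hence the shift \<open>i - 1\<close>.\<close>

definition exponents :: "partition \<Rightarrow> nat \<Rightarrow> (nat \<times> nat \<Rightarrow> nat set) \<Rightarrow> nat \<Rightarrow> nat" where
  "exponents \<nu> n T i = part \<nu> (i - 1) + (n - i) + cell_count T 0 i"

text \<open>
  The relation satisfied by \<open>A \<alpha> = det (x\<^sub>i^\<alpha>\<^sub>j (1 + x\<^sub>i)^(j - 1))\<close>, which replaces the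
  antisymmetry of the classical alternants.
\<close>

locale twisted_alternant =
  fixes n :: nat and A :: "(nat \<Rightarrow> nat) \<Rightarrow> real poly"
  assumes twist: "1 \<le> k \<Longrightarrow> k < n \<Longrightarrow>
    A \<alpha> + A (\<alpha>(k := \<alpha> k + 1)) =
    - (A (\<alpha> \<circ> Transposition.transpose k (Suc k)) +
       A ((\<alpha> \<circ> Transposition.transpose k (Suc k))(k := \<alpha> (Suc k) + 1)))"
begin

section \<open>One violation class: toggling a \<open>k\<close> and the Bender-Knuth move\<close>

context
  fixes \<nu> \<mu> :: partition and j k r :: nat
begin

definition "C = violation_class \<nu> \<mu> n (j, k, r)"
text \<open>The tableaux without a mixed box in row \<open>r\<close>; toggling matches them with
  those of \<open>X\<close>. For members of \<open>N\<close> column \<open>j\<close> contains no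
  \<open>k\<close> at all: row \<open>r\<close> has \<open>k + 1\<close> there, and the other rows
  are covered by \<open>C_D\<close>. So the Bender-Knuth move applies.\<close>

definition "N = {T \<in> C. \<forall>c. \<not> (k \<in> T (r, c) \<and> Suc k \<in> T (r, c))}"
definition "X = {T \<in> C. \<exists>c. k \<in> T (r, c) \<and> Suc k \<in> T (r, c)}"
text \<open>The only place in row \<open>r\<close> where \<open>k\<close> can share a box with
  \<open>k + 1\<close>: boxes further right have no entry below \<open>k + 1\<close>. Hence it is
  the place of the toggle.\<close>

definition "first T = (LEAST c. Suc k \<in> T (r, c))"
definition "grow T = T((r, first T) := insert k (T (r, first T)))"
definition "shrink T = T((r, first T) := T (r, first T) - {k})"

lemma C_D:
  assumes "T \<in> C"
  shows "T \<in> bounded_tableaux \<mu> n" "set_valued_tableau \<mu> T" "1 \<le> k" "Suc k \<in> T (r, j)" "k < n"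
    and "part \<nu> (k - 1) + cell_count T (Suc j) k = part \<nu> k + cell_count T (Suc j) (Suc k)"
    and "r' \<noteq> r \<Longrightarrow> k \<notin> T (r', j)"
proof -
  show B: "T \<in> bounded_tableaux \<mu> n" and "1 \<le> k" and S: "Suc k \<in> T (r, j)"
    and "part \<nu> (k - 1) + cell_count T (Suc j) k = part \<nu> k + cell_count T (Suc j) (Suc k)"
    using assms by (auto simp: C_def violation_class_def violation_def)
  show T: "set_valued_tableau \<mu> T" using B by (rule bounded_tableauxD)
  show "k < n" using bounded_tableauxD(2)[OF B S] by simp
  show "k \<notin> T (r', j)" if "r' \<noteq> r"
  proof
    assume k': "k \<in> T (r', j)"
    have "\<not> r' < r" using k' assms by (auto simp: C_def violation_class_def violation_def)
    with that have "r < r'" by simp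
    then show False using tableau_col[OF T S k'] by simp
  qed
qed

lemma first_props:
  assumes "T \<in> C"
  shows "Suc k \<in> T (r, first T)" "first T \<le> j" "c < first T \<Longrightarrow> Suc k \<notin> T (r, c)"
  using C_D(4)[OF assms] unfolding first_def
  by (auto intro: LeastI Least_le dest: not_less_Least)

lemma first_grow [simp]: "first (grow T) = first T" "first (shrink T) = first T"
proof -
  have "Suc k \<in> grow T (r, c) \<longleftrightarrow> Suc k \<in> T (r, c)" "Suc k \<in> shrink T (r, c) \<longleftrightarrow> Suc k \<in> T (r, c)" for c
    by (auto simp: grow_def shrink_def)
  then show "first (grow T) = first T" "first (shrink T) = first T"
    by (simp_all add: first_def[of "grow T"] first_def[of "shrink T"] first_def[of T])
qed

lemma mixed_first:
  assumes "T \<in> C" "k \<in> T (r, c)" "Suc k \<in> T (r, c)"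
  shows "c = first T"
proof (rule ccontr)
  assume "c \<noteq> first T"
  moreover have "\<not> c < first T" using first_props(3)[OF assms(1)] assms(3) by blast
  ultimately have "first T < c" by simp
  then show False
    using tableau_row[OF C_D(2)[OF assms(1)] first_props(1)[OF assms(1)] assms(2)] by simp
qed

text \<open>A new \<open>k\<close> at the leftmost \<open>k + 1\<close> can only disturb the boxes
  to its left and above. On the left all entries are at most \<open>k\<close>, by leftmost choice. A
  \<open>k\<close> directly above would force a \<open>k\<close> above row \<open>r\<close> in
  column \<open>j\<close>, which contradicts the violation.\<close>

lemma grow_X:
  assumes "T \<in> N" shows "grow T \<in> X"
proof -
  have C: "T \<in> C" and nomix: "\<And>c. \<not> (k \<in> T (r, c) \<and> Suc k \<in> T (r, c))"
    using assms by (auto simp: N_def)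
  note T = C_D(2)[OF C] and fp = first_props[OF C]
  have d: "(r, first T) \<in> diagram \<mu>" using tableau_in_diagram[OF T fp(1)] .
  have above: "x < k" if x: "x \<in> T (r', first T)" and r': "r = Suc r'" for x r'
  proof -
    have "x \<le> k" using tableau_col[OF T x fp(1)] r' by simp
    moreover have "x \<noteq> k"
    proof
      assume xk: "x = k"
      show False
      proof (cases "first T = j")
        case True
        then show False using C_D(7)[OF C, of r'] x xk r' by simp
      next
        case False
        then have lt: "first T < j" using fp by simp
        have "(r', j) \<in> diagram \<mu>"
          using tableau_in_diagram[OF T C_D(4)[OF C]] r' by (auto intro: diagram_down_closed)
        then obtain z where z: "z \<in> T (r', j)" using T tableau_nonempty by blast
        have "k \<le> z" using tableau_row[OF T x z lt] xk by simp
        moreover have "z < Suc k" using tableau_col[OF T z C_D(4)[OF C]] r' by simp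
        ultimately have "z = k" by simp
        then show False using C_D(7)[OF C, of r'] z r' by simp
      qed
    qed
    ultimately show ?thesis by simp
  qed
  have in_grow: "x \<in> grow T b \<longleftrightarrow> x \<in> T b \<or> x = k \<and> b = (r, first T)" for x b
    by (auto simp: grow_def)
  have "set_valued_tableau \<mu> (grow T)"
    unfolding set_valued_tableau_iff
  proof (intro conjI ballI allI impI)
    fix b assume b: "b \<in> diagram \<mu>"
    then show "grow T b \<noteq> {}" "finite (grow T b)"
      using tableau_box[OF T] by (auto simp: grow_def)
    show "grow T b \<subseteq> {1..}"
      using tableau_entry_pos[OF T, of _ b] C_D(3)[OF C] by (auto simp: in_grow)
  next
    fix b assume b: "b \<notin> diagram \<mu>"
    moreover from this have "T b = {}" by (rule tableau_outside[OF T])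
    ultimately show "grow T b = {}" using d by (auto simp: grow_def)
  next
    fix r' c x y assume x: "x \<in> grow T (r', c)" and y: "y \<in> grow T (r', Suc c)"
    show "x \<le> y"
    proof (cases "x \<in> T (r', c)"; cases "y \<in> T (r', Suc c)")
      assume "x \<in> T (r', c)" "y \<in> T (r', Suc c)"
      then show ?thesis using tableau_row[OF T, of x r' c y "Suc c"] by simp
    next
      assume a: "x \<in> T (r', c)" "y \<notin> T (r', Suc c)"
      then have e: "y = k" "r' = r" "first T = Suc c" using y by (auto simp: in_grow)
      have "x \<le> Suc k" using tableau_row[OF T a(1), of "Suc k" "Suc c"] fp(1) e by simp
      moreover have "x \<noteq> Suc k" using fp(3)[of c] e a by auto
      ultimately show ?thesis using e by simp
    next
      assume a: "x \<notin> T (r', c)" "y \<in> T (r', Suc c)"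
      then have e: "x = k" "r' = r" "first T = c" using x by (auto simp: in_grow)
      then show ?thesis using tableau_row[OF T fp(1), of y "Suc c"] a by simp
    next
      assume a: "x \<notin> T (r', c)" "y \<notin> T (r', Suc c)"
      then show ?thesis using x y by (auto simp: in_grow)
    qed
  next
    fix r' c x y assume x: "x \<in> grow T (r', c)" and y: "y \<in> grow T (Suc r', c)"
    show "x < y"
    proof (cases "x \<in> T (r', c)"; cases "y \<in> T (Suc r', c)")
      assume "x \<in> T (r', c)" "y \<in> T (Suc r', c)"
      then show ?thesis using tableau_col[OF T, of x r' c y "Suc r'"] by simp
    next
      assume a: "x \<in> T (r', c)" "y \<notin> T (Suc r', c)"
      then have e: "y = k" "r = Suc r'" "first T = c" using y by (auto simp: in_grow)
      then show ?thesis using above a by simp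
    next
      assume a: "x \<notin> T (r', c)" "y \<in> T (Suc r', c)"
      then have e: "x = k" "r' = r" "first T = c" using x by (auto simp: in_grow)
      then show ?thesis using tableau_col[OF T fp(1), of y "Suc r"] a by simp
    next
      assume a: "x \<notin> T (r', c)" "y \<notin> T (Suc r', c)"
      then show ?thesis using x y by (auto simp: in_grow)
    qed
  qed
  then have "grow T \<in> bounded_tableaux \<mu> n"
    using C_D(1,3,5)[OF C] by (auto simp: bounded_tableaux_def grow_def)
  then have "grow T \<in> C"
    unfolding C_def
    by (rule violation_class_cong[OF C[unfolded C_def]])
      (use fp(2) C_D(7)[OF C] in \<open>auto simp: in_grow\<close>)
  then show ?thesis using fp(1) by (auto simp: X_def in_grow)
qed

lemma shrink_N:
  assumes "T \<in> X" shows "shrink T \<in> N"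
proof -
  have C: "T \<in> C" using assms by (auto simp: X_def)
  note T = C_D(2)[OF C] and fp = first_props[OF C]
  have in_shrink: "x \<in> shrink T b \<longleftrightarrow> x \<in> T b \<and> \<not> (x = k \<and> b = (r, first T))" for x b
    by (auto simp: shrink_def)
  have "set_valued_tableau \<mu> (shrink T)"
  proof (rule tableau_subset[OF T])
    show "shrink T b \<subseteq> T b" for b by (auto simp: in_shrink)
    show "shrink T b \<noteq> {}" if "b \<in> diagram \<mu>" for b
    proof (cases "b = (r, first T)")
      case True
      then have "Suc k \<in> shrink T b" using fp(1) by (simp add: in_shrink)
      then show ?thesis by blast
    next
      case False
      then show ?thesis using tableau_box(1)[OF T that] by (simp add: shrink_def)
    qed
  qed
  then have "shrink T \<in> bounded_tableaux \<mu> n"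
    using C_D(1)[OF C] by (fastforce simp: bounded_tableaux_def in_shrink)
  then have "shrink T \<in> C"
    unfolding C_def
    by (rule violation_class_cong[OF C[unfolded C_def]])
      (use fp(2) C_D(7)[OF C] in \<open>auto simp: in_shrink\<close>)
  then show ?thesis using mixed_first[OF C] by (auto simp: N_def in_shrink)
qed

lemma shrink_grow: "T \<in> N \<Longrightarrow> shrink (grow T) = T"
  using first_props(1)[of T] by (auto simp: N_def shrink_def[of "grow T"]) (auto simp: grow_def fun_eq_iff)

lemma grow_shrink: "T \<in> X \<Longrightarrow> grow (shrink T) = T"
  using mixed_first[of T] by (auto simp: X_def grow_def[of "shrink T"]) (auto simp: shrink_def fun_eq_iff)

lemma exponents_grow:
  assumes "T \<in> N" shows "exponents \<nu> n (grow T) = (exponents \<nu> n T)(k := exponents \<nu> n T k + 1)"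
proof -
  have C: "T \<in> C" and nomix: "\<And>c. \<not> (k \<in> T (r, c) \<and> Suc k \<in> T (r, c))"
    using assms by (auto simp: N_def)
  note T = C_D(2)[OF C] and fp = first_props[OF C]
  have "{b. 0 \<le> snd b \<and> k \<in> grow T b} = insert (r, first T) {b. 0 \<le> snd b \<and> k \<in> T b}"
    by (auto simp: grow_def)
  moreover have "k \<notin> T (r, first T)" using nomix fp by blast
  ultimately have "cell_count (grow T) 0 k = cell_count T 0 k + 1"
    using finite_cells[OF T, of "\<lambda>_. True" k] by (simp add: cell_count_def)
  moreover have "cell_count (grow T) 0 i = cell_count T 0 i" if "i \<noteq> k" for i
    by (rule cell_count_cong) (use that in \<open>auto simp: grow_def\<close>)
  ultimately show ?thesis by (auto simp: exponents_def fun_eq_iff)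
qed

lemma setup_N:
  assumes "T \<in> N" shows "bender_knuth_setup \<mu> T j k"
proof -
  have C: "T \<in> C" and nomix: "\<And>c. \<not> (k \<in> T (r, c) \<and> Suc k \<in> T (r, c))"
    using assms by (auto simp: N_def)
  show ?thesis
    using C_D(2,3,4)[OF C] C_D(7)[OF C] nomix[of j] by unfold_locales metis+
qed

lemma bender_knuth_N:
  assumes "T \<in> N" shows "bender_knuth j k T \<in> N"
proof -
  interpret bender_knuth_setup \<mu> T j k using assms by (rule setup_N)
  have C: "T \<in> C" and nomix: "\<And>c. \<not> (k \<in> T (r, c) \<and> Suc k \<in> T (r, c))"
    using assms by (auto simp: N_def)
  have "x \<in> {1..n}" if "x \<in> T' (a, c)" for a c x
    using that bk_other[of x a c] bounded_tableauxD(2)[OF C_D(1)[OF C], of x "(a, c)"] C_D(3,5)[OF C]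
    by (cases "x = k \<or> x = Suc k") auto
  then have "T' \<in> bounded_tableaux \<mu> n"
    using bk_tableau by (auto simp: bounded_tableaux_def split_paired_All)
  then have "T' \<in> C"
    unfolding C_def
    by (rule violation_class_cong[OF C[unfolded C_def]])
      (use C_D(7)[OF C] in \<open>auto simp: bk_right split_paired_All\<close>)
  then show ?thesis using nomix bk_mixed by (auto simp: N_def)
qed

text \<open>The move exchanges the contributions of the columns left of \<open>j\<close> to the
  exponents of \<open>k\<close> and \<open>k + 1\<close>. Everything else contributes equally to
  both, by \<open>bal\<close>, so the partial move transposes the full exponent vector.\<close>

lemma exponents_bender_knuth:
  assumes "T \<in> N"
  shows "exponents \<nu> n (bender_knuth j k T) = exponents \<nu> n T \<circ> Transposition.transpose k (Suc k)"
proof -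
  interpret bender_knuth_setup \<mu> T j k using assms by (rule setup_N)
  interpret B: bender_knuth_setup \<mu> T' j k using bender_knuth_N[OF assms] by (rule setup_N)
  have C: "T \<in> C" using assms by (simp add: N_def)
  note D = C_D[OF C]
  have right: "cell_count T' j i = cell_count T j i" for i
    by (rule cell_count_cong) (auto simp: bk_right split_paired_all)
  have "cell_count T j k = cell_count T (Suc j) k"
    using cell_count_split[OF T, of j k] J by simp
  moreover have "cell_count T j (Suc k) = Suc (cell_count T (Suc j) (Suc k))"
    using cell_count_split[OF T, of j "Suc k"] D(4) by auto
  \<comment> \<open>At the violation the rows \<open>k\<close> and \<open>k + 1\<close> are equally
    long after the columns right of \<open>j\<close>. The additional \<open>k + 1\<close> in column
    \<open>j\<close> makes up for the staircase, which is one smaller at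
    \<open>k + 1\<close>.\<close>
  ultimately have bal: "part \<nu> (k - 1) + (n - k) + cell_count T j k
      = part \<nu> k + (n - Suc k) + cell_count T j (Suc k)"
    using D(5,6) by simp
  have "exponents \<nu> n T' k = exponents \<nu> n T (Suc k)"
    using bal bk_left_count
    by (simp add: exponents_def cell_count_left[OF bk_tableau, of _ j] cell_count_left[OF T, of _ j] right)
  moreover have "exponents \<nu> n T' (Suc k) = exponents \<nu> n T k"
    using bal B.bk_left_count
    by (simp add: exponents_def cell_count_left[OF bk_tableau, of _ j] cell_count_left[OF T, of _ j]
        right bk_involution)
  moreover have "exponents \<nu> n T' i = exponents \<nu> n T i" if "i \<noteq> k" "i \<noteq> Suc k" for i
    unfolding exponents_def
    by (intro arg_cong2[of _ _ _ _ "(+)"] refl cell_count_cong)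
      (use bk_other[OF that] in \<open>auto simp: split_paired_all\<close>)
  ultimately show ?thesis by (auto simp: fun_eq_iff Transposition.transpose_def)
qed

text \<open>Toggling identifies \<open>X\<close> with \<open>N\<close>, so the sum becomes that of
  the two-term expressions \<open>H\<close> over \<open>N\<close>. By \<open>twist\<close> the
  Bender-Knuth move reverses the sign of \<open>H\<close>, so the sum equals its own
  negative.\<close>

lemma sum_violation_class: "(\<Sum>T\<in>C. A (exponents \<nu> n T)) = 0"
proof -
  let ?E = "exponents \<nu> n"
  define H where "H T = A (?E T) + A ((?E T)(k := ?E T k + 1))" for T
  have fin: "finite C" by (simp add: C_def violation_class_def)
  have "C = N \<union> X" "N \<inter> X = {}" by (auto simp: N_def X_def)
  then have "(\<Sum>T\<in>C. A (?E T)) = (\<Sum>T\<in>N. A (?E T)) + (\<Sum>T\<in>X. A (?E T))"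
    using fin by (metis finite_Un sum.union_disjoint)
  also have "(\<Sum>T\<in>X. A (?E T)) = (\<Sum>T\<in>N. A (?E (grow T)))"
    by (rule sum.reindex_bij_witness[of _ grow shrink])
      (auto simp: grow_X shrink_N shrink_grow grow_shrink)
  also have "(\<Sum>T\<in>N. A (?E T)) + (\<Sum>T\<in>N. A (?E (grow T))) = (\<Sum>T\<in>N. H T)"
    by (simp add: H_def sum.distrib exponents_grow)
  also have "\<dots> = 0"
  proof -
    have "(\<Sum>T\<in>N. H T) = (\<Sum>T\<in>N. H (bender_knuth j k T))"
      by (rule sum.reindex_bij_witness[of _ "bender_knuth j k" "bender_knuth j k"])
        (use bender_knuth_N bender_knuth_setup.bk_involution[OF setup_N] in auto)
    also have "\<dots> = (\<Sum>T\<in>N. - H T)"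
    proof (rule sum.cong[OF refl])
      fix T assume T: "T \<in> N"
      then have kn: "1 \<le> k" "k < n" using C_D(3,5) by (auto simp: N_def)
      show "H (bender_knuth j k T) = - H T"
        using twist[OF kn, of "?E T"] by (simp add: H_def exponents_bender_knuth[OF T])
    qed
    finally have "(\<Sum>T\<in>N. H T) = - (\<Sum>T\<in>N. H T)" by (simp add: sum_negf)
    then have "coeff (\<Sum>T\<in>N. H T) i = - coeff (\<Sum>T\<in>N. H T) i" for i
      by (metis coeff_minus)
    then show ?thesis by (intro poly_eqI) simp
  qed
  finally show ?thesis .
qed

end

lemma sum_yamanouchi:
  "(\<Sum>T\<in>bounded_tableaux \<mu> n. A (exponents \<nu> n T)) =
   (\<Sum>T | T \<in> bounded_tableaux \<mu> n \<and> yamanouchi \<nu> T. A (exponents \<nu> n T))"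
proof -
  let ?B = "{T \<in> bounded_tableaux \<mu> n. \<not> yamanouchi \<nu> T}"
  define key where "key T = (SOME p. T \<in> violation_class \<nu> \<mu> n p)" for T
  have key: "T \<in> violation_class \<nu> \<mu> n (key T)" if "T \<in> ?B" for T
    unfolding key_def by (rule someI_ex) (use violation_class_exists that in auto)
  have fibre: "{T \<in> ?B. key T = p} = violation_class \<nu> \<mu> n p" for p
  proof -
    have "T \<in> ?B" if "T \<in> violation_class \<nu> \<mu> n p" for T
      using that by (cases p) (auto simp: violation_class_def yamanouchi_def)
    then show ?thesis using key violation_class_unique by blast
  qed
  have "(\<Sum>T\<in>?B. A (exponents \<nu> n T)) =
      (\<Sum>p\<in>key ` ?B. \<Sum>T\<in>{T \<in> ?B. key T = p}. A (exponents \<nu> n T))"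
    by (rule sum.group[symmetric]) auto
  also have "\<dots> = 0"
  proof (rule sum.neutral, rule ballI)
    fix p
    show "(\<Sum>T\<in>{T \<in> ?B. key T = p}. A (exponents \<nu> n T)) = 0"
      unfolding fibre using sum_violation_class[unfolded C_def] by (cases p) simp
  qed
  finally have B: "(\<Sum>T\<in>?B. A (exponents \<nu> n T)) = 0" .
  have "bounded_tableaux \<mu> n = {T \<in> bounded_tableaux \<mu> n. yamanouchi \<nu> T} \<union> ?B" by auto
  then have "(\<Sum>T\<in>bounded_tableaux \<mu> n. A (exponents \<nu> n T)) =
      (\<Sum>T\<in>{T \<in> bounded_tableaux \<mu> n. yamanouchi \<nu> T} \<union> ?B. A (exponents \<nu> n T))" by simp
  also have "\<dots> = (\<Sum>T | T \<in> bounded_tableaux \<mu> n \<and> yamanouchi \<nu> T. A (exponents \<nu> n T)) +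
      (\<Sum>T\<in>?B. A (exponents \<nu> n T))"
    by (rule sum.union_disjoint) auto
  finally show ?thesis using B by simp
qed

end

section \<open>Yamanouchi tableaux\<close>

lemma part_Partition:
  assumes "\<And>i. f (Suc i) \<le> f i" "finite {i. f i \<noteq> 0}"
  shows "part (Partition f) = f"
  by (rule Partition_inverse) (use assms in \<open>auto intro: antimono_iff_le_Suc[THEN iffD2]\<close>)

lemma finite_entries:
  assumes "set_valued_tableau \<mu> T" shows "finite {x. \<exists>b. x \<in> T b}"
proof -
  have "{x. \<exists>b. x \<in> T b} = (\<Union>b\<in>diagram \<mu>. T b)"
    using tableau_in_diagram[OF assms] by blast
  then show ?thesis using tableau_box(2)[OF assms] by simp
qed

lemma cell_count_eq_0_iff:
  assumes "set_valued_tableau \<mu> T"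
  shows "cell_count T J i = 0 \<longleftrightarrow> (\<forall>r c. J \<le> c \<longrightarrow> i \<notin> T (r, c))"
  unfolding cell_count_def card_0_eq[OF finite_cells[OF assms]] by auto

text \<open>Columns are added from right to left. The inequality could fail only when it was an
  equality and column \<open>J\<close> contains \<open>k + 1\<close>; absence of a violation then
  provides a \<open>k\<close> in the same column.\<close>

lemma yamanouchi_le:
  assumes T: "set_valued_tableau \<mu> T" and Y: "yamanouchi \<nu> T" and k: "1 \<le> k"
  shows "part \<nu> k + cell_count T J (Suc k) \<le> part \<nu> (k - 1) + cell_count T J k"
proof (induction "part \<mu> 0 - J" arbitrary: J)
  case 0
  have "i \<notin> T (r, c)" if "J \<le> c" for i r c
  proof
    assume "i \<in> T (r, c)"
    then have "(0, c) \<in> diagram \<mu>"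
      using tableau_in_diagram[OF T] by (auto intro: diagram_down_closed)
    then show False using 0 that by (simp add: diagram_iff)
  qed
  then have "cell_count T J i = 0" for i by (simp add: cell_count_eq_0_iff[OF T])
  then show ?case by (simp add: part_antimono)
next
  case (Suc d)
  have IH: "part \<nu> k + cell_count T (Suc J) (Suc k) \<le> part \<nu> (k - 1) + cell_count T (Suc J) k"
    using Suc.hyps by (intro Suc.hyps(1)) simp
  show ?case
  proof (cases "\<exists>r. Suc k \<in> T (r, J)")
    case True
    then obtain r where r: "Suc k \<in> T (r, J)" by blast
    have "\<not> violation \<nu> T J k r" using Y by (simp add: yamanouchi_def)
    then have "part \<nu> (k - 1) + cell_count T (Suc J) k \<noteq> part \<nu> k + cell_count T (Suc J) (Suc k)
        \<or> (\<exists>r. k \<in> T (r, J))"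
      using r k unfolding violation_def by blast
    then show ?thesis using IH by (auto simp: cell_count_split[OF T, of J])
  next
    case False
    then show ?thesis using IH by (auto simp: cell_count_split[OF T, of J])
  qed
qed

text \<open>The shape reached after reading the whole word. The argument of \<open>Partition\<close>
  is a partition when \<open>T\<close> is a Yamanouchi tableau for \<nu>.\<close>

definition add_content :: "partition \<Rightarrow> (nat \<times> nat \<Rightarrow> nat set) \<Rightarrow> partition" where
  "add_content \<nu> T = Partition (\<lambda>i. part \<nu> i + cell_count T 0 (Suc i))"

lemma part_add_content:
  assumes T: "set_valued_tableau \<mu> T" and Y: "yamanouchi \<nu> T"
  shows "part (add_content \<nu> T) i = part \<nu> i + cell_count T 0 (Suc i)"
proof -
  have "{i. part \<nu> i + cell_count T 0 (Suc i) \<noteq> 0} \<subseteq>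
      {i. part \<nu> i \<noteq> 0} \<union> Suc -` {x. \<exists>b. x \<in> T b}"
    by (auto simp: cell_count_eq_0_iff[OF T])
  then have "finite {i. part \<nu> i + cell_count T 0 (Suc i) \<noteq> 0}"
    by (rule finite_subset)
      (rule finite_UnI[OF finite_part_support finite_vimageI[OF finite_entries[OF T]]], simp)
  then show ?thesis
    unfolding add_content_def
    by (subst part_Partition) (use yamanouchi_le[OF T Y, of "Suc _" 0] in auto)
qed

text \<open>A box can enter row \<open>e\<close> (counted from 1) only once row \<open>e - 1\<close>
  is longer. For \<open>e > l + 1\<close> both rows are empty in \<nu>, so a letter
  \<open>e - 1\<close> must have been read earlier, in another box.\<close>

lemma yamanouchi_predecessor:
  assumes T: "set_valued_tableau \<mu> T" and Y: "yamanouchi \<nu> T"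
    and len: "\<And>i. l \<le> i \<Longrightarrow> part \<nu> i = 0" and e: "e \<in> T (r, j)" "l + 1 < e"
  shows "\<exists>r' j'. e - 1 \<in> T (r', j') \<and> (j < j' \<or> j = j' \<and> r' < r)"
proof -
  define k where "k = e - 1"
  have k: "e = Suc k" "1 \<le> k" "l \<le> k - 1" using e by (auto simp: k_def)
  let ?P = "\<lambda>c. j \<le> c \<and> (\<exists>r. e \<in> T (r, c))"
  have P: "c < part \<mu> 0" if Pc: "?P c" for c
  proof -
    have "(0, c) \<in> diagram \<mu>"
      using Pc tableau_in_diagram[OF T] by (auto intro: diagram_down_closed)
    then show ?thesis by (simp add: diagram_iff)
  qed
  \<comment> \<open>The rightmost column with \<open>e\<close>, so that no \<open>e\<close> was read
    before it.\<close>
  have "\<exists>c. ?P c \<and> (\<forall>i. ?P i \<longrightarrow> i \<le> c)"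
    by (rule ex_has_greatest_nat[of ?P j "\<lambda>j. j" "part \<mu> 0"]) (use P e in auto)
  then obtain c where c: "?P c" "\<And>i. ?P i \<Longrightarrow> i \<le> c" by blast
  then obtain r' where r': "e \<in> T (r', c)" by blast
  have e0: "cell_count T (Suc c) e = 0"
    unfolding cell_count_eq_0_iff[OF T] using c by (metis Suc_leD Suc_n_not_le_n le_trans)
  show ?thesis
  proof (cases "cell_count T (Suc c) k = 0")
    case True
    have "\<not> violation \<nu> T c k r'" using Y by (simp add: yamanouchi_def)
    then obtain r'' where r'': "r'' < r'" "k \<in> T (r'', c)"
      using True e0 r' k len[of k] len[of "k - 1"] unfolding violation_def by auto
    show ?thesis
    proof (cases "j = c")
      case True
      then have "r = r'" using tableau_unique_row[OF T] e(1) r' by blast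
      then show ?thesis using r'' True by (intro exI[of _ r''] exI[of _ c]) (simp add: k_def)
    next
      case False
      then show ?thesis using r'' c(1) by (intro exI[of _ r''] exI[of _ c]) (simp add: k_def)
    qed
  next
    case False
    then obtain r'' c'' where "Suc c \<le> c''" "k \<in> T (r'', c'')"
      by (auto simp: cell_count_eq_0_iff[OF T])
    then show ?thesis using c(1) by (intro exI[of _ r''] exI[of _ c'']) (simp add: k_def)
  qed
qed

text \<open>With \<open>R\<close> slots per column, \<open>(part \<mu> 0 - j) * R + r\<close>
  measures how late the box is read. Passing from \<open>e\<close> to the preceding
  \<open>e - 1\<close> lowers both the letter and this position by at least one, until the letter is
  at most \<open>l + 1\<close>.\<close>

lemma yamanouchi_entry_bound:
  assumes T: "set_valued_tableau \<mu> T" and Y: "yamanouchi \<nu> T"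
    and len: "\<And>i. l \<le> i \<Longrightarrow> part \<nu> i = 0" and rows: "\<And>i. R \<le> i \<Longrightarrow> part \<mu> i = 0"
    and e: "e \<in> T (r, j)"
  shows "e \<le> l + (part \<mu> 0 - j) * R + r + 1"
  using e
proof (induction e arbitrary: r j rule: less_induct)
  case (less e)
  show ?case
  proof (cases "l + 1 < e")
    case False then show ?thesis by simp
  next
    case True
    obtain r' j' where p: "e - 1 \<in> T (r', j')" and lt: "j < j' \<or> j = j' \<and> r' < r"
      using yamanouchi_predecessor[OF T Y len less.prems True] by blast
    have IH: "e - 1 \<le> l + (part \<mu> 0 - j') * R + r' + 1"
      using less.IH[OF _ p] True by simp
    show ?thesis
    proof (cases "j < j'")
      case j: True
      have d: "j' < part \<mu> r'" using tableau_in_diagram[OF T p] by (simp add: diagram_iff)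
      then have "r' < R" using rows[of r'] by (cases "r' < R") auto
      moreover have "j' < part \<mu> 0" using d part_antimono[of 0 r' \<mu>] by simp
      then have "Suc (part \<mu> 0 - j') \<le> part \<mu> 0 - j" using j by simp
      then have "Suc (part \<mu> 0 - j') * R \<le> (part \<mu> 0 - j) * R" by (rule mult_le_mono1)
      ultimately show ?thesis using IH True by simp
    next
      case False
      then show ?thesis using lt IH True by auto
    qed
  qed
qed

definition littlewood_richardson ::
    "partition \<Rightarrow> partition \<Rightarrow> (nat \<times> nat \<Rightarrow> nat set) set" where
  "littlewood_richardson \<nu> \<mu> = {T. set_valued_tableau \<mu> T \<and> yamanouchi \<nu> T}"

lemma part_eventually_0: obtains l where "\<And>i. l \<le> i \<Longrightarrow> part \<nu> i = 0"
proof -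
  obtain l where "\<And>i. part \<nu> i \<noteq> 0 \<Longrightarrow> i < l"
    using finite_part_support[of \<nu>] by (auto simp: finite_nat_set_iff_bounded)
  then show ?thesis by (intro that[of l]) (metis not_le)
qed

text \<open>The index set of the product formula in \<open>n\<close> variables is eventually
  independent of \<open>n\<close>. This allows the passage from finitely many variables to power
  series.\<close>

lemma littlewood_richardson_bounded:
  "\<exists>n0. \<forall>n\<ge>n0. littlewood_richardson \<nu> \<mu> = {T \<in> bounded_tableaux \<mu> n. yamanouchi \<nu> T}"
proof -
  obtain l where l: "\<And>i. l \<le> i \<Longrightarrow> part \<nu> i = 0" using part_eventually_0 by blast
  obtain R where R: "\<And>i. R \<le> i \<Longrightarrow> part \<mu> i = 0" using part_eventually_0 by blast
  have "T \<in> bounded_tableaux \<mu> n"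
    if T: "set_valued_tableau \<mu> T" "yamanouchi \<nu> T" and n: "n \<ge> l + part \<mu> 0 * R + R + 1" for n T
  proof -
    have "x \<in> {1..n}" if x: "x \<in> T (r, j)" for x r j
    proof -
      have "r < R" using tableau_in_diagram[OF T(1) x] R[of r]
        by (cases "r < R") (auto simp: diagram_iff)
      moreover have "(part \<mu> 0 - j) * R \<le> part \<mu> 0 * R" by simp
      ultimately show ?thesis
        using yamanouchi_entry_bound[where l = l and R = R, OF T l R x] tableau_entry_pos[OF T(1) x] n
        unfolding atLeastAtMost_iff by linarith
    qed
    then show ?thesis using T(1) by (auto simp: bounded_tableaux_def split_paired_All)
  qed
  then show ?thesis
    unfolding littlewood_richardson_def
    by (intro exI[of _ "l + part \<mu> 0 * R + R + 1"]) (blast dest: bounded_tableauxD(1))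
qed

lemma finite_littlewood_richardson: "finite (littlewood_richardson \<nu> \<mu>)"
  using littlewood_richardson_bounded[of \<nu> \<mu>] by (metis (lifting) finite_bounded_tableaux finite_subset mem_Collect_eq order_refl subsetI)

section \<open>The superstandard tableau, alone Yamanouchi for the empty shape\<close>

definition row_tableau :: "partition \<Rightarrow> nat \<times> nat \<Rightarrow> nat set" where
  "row_tableau \<mu> = (\<lambda>(r, c). if (r, c) \<in> diagram \<mu> then {Suc r} else {})"

lemma in_row_tableau: "x \<in> row_tableau \<mu> (r, c) \<longleftrightarrow> c < part \<mu> r \<and> x = Suc r"
  by (simp add: row_tableau_def diagram_iff)

lemma row_tableau: "set_valued_tableau \<mu> (row_tableau \<mu>)"
  unfolding set_valued_tableau_iff
  by (auto simp: in_row_tableau) (auto simp: row_tableau_def diagram_iff)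

lemma cell_count_row_tableau: "cell_count (row_tableau \<mu>) 0 (Suc i) = part \<mu> i"
proof -
  have "{b. 0 \<le> snd b \<and> Suc i \<in> row_tableau \<mu> b} = Pair i ` {..<part \<mu> i}"
    by (auto simp: in_row_tableau split_paired_all)
  then show ?thesis by (simp add: cell_count_def card_image inj_on_def)
qed

lemma yamanouchi_row_tableau: "yamanouchi empty_partition (row_tableau \<mu>)"
  unfolding yamanouchi_def
proof (intro allI notI)
  fix j k r assume v: "violation empty_partition (row_tableau \<mu>) j k r"
  then have k: "r = k" "j < part \<mu> k" "1 \<le> k" and no: "\<And>r'. r' < r \<Longrightarrow> k \<notin> row_tableau \<mu> (r', j)"
    by (auto simp: violation_def in_row_tableau)
  have "j < part \<mu> (k - 1)" using part_antimono[of "k - 1" k \<mu>] k by simp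
  then show False using no[of "k - 1"] k by (simp add: in_row_tableau)
qed

text \<open>Take the rightmost column, and in it the highest box, with an entry \<open>e\<close>
  above the minimum \<open>r + 1\<close>. Row \<open>r\<close> ends there, since further right
  entries are minimal, and so neither \<open>e\<close> nor \<open>e - 1\<close> occurs to the right.
  Then \<open>e - 1\<close> would have to stand above in the same column, where entries are too
  small.\<close>

lemma yamanouchi_empty_unique:
  assumes T: "set_valued_tableau \<mu> T" and Y: "yamanouchi empty_partition T"
  shows "T = row_tableau \<mu>"
proof -
  let ?P = "\<lambda>j. \<exists>r e. e \<in> T (r, j) \<and> Suc r < e"
  have no: "\<not> ?P j" for j
  proof (rule ccontr)
    assume "\<not> \<not> ?P j"
    then have Pj: "?P j" by simp
    have bd: "c < part \<mu> 0" if Pc: "?P c" for c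
    proof -
      have "(0, c) \<in> diagram \<mu>"
        using Pc tableau_in_diagram[OF T] by (auto intro: diagram_down_closed)
      then show ?thesis by (simp add: diagram_iff)
    qed
    have "\<exists>c. ?P c \<and> (\<forall>i. ?P i \<longrightarrow> i \<le> c)"
      by (rule ex_has_greatest_nat[of ?P j "\<lambda>j. j" "part \<mu> 0"]) (use Pj bd in auto)
    then obtain c where c: "?P c" "\<And>i. ?P i \<Longrightarrow> i \<le> c" by blast
    define r where "r = (LEAST r. \<exists>e. e \<in> T (r, c) \<and> Suc r < e)"
    have "\<exists>e. e \<in> T (r, c) \<and> Suc r < e" using c(1) unfolding r_def by (rule LeastI_ex)
    then obtain e where e: "e \<in> T (r, c)" "Suc r < e" by blast
    have r: "x \<le> Suc r'" if "r' < r" "x \<in> T (r', c)" for r' x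
      using not_less_Least[OF that(1)[unfolded r_def]] that(2) by (metis not_le)
    have right: "x \<le> Suc r'" if "c < c'" "x \<in> T (r', c')" for c' r' x
      using c(2)[of c'] that by (metis not_le)
    have corner: "(r, Suc c) \<notin> diagram \<mu>"
    proof
      assume "(r, Suc c) \<in> diagram \<mu>"
      then obtain y where y: "y \<in> T (r, Suc c)" using T tableau_nonempty by blast
      then show False using tableau_row[OF T e(1) y] right[OF _ y] e(2) by simp
    qed
    have z: "cell_count T (Suc c) i = 0" if "r < i" for i
      unfolding cell_count_eq_0_iff[OF T]
    proof (intro allI impI notI)
      fix r' c' assume a: "Suc c \<le> c'" "i \<in> T (r', c')"
      then have "r \<le> r'" using right[of c' i r'] that by simp
      then show False
        using corner diagram_down_closed[OF tableau_in_diagram[OF T a(2)], of r "Suc c"] a(1) by simp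
    qed
    have "\<not> violation empty_partition T c (e - 1) r" using Y by (simp add: yamanouchi_def)
    then obtain r' where "r' < r" "e - 1 \<in> T (r', c)"
      using z[of e] z[of "e - 1"] e by (auto simp: violation_def)
    then show False using r[of r' "e - 1"] e(2) by simp
  qed
  have "x \<in> T (r, c) \<longleftrightarrow> x \<in> row_tableau \<mu> (r, c)" for x r c
  proof
    assume "x \<in> T (r, c)"
    then show "x \<in> row_tableau \<mu> (r, c)"
      using no[of c] tableau_row_ge[OF T, of x r c] tableau_in_diagram[OF T, of x "(r, c)"]
      by (auto simp: in_row_tableau diagram_iff) (metis Suc_leI le_antisym not_le)
  next
    assume "x \<in> row_tableau \<mu> (r, c)"
    then have x: "(r, c) \<in> diagram \<mu>" "x = Suc r" by (auto simp: in_row_tableau diagram_iff)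
    then obtain y where y: "y \<in> T (r, c)" using T tableau_nonempty by blast
    then have "y = Suc r" using no[of c] tableau_row_ge[OF T y] by (metis le_neq_implies_less)
    then show "x \<in> T (r, c)" using x y by simp
  qed
  then show ?thesis by (auto simp: fun_eq_iff split_paired_All)
qed

text \<open>A box is read in decreasing order, so lower rows grow first and no row profits from a
  letter for the row above it. Each letter must therefore name a row that can be lengthened in \<nu>
  itself.\<close>

lemma littlewood_richardson_one_box:
  "T \<in> littlewood_richardson \<nu> one_box \<longleftrightarrow>
    (\<exists>S. S \<noteq> {} \<and> finite S \<and> T = (\<lambda>b. if b = (0, 0) then Suc ` S else {}) \<and>
      (\<forall>k. Suc k \<in> S \<longrightarrow> part \<nu> (Suc k) < part \<nu> k))"
  (is "_ \<longleftrightarrow> ?R")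
proof
  assume L: "T \<in> littlewood_richardson \<nu> one_box"
  then have T: "set_valued_tableau one_box T" and Y: "yamanouchi \<nu> T"
    by (auto simp: littlewood_richardson_def)
  define S where "S = {i. Suc i \<in> T (0, 0)}"
  have box: "T (0, 0) \<noteq> {}" "finite (T (0, 0))" "T (0, 0) \<subseteq> {1..}"
    using tableau_box[OF T, of "(0, 0)"] by auto
  have im: "T (0, 0) = Suc ` S"
  proof (intro set_eqI iffI)
    fix x assume "x \<in> T (0, 0)"
    moreover from this have "1 \<le> x" by (rule tableau_entry_pos[OF T])
    ultimately show "x \<in> Suc ` S" by (cases x) (auto simp: S_def)
  qed (auto simp: S_def)
  have out: "T b = {}" if "b \<noteq> (0, 0)" for b
    by (rule tableau_outside[OF T]) (use that in simp)
  have "part \<nu> (Suc k) < part \<nu> k" if "Suc k \<in> S" for k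
  proof (rule ccontr)
    assume "\<not> part \<nu> (Suc k) < part \<nu> k"
    then have eq: "part \<nu> (Suc k) = part \<nu> k" using part_antimono[of k "Suc k" \<nu>] by simp
    have "cell_count T (Suc 0) i = 0" for i
      unfolding cell_count_eq_0_iff[OF T] using out by auto
    moreover have "Suc (Suc k) \<in> T (0, 0)" using that by (simp add: S_def)
    ultimately have "violation \<nu> T 0 (Suc k) 0" using eq by (simp add: violation_def)
    then show False using Y by (simp add: yamanouchi_def)
  qed
  moreover have "S \<noteq> {}" "finite S" using box im finite_imageD[of Suc S] by auto
  moreover have "T = (\<lambda>b. if b = (0, 0) then Suc ` S else {})" using im out by (auto simp: fun_eq_iff)
  ultimately show ?R by blast
next
  assume ?R
  then obtain S where S: "S \<noteq> {}" "finite S" "\<And>k. Suc k \<in> S \<Longrightarrow> part \<nu> (Suc k) < part \<nu> k"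
    and Teq: "T = (\<lambda>b. if b = (0, 0) then Suc ` S else {})" by blast
  have T: "set_valued_tableau one_box T"
    unfolding set_valued_tableau_iff using S by (auto simp: Teq split: if_splits)
  have "\<not> violation \<nu> T j k r" for j k r
  proof
    assume v: "violation \<nu> T j k r"
    then have j: "j = 0" "r = 0" "k \<in> S" "1 \<le> k" by (auto simp: violation_def Teq split: if_splits)
    have "cell_count T (Suc 0) i = 0" for i
      unfolding cell_count_eq_0_iff[OF T] by (auto simp: Teq)
    then show False using v j S(3)[of "k - 1"] by (simp add: violation_def)
  qed
  then show "T \<in> littlewood_richardson \<nu> one_box" using T by (simp add: littlewood_richardson_def yamanouchi_def)
qed

lemma part_add_content_one_box:
  assumes "T \<in> littlewood_richardson \<nu> one_box"
  shows "part (add_content \<nu> T) i = part \<nu> i + (if Suc i \<in> T (0, 0) then 1 else 0)"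
proof -
  from assms have T: "set_valued_tableau one_box T" and Y: "yamanouchi \<nu> T"
    by (auto simp: littlewood_richardson_def)
  have box: "b = (0, 0)" if "x \<in> T b" for x b using tableau_in_diagram[OF T that] by simp
  have "card {b. Suc i \<in> T b} = (if Suc i \<in> T (0, 0) then 1 else 0)"
  proof (cases "Suc i \<in> T (0, 0)")
    case True
    then have "{b. Suc i \<in> T b} = {(0, 0)}" using box by blast
    with True show ?thesis by simp
  next
    case False
    then have "{b. Suc i \<in> T b} = {}" using box by blast
    with False show ?thesis by (simp only: card.empty if_False)
  qed
  then show ?thesis by (simp add: part_add_content[OF T Y] cell_count_def)
qed

text \<open>A rook strip is a set of corners that can be added to \<nu> independently. If the row
  above had the same length, it would have to grow too, in the same column; conversely, rows that
  grow at corners have different lengths.\<close>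

lemma young_arc_iff:
  "young_arc \<nu> \<mu> \<longleftrightarrow> \<mu> \<noteq> \<nu> \<and> (\<forall>i. part \<mu> i = part \<nu> i \<or>
      part \<mu> i = Suc (part \<nu> i) \<and> (\<forall>k. i = Suc k \<longrightarrow> part \<nu> i < part \<nu> k))"
  (is "_ \<longleftrightarrow> ?R")
proof
  assume arc: "young_arc \<nu> \<mu>"
  have "part \<mu> i = part \<nu> i \<or>
      part \<mu> i = Suc (part \<nu> i) \<and> (\<forall>k. i = Suc k \<longrightarrow> part \<nu> i < part \<nu> k)" for i
  proof -
    have sub: "part \<nu> i \<le> part \<mu> i"
    proof (rule ccontr)
      assume "\<not> ?thesis"
      then have "(i, part \<mu> i) \<in> diagram \<nu>" by (simp add: diagram_iff)
      then have "(i, part \<mu> i) \<in> diagram \<mu>" using arc by (auto simp: young_arc_def)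
      then show False by (simp add: diagram_iff)
    qed
    have "part \<nu> i < part \<nu> k" if k: "i = Suc k" "part \<mu> i = Suc (part \<nu> i)" for k
    proof (rule ccontr)
      assume "\<not> ?thesis"
      then have eq: "part \<nu> i = part \<nu> k" using part_antimono[of k i \<nu>] k by simp
      have "part \<mu> i \<le> part \<mu> k" using k(1) by (intro part_antimono) simp
      then have "(k, part \<nu> k) \<in> diagram \<mu> - diagram \<nu>" "(i, part \<nu> k) \<in> diagram \<mu> - diagram \<nu>"
        using eq k by (auto simp: diagram_iff)
      moreover have "rook_strip (diagram \<mu> - diagram \<nu>)" using arc by (simp add: young_arc_def)
      ultimately show False
        using k unfolding rook_strip_def by (metis n_not_Suc_n prod.inject snd_conv)
    qed
    then show ?thesis using sub young_arc_part_bounds(1)[OF arc, of i] by auto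
  qed
  then show ?R using arc by (simp add: young_arc_def)
next
  assume R: ?R
  then have step: "\<And>i. part \<mu> i = part \<nu> i \<or> part \<mu> i = Suc (part \<nu> i)"
    and corner: "\<And>k. part \<mu> (Suc k) = Suc (part \<nu> (Suc k)) \<Longrightarrow> part \<nu> (Suc k) < part \<nu> k"
    by (metis n_not_Suc_n)+
  have box: "c = part \<nu> r" "part \<mu> r = Suc (part \<nu> r)"
    if "(r, c) \<in> diagram \<mu> - diagram \<nu>" for r c
    using that step[of r] by (auto simp: diagram_iff)
  have lt: "part \<nu> r' < part \<nu> r" if "r < r'" "part \<mu> r' = Suc (part \<nu> r')" for r r'
  proof -
    obtain k where k: "r' = Suc k" using \<open>r < r'\<close> by (cases r') auto
    then show ?thesis using corner[of k] that part_antimono[of r k \<nu>] by simp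
  qed
  have "rook_strip (diagram \<mu> - diagram \<nu>)"
    unfolding rook_strip_def
  proof (intro ballI impI)
    fix b c assume b: "b \<in> diagram \<mu> - diagram \<nu>" and c: "c \<in> diagram \<mu> - diagram \<nu>" and ne: "b \<noteq> c"
    have b': "snd b = part \<nu> (fst b)" "part \<mu> (fst b) = Suc (part \<nu> (fst b))"
      using box[of "fst b" "snd b"] b by auto
    have c': "snd c = part \<nu> (fst c)" "part \<mu> (fst c) = Suc (part \<nu> (fst c))"
      using box[of "fst c" "snd c"] c by auto
    have f: "fst b \<noteq> fst c" using b' c' ne by (metis prod_eqI)
    then show "fst b \<noteq> fst c \<and> snd b \<noteq> snd c"
      using lt[of "fst b" "fst c"] lt[of "fst c" "fst b"] b' c' by (metis linorder_neqE_nat less_irrefl)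
  qed
  moreover have "diagram \<nu> \<subseteq> diagram \<mu>"
  proof
    fix b assume "b \<in> diagram \<nu>"
    then show "b \<in> diagram \<mu>" using step[of "fst b"] by (cases b) (auto simp: diagram_iff)
  qed
  ultimately show "young_arc \<nu> \<mu>" using R by (simp add: young_arc_def)
qed

lemma part_eqI: "(\<And>i. part \<mu> i = part \<nu> i) \<Longrightarrow> \<mu> = \<nu>"
  by (metis ext part_inject)

text \<open>Turns the one-box case of the product formula into the sum over arcs. The inverse takes
  the set of rows in which \<mu> and \<nu> differ.\<close>

lemma bij_betw_one_box:
  "bij_betw (add_content \<nu>) (littlewood_richardson \<nu> one_box) {\<mu>. young_arc \<nu> \<mu>}"
  unfolding bij_betw_def
proof
  show "inj_on (add_content \<nu>) (littlewood_richardson \<nu> one_box)"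
  proof (rule inj_onI)
    fix T U assume T: "T \<in> littlewood_richardson \<nu> one_box" and U: "U \<in> littlewood_richardson \<nu> one_box"
      and eq: "add_content \<nu> T = add_content \<nu> U"
    have "Suc i \<in> T (0, 0) \<longleftrightarrow> Suc i \<in> U (0, 0)" for i
      using part_add_content_one_box[OF T, of i] part_add_content_one_box[OF U, of i] eq
      by (simp split: if_splits)
    moreover obtain S S' where TS: "T = (\<lambda>b. if b = (0, 0) then Suc ` S else {})"
      and US: "U = (\<lambda>b. if b = (0, 0) then Suc ` S' else {})"
      using T U unfolding littlewood_richardson_one_box by blast
    ultimately have "S = S'" by (auto simp: inj_image_mem_iff)
    then show "T = U" unfolding TS US by (rule arg_cong)
  qed
  show "add_content \<nu> ` littlewood_richardson \<nu> one_box = {\<mu>. young_arc \<nu> \<mu>}"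
  proof (intro set_eqI iffI)
    fix \<mu> assume "\<mu> \<in> add_content \<nu> ` littlewood_richardson \<nu> one_box"
    then obtain T where T: "T \<in> littlewood_richardson \<nu> one_box" and \<mu>: "\<mu> = add_content \<nu> T" by blast
    obtain S where S: "S \<noteq> {}" "T = (\<lambda>b. if b = (0, 0) then Suc ` S else {})"
      "\<And>k. Suc k \<in> S \<Longrightarrow> part \<nu> (Suc k) < part \<nu> k"
      using T[unfolded littlewood_richardson_one_box] by blast
    have p: "part \<mu> i = part \<nu> i + (if i \<in> S then 1 else 0)" for i
      using part_add_content_one_box[OF T, of i] by (simp add: \<mu> S(2) image_iff)
    obtain s where "s \<in> S" using S(1) by blast
    then have "part \<mu> s \<noteq> part \<nu> s" using p[of s] by simp
    then have "\<mu> \<noteq> \<nu>" by auto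
    then show "\<mu> \<in> {\<mu>. young_arc \<nu> \<mu>}" using S(3) by (auto simp: young_arc_iff p)
  next
    fix \<mu> assume "\<mu> \<in> {\<mu>. young_arc \<nu> \<mu>}"
    then have ne: "\<mu> \<noteq> \<nu>" and R: "\<And>i. part \<mu> i = part \<nu> i \<or>
      part \<mu> i = Suc (part \<nu> i) \<and> (\<forall>k. i = Suc k \<longrightarrow> part \<nu> i < part \<nu> k)"
      by (auto simp: young_arc_iff)
    define S where "S = {i. part \<mu> i \<noteq> part \<nu> i}"
    define T where "T = (\<lambda>b::nat \<times> nat. if b = (0, 0) then Suc ` S else {})"
    have "part \<mu> i \<noteq> 0" if "i \<in> S" for i
      using that R[of i] unfolding S_def mem_Collect_eq by linarith
    then have "finite S" by (intro finite_subset[OF _ finite_part_support[of \<mu>]]) blast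
    moreover have "S \<noteq> {}" using ne part_eqI[of \<mu> \<nu>] by (auto simp: S_def)
    moreover have "part \<nu> (Suc k) < part \<nu> k" if "Suc k \<in> S" for k
      using that R[of "Suc k"] unfolding S_def by blast
    ultimately have T: "T \<in> littlewood_richardson \<nu> one_box"
      unfolding littlewood_richardson_one_box T_def by (intro exI[of _ S] conjI refl) blast+
    have "part \<mu> i = part (add_content \<nu> T) i" for i
      using part_add_content_one_box[OF T, of i] R[of i] by (auto simp: T_def S_def image_iff)
    then have "\<mu> = add_content \<nu> T" by (rule part_eqI)
    with T show "\<mu> \<in> add_content \<nu> ` littlewood_richardson \<nu> one_box" by blast
  qed
qed

section \<open>Twisted alternants\<close>

text \<open>The Leibniz expansion of the numerator of the bialternant formula. The variables take
  values in \<open>real poly\<close>, the domain in which the Kronecker substitution takes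
  place.\<close>

definition alternant :: "nat \<Rightarrow> (nat \<Rightarrow> real poly) \<Rightarrow> (nat \<Rightarrow> nat) \<Rightarrow> real poly" where
  "alternant n x \<alpha> =
     (\<Sum>p | p permutes {1..n}. of_int (sign p) * (\<Prod>i\<in>{1..n}. x (p i) ^ \<alpha> i * (1 + x (p i)) ^ (i - 1)))"

text \<open>The exponents \<open>\<beta>\<close> of 1 + x in the sum of the two terms are
  \<open>i - 1\<close>, except that position \<open>k\<close> has exponent \<open>k\<close> like its
  successor. As \<open>\<beta>\<close> is invariant under the transposition, \<open>B\<close> is
  antisymmetric.\<close>

lemma alternant_twist:
  assumes k: "1 \<le> k" "k < n"
  shows "alternant n x \<alpha> + alternant n x (\<alpha>(k := \<alpha> k + 1)) =
    - (alternant n x (\<alpha> \<circ> Transposition.transpose k (Suc k)) +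
       alternant n x ((\<alpha> \<circ> Transposition.transpose k (Suc k))(k := \<alpha> (Suc k) + 1)))"
proof -
  define s where "s = Transposition.transpose k (Suc k)"
  have s: "s permutes {1..n}" using k unfolding s_def by (intro permutes_swap_id) auto
  define \<beta> where "\<beta> = (\<lambda>i::nat. i - 1)(k := k)"
  have \<beta>s: "\<beta> (s i) = \<beta> i" for i by (auto simp: \<beta>_def s_def Transposition.transpose_def)
  define B where "B \<alpha> = (\<Sum>p | p permutes {1..n}.
      of_int (sign p) * (\<Prod>i\<in>{1..n}. x (p i) ^ \<alpha> i * (1 + x (p i)) ^ \<beta> i))" for \<alpha>
  have pair: "alternant n x \<alpha> + alternant n x (\<alpha>(k := \<alpha> k + 1)) = B \<alpha>" for \<alpha>
  proof -
    have "(\<Prod>i\<in>{1..n}. x (p i) ^ \<alpha> i * (1 + x (p i)) ^ (i - 1)) +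
        (\<Prod>i\<in>{1..n}. x (p i) ^ (\<alpha>(k := \<alpha> k + 1)) i * (1 + x (p i)) ^ (i - 1)) =
        (\<Prod>i\<in>{1..n}. x (p i) ^ \<alpha> i * (1 + x (p i)) ^ \<beta> i)" for p
    proof -
      have kin: "k \<in> {1..n}" using k by simp
      obtain k' where k': "k = Suc k'" using k by (cases k) auto
      have 1: "(\<Prod>i\<in>{1..n} - {k}. x (p i) ^ (\<alpha>(k := \<alpha> k + 1)) i * (1 + x (p i)) ^ (i - 1)) =
          (\<Prod>i\<in>{1..n} - {k}. x (p i) ^ \<alpha> i * (1 + x (p i)) ^ (i - 1))"
        by (rule prod.cong) auto
      have 2: "(\<Prod>i\<in>{1..n} - {k}. x (p i) ^ \<alpha> i * (1 + x (p i)) ^ \<beta> i) =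
          (\<Prod>i\<in>{1..n} - {k}. x (p i) ^ \<alpha> i * (1 + x (p i)) ^ (i - 1))"
        by (rule prod.cong) (auto simp: \<beta>_def)
      show ?thesis
        unfolding prod.remove[OF finite_atLeastAtMost kin] 1 2
        by (simp add: \<beta>_def k' algebra_simps)
    qed
    then show ?thesis
      unfolding alternant_def B_def sum.distrib[symmetric] distrib_left[symmetric] by simp
  qed
  have "B (\<alpha> \<circ> s) = - B \<alpha>"
  proof -
    have "B (\<alpha> \<circ> s) = (\<Sum>p | p permutes {1..n}.
      of_int (sign p) * (\<Prod>i\<in>{1..n}. x ((p \<circ> s) i) ^ \<alpha> i * (1 + x ((p \<circ> s) i)) ^ \<beta> i))"
      unfolding B_def
    proof (intro sum.cong refl arg_cong2[of _ _ _ _ "(*)"])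
      fix p
      have "(\<Prod>i\<in>{1..n}. x (p i) ^ (\<alpha> \<circ> s) i * (1 + x (p i)) ^ \<beta> i) =
        (\<Prod>i\<in>{1..n}. x (p (s i)) ^ (\<alpha> \<circ> s) (s i) * (1 + x (p (s i))) ^ \<beta> (s i))"
        using prod.permute[OF s, of "\<lambda>i. x (p i) ^ (\<alpha> \<circ> s) i * (1 + x (p i)) ^ \<beta> i"]
        by (simp add: o_def)
      then show "(\<Prod>i\<in>{1..n}. x (p i) ^ (\<alpha> \<circ> s) i * (1 + x (p i)) ^ \<beta> i) =
        (\<Prod>i\<in>{1..n}. x ((p \<circ> s) i) ^ \<alpha> i * (1 + x ((p \<circ> s) i)) ^ \<beta> i)"
        by (simp add: \<beta>s) (simp add: s_def)
    qed
    also have "\<dots> = (\<Sum>p | p permutes {1..n}. - of_int (sign (p \<circ> s)) *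
        (\<Prod>i\<in>{1..n}. x ((p \<circ> s) i) ^ \<alpha> i * (1 + x ((p \<circ> s) i)) ^ \<beta> i))"
    proof (intro sum.cong refl arg_cong2[of _ _ _ _ "(*)"])
      fix p assume "p \<in> {p. p permutes {1..n}}"
      then have "permutation p" "permutation s"
        using s permutation_permutes finite_atLeastAtMost by blast+
      then have "sign (p \<circ> s) = - sign p" by (simp add: sign_compose s_def sign_swap_id)
      then show "of_int (sign p) = (- of_int (sign (p \<circ> s)) :: real poly)" by simp
    qed
    also have "\<dots> = (\<Sum>p | p permutes {1..n}. - of_int (sign p) *
        (\<Prod>i\<in>{1..n}. x (p i) ^ \<alpha> i * (1 + x (p i)) ^ \<beta> i))"
      by (rule sum_permutations_compose_right[OF s, symmetric])
    finally show ?thesis by (simp add: B_def sum_negf)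
  qed
  then show ?thesis
    using pair[of \<alpha>] pair[of "\<alpha> \<circ> s"] by (simp add: s_def)
qed

lemma twisted_alternant_alternant: "twisted_alternant n (alternant n x)"
  by unfold_locales (rule alternant_twist)

section \<open>Symmetry in finitely many variables\<close>

definition G_poly :: "partition \<Rightarrow> nat \<Rightarrow> (nat \<Rightarrow> real poly) \<Rightarrow> real poly" where
  "G_poly \<mu> n x = (\<Sum>T\<in>bounded_tableaux \<mu> n. \<Prod>i\<in>{1..n}. x i ^ cell_count T 0 i)"

text \<open>The Bender-Knuth move on the whole tableau: \<open>J\<close> is the number of columns,
  so column \<open>J\<close> is empty and the multiplicities of \<open>k\<close> and
  \<open>k + 1\<close> are exchanged.\<close>

lemma G_poly_adjacent:
  assumes kn: "1 \<le> k" "k < n"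
  shows "G_poly \<mu> n (x \<circ> Transposition.transpose k (Suc k)) = G_poly \<mu> n x"
proof -
  define s where "s = Transposition.transpose k (Suc k)"
  have s: "s permutes {1..n}" using kn unfolding s_def by (intro permutes_swap_id) auto
  define J where "J = part \<mu> 0"
  have empty: "T (r, c) = {}" if T: "T \<in> bounded_tableaux \<mu> n" and c: "J \<le> c" for T r c
  proof (rule ccontr)
    assume "T (r, c) \<noteq> {}"
    then have "(0, c) \<in> diagram \<mu>"
      using tableau_in_diagram[OF bounded_tableauxD(1)[OF T]] by (auto intro: diagram_down_closed)
    then show False using c by (simp add: J_def diagram_iff)
  qed
  have bks: "bender_knuth_setup \<mu> T J k" if "T \<in> bounded_tableaux \<mu> n" for T
    using bounded_tableauxD(1)[OF that] empty[OF that] kn by unfold_locales auto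
  have bk: "bender_knuth J k T \<in> bounded_tableaux \<mu> n"
    and cc: "cell_count (bender_knuth J k T) 0 i = cell_count T 0 (s i)"
    if TB: "T \<in> bounded_tableaux \<mu> n" for T i
  proof -
    interpret bender_knuth_setup \<mu> T J k using bks[OF TB] .
    have "x \<in> {1..n}" if "x \<in> T' (a, c)" for a c x
      using that bk_other[of x a c] bounded_tableauxD(2)[OF TB, of x "(a, c)"] kn
      by (cases "x = k \<or> x = Suc k") auto
    then show T': "T' \<in> bounded_tableaux \<mu> n"
      using bk_tableau by (auto simp: bounded_tableaux_def split_paired_All)
    interpret B: bender_knuth_setup \<mu> T' J k using bks[OF T'] .
    have zero: "cell_count U J i = 0" if "U \<in> bounded_tableaux \<mu> n" for U i
      using cell_count_eq_0_iff[OF bounded_tableauxD(1)[OF that]] empty[OF that] by simp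
    note left = cell_count_left[OF bk_tableau, of _ J] cell_count_left[OF bounded_tableauxD(1)[OF TB], of _ J]
    have "cell_count T' 0 k = cell_count T 0 (Suc k)"
      using bk_left_count by (simp add: left zero TB T')
    moreover have "cell_count T' 0 (Suc k) = cell_count T 0 k"
      using B.bk_left_count by (simp add: left zero TB T' bk_involution)
    moreover have "cell_count T' 0 i = cell_count T 0 i" if "i \<noteq> k" "i \<noteq> Suc k" for i
      by (rule cell_count_cong) (use bk_other[OF that] in \<open>auto simp: split_paired_all\<close>)
    ultimately show "cell_count T' 0 i = cell_count T 0 (s i)"
      by (auto simp: s_def Transposition.transpose_def)
  qed
  have "G_poly \<mu> n (x \<circ> s) =
      (\<Sum>T\<in>bounded_tableaux \<mu> n. \<Prod>i\<in>{1..n}. x i ^ cell_count (bender_knuth J k T) 0 i)"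
    unfolding G_poly_def
  proof (rule sum.cong[OF refl])
    fix T assume T: "T \<in> bounded_tableaux \<mu> n"
    have "(\<Prod>i\<in>{1..n}. (x \<circ> s) i ^ cell_count T 0 i) =
        (\<Prod>i\<in>{1..n}. x (s (s i)) ^ cell_count T 0 (s i))"
      using prod.permute[OF s, of "\<lambda>i. (x \<circ> s) i ^ cell_count T 0 i"] by (simp add: o_def)
    then show "(\<Prod>i\<in>{1..n}. (x \<circ> s) i ^ cell_count T 0 i) =
        (\<Prod>i\<in>{1..n}. x i ^ cell_count (bender_knuth J k T) 0 i)"
      by (simp add: cc[OF T]) (simp add: s_def)
  qed
  also have "\<dots> = G_poly \<mu> n x"
    unfolding G_poly_def
    by (rule sum.reindex_bij_witness[of _ "bender_knuth J k" "bender_knuth J k"])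
      (use bk bender_knuth_setup.bk_involution[OF bks] in auto)
  finally show ?thesis by (simp add: s_def)
qed

lemma symmetric_if_adjacent_symmetric:
  fixes f :: "(nat \<Rightarrow> 'a) \<Rightarrow> 'b"
  assumes adj: "\<And>k x. 1 \<le> k \<Longrightarrow> k < n \<Longrightarrow> f (x \<circ> Transposition.transpose k (Suc k)) = f x"
    and p: "p permutes {1..n}"
  shows "f (x \<circ> p) = f x"
proof -
  have up: "f (x \<circ> Transposition.transpose a b) = f x" if "1 \<le> a" "a < b" "b \<le> n" for a b x
    using that
  proof (induction b arbitrary: x)
    case (Suc b)
    show ?case
    proof (cases "a = b")
      case True
      then show ?thesis using adj[of b x] Suc.prems by (simp only:)
    next
      case False
      let ?t = "Transposition.transpose b (Suc b)"
      have "Transposition.transpose a (Suc b) = ?t \<circ> Transposition.transpose a b \<circ> ?t"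
        using False Suc.prems by (auto simp: fun_eq_iff Transposition.transpose_def)
      then have "f (x \<circ> Transposition.transpose a (Suc b)) =
          f ((x \<circ> ?t \<circ> Transposition.transpose a b) \<circ> ?t)" by (simp add: o_assoc)
      also have "\<dots> = f (x \<circ> ?t \<circ> Transposition.transpose a b)"
        by (rule adj) (use Suc.prems in auto)
      also have "\<dots> = f (x \<circ> ?t)"
        by (rule Suc.IH) (use Suc.prems False in auto)
      also have "\<dots> = f x" by (rule adj) (use Suc.prems in auto)
      finally show ?thesis .
    qed
  qed simp
  have transp: "f (x \<circ> Transposition.transpose a b) = f x"
    if "a \<in> {1..n}" "b \<in> {1..n}" "a \<noteq> b" for a b x
    using up[of a b x] up[of b a x] that
    by (cases a b rule: linorder_cases) (auto simp: transpose_commute)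
  show ?thesis
    using p finite_atLeastAtMost
  proof (induction arbitrary: x rule: permutes_induct)
    case (swap a b p)
    have "f (x \<circ> (Transposition.transpose a b \<circ> p)) = f (x \<circ> Transposition.transpose a b \<circ> p)"
      by (simp add: o_assoc)
    also have "\<dots> = f (x \<circ> Transposition.transpose a b)" by (rule swap)
    also have "\<dots> = f x" by (rule transp) (use swap in auto)
    finally show ?case .
  qed simp
qed

lemma G_poly_symmetric: "p permutes {1..n} \<Longrightarrow> G_poly \<mu> n (x \<circ> p) = G_poly \<mu> n x"
  by (rule symmetric_if_adjacent_symmetric[of n "G_poly \<mu> n", OF G_poly_adjacent])

text \<open>By symmetry the summand of \<open>p\<close> may be multiplied by \<open>G_poly\<close>
  in the variables permuted by \<open>p\<close>; the exponents of its monomials are then simply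
  added to \<alpha>.\<close>

lemma G_poly_times_alternant:
  "G_poly \<mu> n x * alternant n x \<alpha> =
    (\<Sum>T\<in>bounded_tableaux \<mu> n. alternant n x (\<lambda>i. \<alpha> i + cell_count T 0 i))"
proof -
  have "G_poly \<mu> n x * alternant n x \<alpha> = (\<Sum>p | p permutes {1..n}. G_poly \<mu> n (x \<circ> p) *
      (of_int (sign p) * (\<Prod>i\<in>{1..n}. x (p i) ^ \<alpha> i * (1 + x (p i)) ^ (i - 1))))"
    unfolding alternant_def sum_distrib_left by (rule sum.cong) (auto simp: G_poly_symmetric)
  also have "\<dots> = (\<Sum>p | p permutes {1..n}. \<Sum>T\<in>bounded_tableaux \<mu> n. of_int (sign p) *
      (\<Prod>i\<in>{1..n}. x (p i) ^ (\<alpha> i + cell_count T 0 i) * (1 + x (p i)) ^ (i - 1)))"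
    unfolding G_poly_def sum_distrib_right
    by (intro sum.cong refl) (simp add: power_add prod.distrib mult_ac)
  also have "\<dots> = (\<Sum>T\<in>bounded_tableaux \<mu> n. alternant n x (\<lambda>i. \<alpha> i + cell_count T 0 i))"
    unfolding alternant_def by (rule sum.swap)
  finally show ?thesis .
qed

section \<open>The bialternant formula and products in finitely many variables\<close>

definition shape_alternant :: "nat \<Rightarrow> (nat \<Rightarrow> real poly) \<Rightarrow> partition \<Rightarrow> real poly" where
  "shape_alternant n x \<nu> = alternant n x (\<lambda>i. part \<nu> (i - 1) + (n - i))"

lemma G_poly_times_shape_alternant:
  "G_poly \<mu> n x * shape_alternant n x \<nu> =
    (\<Sum>T | T \<in> bounded_tableaux \<mu> n \<and> yamanouchi \<nu> T. shape_alternant n x (add_content \<nu> T))"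
proof -
  have "G_poly \<mu> n x * shape_alternant n x \<nu> =
      (\<Sum>T\<in>bounded_tableaux \<mu> n. alternant n x (exponents \<nu> n T))"
    unfolding shape_alternant_def G_poly_times_alternant
    by (rule sum.cong) (simp_all add: exponents_def[abs_def])
  also have "\<dots> = (\<Sum>T | T \<in> bounded_tableaux \<mu> n \<and> yamanouchi \<nu> T. alternant n x (exponents \<nu> n T))"
    by (rule twisted_alternant.sum_yamanouchi[OF twisted_alternant_alternant])
  also have "\<dots> = (\<Sum>T | T \<in> bounded_tableaux \<mu> n \<and> yamanouchi \<nu> T. shape_alternant n x (add_content \<nu> T))"
  proof (rule sum.cong[OF refl])
    fix T assume "T \<in> {T. T \<in> bounded_tableaux \<mu> n \<and> yamanouchi \<nu> T}"
    then have T: "set_valued_tableau \<mu> T" "yamanouchi \<nu> T" by (auto dest: bounded_tableauxD(1))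
    have "exponents \<nu> n T i = part (add_content \<nu> T) (i - 1) + (n - i)" if "i \<in> {1..n}" for i
      using that by (simp add: exponents_def part_add_content[OF T])
    then show "alternant n x (exponents \<nu> n T) = shape_alternant n x (add_content \<nu> T)"
      unfolding shape_alternant_def alternant_def by (intro sum.cong refl) simp
  qed
  finally show ?thesis .
qed

text \<open>The product formula started from the empty shape: the superstandard tableau alone
  survives the cancellation, and the hypothesis makes its letters fit into
  \<open>{1..n}\<close>.\<close>

lemma G_poly_bialternant:
  assumes "part \<mu> n = 0"
  shows "G_poly \<mu> n x * shape_alternant n x empty_partition = shape_alternant n x \<mu>"
proof -
  have rows: "r < n" if "c < part \<mu> r" for r c
    using that assms part_antimono[of n r \<mu>] by (cases "r < n") auto
  have "row_tableau \<mu> \<in> bounded_tableaux \<mu> n"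
    using row_tableau[of \<mu>] rows
    by (auto simp: bounded_tableaux_def split_paired_All in_row_tableau Suc_le_eq)
  then have "{T. T \<in> bounded_tableaux \<mu> n \<and> yamanouchi empty_partition T} = {row_tableau \<mu>}"
    using yamanouchi_row_tableau yamanouchi_empty_unique by (auto dest: bounded_tableauxD(1))
  moreover have "add_content empty_partition (row_tableau \<mu>) = \<mu>"
    by (rule part_eqI)
      (simp add: part_add_content[OF row_tableau yamanouchi_row_tableau] cell_count_row_tableau)
  ultimately show ?thesis by (simp add: G_poly_times_shape_alternant)
qed

text \<open>Both sides are multiplied by the common denominator and compared through
  \<open>G_poly_times_shape_alternant\<close>. Letters are at most \<open>n\<close>, so every
  \<open>add_content \<nu> T\<close> has at most \<open>n\<close> rows and the bialternant formula
  applies to it.\<close>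

lemma G_poly_product:
  assumes n: "part \<nu> n = 0" and nz: "shape_alternant n x empty_partition \<noteq> 0"
  shows "G_poly \<nu> n x * G_poly \<mu> n x =
    (\<Sum>T | T \<in> bounded_tableaux \<mu> n \<and> yamanouchi \<nu> T. G_poly (add_content \<nu> T) n x)"
proof -
  let ?Y = "{T. T \<in> bounded_tableaux \<mu> n \<and> yamanouchi \<nu> T}"
  let ?D = "shape_alternant n x empty_partition"
  have "G_poly \<nu> n x * G_poly \<mu> n x * ?D = G_poly \<mu> n x * shape_alternant n x \<nu>"
    using G_poly_bialternant[OF n, of x] by (simp add: mult_ac)
  also have "\<dots> = (\<Sum>T\<in>?Y. shape_alternant n x (add_content \<nu> T))"
    by (rule G_poly_times_shape_alternant)
  also have "\<dots> = (\<Sum>T\<in>?Y. G_poly (add_content \<nu> T) n x * ?D)"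
  proof (rule sum.cong[OF refl])
    fix T assume "T \<in> ?Y"
    then have T: "set_valued_tableau \<mu> T" "yamanouchi \<nu> T" and b: "T \<in> bounded_tableaux \<mu> n"
      by (auto dest: bounded_tableauxD(1))
    have "cell_count T 0 (Suc n) = 0"
      unfolding cell_count_eq_0_iff[OF T(1)] using bounded_tableauxD(2)[OF b, of "Suc n"] by auto
    then have "part (add_content \<nu> T) n = 0" by (simp add: part_add_content[OF T] n)
    then show "shape_alternant n x (add_content \<nu> T) = G_poly (add_content \<nu> T) n x * ?D"
      by (simp add: G_poly_bialternant)
  qed
  finally show ?thesis using nz by (simp add: sum_distrib_right[symmetric])
qed

section \<open>The product of two series\<close>

text \<open>Kronecker substitution: with \<open>x\<^sub>i = t^(B^i)\<close>, monomials with exponents below \<open>B\<close> are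
  distinguished by the resulting power of \<open>t\<close>.\<close>

definition encode :: "nat \<Rightarrow> nat \<Rightarrow> (nat \<Rightarrow> nat) \<Rightarrow> nat" where
  "encode B n f = (\<Sum>i\<in>{1..n}. f i * B ^ i)"

definition kronecker :: "nat \<Rightarrow> nat \<Rightarrow> real poly" where
  "kronecker B i = monom 1 (B ^ i)"

lemma encode_less:
  assumes "0 < B" and "\<And>i. i \<in> {1..n} \<Longrightarrow> f i < B"
  shows "encode B n f < B ^ Suc n"
  using assms
proof (induction n)
  case 0
  then show ?case by (simp add: encode_def)
next
  case (Suc n)
  have "encode B (Suc n) f = encode B n f + f (Suc n) * B ^ Suc n" by (simp add: encode_def)
  also have "\<dots> < B ^ Suc n + f (Suc n) * B ^ Suc n"
    using Suc by (intro add_strict_right_mono) auto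
  also have "\<dots> = Suc (f (Suc n)) * B ^ Suc n" by simp
  also have "\<dots> \<le> B * B ^ Suc n" using Suc.prems(2)[of "Suc n"] by (intro mult_le_mono1) simp
  finally show ?case by simp
qed

lemma encode_inject:
  assumes "\<And>i. i \<in> {1..n} \<Longrightarrow> f i < B" "\<And>i. i \<in> {1..n} \<Longrightarrow> g i < B"
    and "encode B n f = encode B n g" "i \<in> {1..n}"
  shows "f i = g i"
  using assms
proof (induction n)
  case (Suc n)
  have lt: "encode B n f < B ^ Suc n" "encode B n g < B ^ Suc n"
    by (rule encode_less; use Suc.prems(1,2)[of "Suc n"] Suc.prems(1,2) in force)+
  have e: "encode B n f + f (Suc n) * B ^ Suc n = encode B n g + g (Suc n) * B ^ Suc n"
    using Suc.prems(3) by (simp add: encode_def)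
  have digit: "(a + q * d) div d = q" if "a < d" for a q d :: nat using that by simp
  have top: "f (Suc n) = g (Suc n)" using digit[OF lt(1)] digit[OF lt(2)] e by metis
  then show ?case
    using Suc.IH Suc.prems e by (cases "i = Suc n") auto
qed simp

lemma monom_power_prod:
  "finite A \<Longrightarrow> (\<Prod>i\<in>A. monom (1::real) (e i)) = monom 1 (\<Sum>i\<in>A. e i)"
  by (induction A rule: finite_induct) (auto simp: mult_monom)

lemma kronecker_prod: "(\<Prod>i\<in>{1..n}. kronecker B i ^ f i) = monom 1 (encode B n f)"
proof -
  have "kronecker B i ^ f i = monom 1 (f i * B ^ i)" for i
    by (simp add: kronecker_def monom_power mult.commute)
  then show ?thesis by (simp add: monom_power_prod encode_def)
qed

text \<open>The lowest power of t survives. The exponents \<open>e p\<close> have base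
  \<open>B\<close> digits \<open>n - inv p v\<close>, hence are distinct, and the twist factors
  \<open>q p\<close> have constant term 1. So the smallest \<open>e p\<close> occurs with
  coefficient 1 or -1.\<close>

lemma shape_alternant_nonzero:
  assumes B: "n \<le> B"
  shows "shape_alternant n (kronecker B) empty_partition \<noteq> 0"
proof -
  let ?P = "{p. p permutes {1..n}}"
  define e where "e p = encode B n (\<lambda>v. n - inv p v)" for p
  define q where "q p = (\<Prod>i\<in>{1..n}. (1 + kronecker B (p i)) ^ (i - 1))" for p :: "nat \<Rightarrow> nat"
  have B0: "B ^ i \<noteq> 0" if "i \<in> {1..n}" for i using that B by auto
  have q0: "coeff (q p) 0 = 1" if p: "p permutes {1..n}" for p
  proof -
    have "poly (kronecker B (p i)) 0 = 0" if i: "i \<in> {1..n}" for i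
    proof -
      have "p i \<in> {1..n}" using i by (simp only: permutes_in_image[OF p])
      then show ?thesis using B0[of "p i"] by (simp add: kronecker_def poly_monom)
    qed
    then have "poly (q p) 0 = 1" by (simp add: q_def poly_prod poly_power)
    then show ?thesis by (simp add: poly_0_coeff_0)
  qed
  have expand: "shape_alternant n (kronecker B) empty_partition =
      (\<Sum>p\<in>?P. of_int (sign p) * (monom 1 (e p) * q p))"
    unfolding shape_alternant_def alternant_def
  proof (rule sum.cong[OF refl])
    fix p assume "p \<in> ?P"
    then have p: "p permutes {1..n}" by simp
    have "(\<Prod>i\<in>{1..n}. kronecker B (p i) ^ (n - i)) = (\<Prod>v\<in>{1..n}. kronecker B v ^ (n - inv p v))"
      using prod.permute[OF p, of "\<lambda>v. kronecker B v ^ (n - inv p v)"] permutes_inverses(2)[OF p]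
      by (simp add: o_def)
    then show "of_int (sign p) * (\<Prod>i\<in>{1..n}. kronecker B (p i) ^ (part empty_partition (i - 1) + (n - i)) *
        (1 + kronecker B (p i)) ^ (i - 1)) = of_int (sign p) * (monom 1 (e p) * q p)"
      unfolding q_def e_def kronecker_prod part_empty_partition add_0 prod.distrib by (simp only:)
  qed
  have inj: "inj_on e ?P"
  proof (rule inj_onI)
    fix p p' assume "p \<in> ?P" "p' \<in> ?P" and eq: "e p = e p'"
    then have p: "p permutes {1..n}" and p': "p' permutes {1..n}" by auto
    have mem: "inv p v \<in> {1..n}" "inv p' v \<in> {1..n}" if "v \<in> {1..n}" for v
      using that permutes_in_image[OF permutes_inv[OF p]] permutes_in_image[OF permutes_inv[OF p']] by auto
    have "inv p v = inv p' v" for v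
    proof (cases "v \<in> {1..n}")
      case True
      have "n - inv p v = n - inv p' v"
        by (rule encode_inject[OF _ _ eq[unfolded e_def] True]) (use mem B in fastforce)+
      then show ?thesis using mem[OF True] by auto
    next
      case False
      then show ?thesis
        using permutes_not_in[OF permutes_inv[OF p]] permutes_not_in[OF permutes_inv[OF p']] by simp
    qed
    then have "inv p = inv p'" by (rule ext)
    then show "p = p'" using p p' by (metis permutes_inv_inv)
  qed
  have fin: "finite ?P" by (rule finite_permutations) simp
  have "id \<in> ?P" by (simp add: permutes_id)
  then obtain p0 where p0: "p0 \<in> ?P" "\<And>p. p \<in> ?P \<Longrightarrow> e p0 \<le> e p"
    using arg_min_if_finite[OF fin, of e] by (metis empty_iff not_le)
  have "coeff (of_int (sign p) * (monom 1 (e p) * q p)) (e p0) = (if p = p0 then of_int (sign p0) else 0)"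
    if "p \<in> ?P" for p
  proof (cases "p = p0")
    case True
    then show ?thesis using q0 p0 by (simp add: of_int_poly coeff_monom_mult)
  next
    case False
    then have "e p0 < e p" using p0(2)[OF that] inj that p0(1) by (metis inj_onD le_neq_implies_less)
    then show ?thesis using False by (simp add: of_int_poly coeff_monom_mult)
  qed
  then have "coeff (shape_alternant n (kronecker B) empty_partition) (e p0) = of_int (sign p0)"
    unfolding expand coeff_sum using fin p0(1) by (simp add: sum.delta)
  moreover have "sign p0 \<noteq> 0" by (simp add: sign_def)
  ultimately show ?thesis by auto
qed

section \<open>Reading coefficients of the series off polynomials in t\<close>

lemma coefficient_sum: "coefficient (\<Sum>a\<in>A. f a) M = (\<Sum>a\<in>A. coefficient (f a) M)"
proof (induction A rule: infinite_finite_induct)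
  case (insert a A)
  then show ?case by (simp add: plus_power_series.rep_eq)
qed (simp_all add: zero_power_series.rep_eq)

lemma coefficient_G_tilde:
  "coefficient (G_tilde \<kappa>) M = real (card {T. set_valued_tableau \<kappa> T \<and> tableau_weight \<kappa> T = M})"
  by (simp add: G_tilde_def Power_Series_inverse)

lemma set_mset_tableau_weight:
  assumes "set_valued_tableau \<kappa> T" shows "set_mset (tableau_weight \<kappa> T) = {x. \<exists>b. x \<in> T b}"
proof -
  have "x \<in># tableau_weight \<kappa> T \<longleftrightarrow> (\<exists>b. x \<in> T b)" for x
    using cell_count_0[OF assms, of x] cell_count_eq_0_iff[OF assms, of 0 x]
    by (auto simp: count_greater_zero_iff[symmetric] simp del: count_greater_zero_iff)
  then show ?thesis by blast
qed

lemma coefficient_G_tilde_bounded: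
  assumes "set_mset M \<subseteq> {1..n}"
  shows "coefficient (G_tilde \<kappa>) M = (\<Sum>T\<in>bounded_tableaux \<kappa> n. of_bool (tableau_weight \<kappa> T = M))"
proof -
  have "{T. set_valued_tableau \<kappa> T \<and> tableau_weight \<kappa> T = M} =
      {T \<in> bounded_tableaux \<kappa> n. tableau_weight \<kappa> T = M}"
    using assms set_mset_tableau_weight by (fastforce simp: bounded_tableaux_def)
  then have "coefficient (G_tilde \<kappa>) M = real (card (bounded_tableaux \<kappa> n \<inter> {T. tableau_weight \<kappa> T = M}))"
    unfolding coefficient_G_tilde by (simp only: Collect_conj_eq Collect_mem_eq)
  then show ?thesis by simp
qed

lemma bounded_set_mset_tableau_weight:
  assumes "T \<in> bounded_tableaux \<kappa> n" shows "set_mset (tableau_weight \<kappa> T) \<subseteq> {1..n}"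
  unfolding set_mset_tableau_weight[OF bounded_tableauxD(1)[OF assms]]
  using bounded_tableauxD(2)[OF assms] by auto

text \<open>A letter occurs at most once per box: the degree in each single variable is bounded
  although the total degree need not be. So one base \<open>B\<close> serves all monomials of the
  series.\<close>

lemma count_tableau_weight_le:
  assumes "set_valued_tableau \<kappa> T" shows "count (tableau_weight \<kappa> T) i \<le> card (diagram \<kappa>)"
  unfolding count_tableau_weight[OF assms] by (rule card_mono) auto

lemma G_poly_kronecker:
  "G_poly \<kappa> n (kronecker B) = (\<Sum>T\<in>bounded_tableaux \<kappa> n. monom 1 (encode B n (count (tableau_weight \<kappa> T))))"
  unfolding G_poly_def kronecker_prod
proof (rule sum.cong[OF refl])
  fix T assume "T \<in> bounded_tableaux \<kappa> n"
  then have "cell_count T 0 = count (tableau_weight \<kappa> T)"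
    by (intro ext cell_count_0 bounded_tableauxD(1))
  then show "monom 1 (encode B n (cell_count T 0)) = monom 1 (encode B n (count (tableau_weight \<kappa> T)))"
    by (rule arg_cong)
qed

lemma encode_count_eq_iff:
  assumes "set_mset M \<subseteq> {1..n}" "set_mset N \<subseteq> {1..n}"
    and "\<And>i. count M i < B" "\<And>i. count N i < B"
  shows "encode B n (count M) = encode B n (count N) \<longleftrightarrow> M = N"
proof
  assume eq: "encode B n (count M) = encode B n (count N)"
  show "M = N"
  proof (rule multiset_eqI)
    fix i
    show "count M i = count N i"
    proof (cases "i \<in> {1..n}")
      case True
      show ?thesis by (rule encode_inject[OF _ _ eq True]) (use assms in auto)
    next
      case False
      then have "i \<notin># M" "i \<notin># N" using assms by blast+
      then show ?thesis by (simp add: not_in_iff)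
    qed
  qed
qed simp

lemma coeff_G_poly:
  assumes M: "set_mset M \<subseteq> {1..n}" "size M < B" and B: "card (diagram \<kappa>) < B"
  shows "coeff (G_poly \<kappa> n (kronecker B)) (encode B n (count M)) = coefficient (G_tilde \<kappa>) M"
  unfolding G_poly_kronecker coeff_sum coefficient_G_tilde_bounded[OF M(1)]
proof (rule sum.cong[OF refl])
  fix T assume T: "T \<in> bounded_tableaux \<kappa> n"
  note T' = bounded_tableauxD(1)[OF T]
  have "encode B n (count (tableau_weight \<kappa> T)) = encode B n (count M) \<longleftrightarrow> tableau_weight \<kappa> T = M"
    using count_tableau_weight_le[OF T'] count_le_size[of M] M B
    by (intro encode_count_eq_iff bounded_set_mset_tableau_weight[OF T]) (auto intro: le_less_trans)
  then show "coeff (monom 1 (encode B n (count (tableau_weight \<kappa> T)))) (encode B n (count M)) =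
      of_bool (tableau_weight \<kappa> T = M)" by simp
qed

text \<open>The bound on \<open>B\<close> prevents carries when the digits of two monomials are
  added.\<close>

lemma coeff_G_poly_mult:
  assumes M: "set_mset M \<subseteq> {1..n}" "size M < B" and B: "card (diagram \<nu>) + card (diagram \<mu>) < B"
  shows "coeff (G_poly \<nu> n (kronecker B) * G_poly \<mu> n (kronecker B)) (encode B n (count M)) =
    coefficient (G_tilde \<nu> * G_tilde \<mu>) M"
proof -
  let ?w = "tableau_weight"
  have "coefficient (G_tilde \<nu> * G_tilde \<mu>) M = (\<Sum>(A, C) | A + C = M.
      \<Sum>T\<in>bounded_tableaux \<nu> n. \<Sum>U\<in>bounded_tableaux \<mu> n. of_bool (?w \<nu> T = A) * of_bool (?w \<mu> U = C))"
    unfolding times_power_series.rep_eq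
  proof (intro sum.cong refl)
    fix p assume "p \<in> {(A, C). A + C = M}"
    then obtain A C where p: "p = (A, C)" and AC: "A + C = M" by blast
    have A: "set_mset A \<subseteq> {1..n}" and C: "set_mset C \<subseteq> {1..n}" using AC M by auto
    show "(case p of (A, C) \<Rightarrow> coefficient (G_tilde \<nu>) A * coefficient (G_tilde \<mu>) C) =
      (case p of (A, C) \<Rightarrow> \<Sum>T\<in>bounded_tableaux \<nu> n. \<Sum>U\<in>bounded_tableaux \<mu> n.
        of_bool (?w \<nu> T = A) * of_bool (?w \<mu> U = C))"
      unfolding p prod.case coefficient_G_tilde_bounded[OF A] coefficient_G_tilde_bounded[OF C]
      by (rule sum_product)
  qed
  also have "\<dots> = (\<Sum>p | fst p + snd p = M. \<Sum>T\<in>bounded_tableaux \<nu> n. \<Sum>U\<in>bounded_tableaux \<mu> n.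
      of_bool (p = (?w \<nu> T, ?w \<mu> U)))"
    by (rule sum.cong, simp add: case_prod_unfold, unfold case_prod_unfold, intro sum.cong refl)
      (auto simp: prod_eq_iff)
  also have "\<dots> = (\<Sum>T\<in>bounded_tableaux \<nu> n. \<Sum>U\<in>bounded_tableaux \<mu> n.
      \<Sum>p | fst p + snd p = M. of_bool (p = (?w \<nu> T, ?w \<mu> U)))"
    by (subst sum.swap, rule sum.cong[OF refl], rule sum.swap)
  also have "\<dots> = (\<Sum>T\<in>bounded_tableaux \<nu> n. \<Sum>U\<in>bounded_tableaux \<mu> n. of_bool (?w \<nu> T + ?w \<mu> U = M))"
  proof (intro sum.cong refl)
    fix T U
    have fin: "finite {p. fst p + snd p = M}"
      using finite_mset_decompositions[of M] by (simp add: case_prod_unfold)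
    show "(\<Sum>p | fst p + snd p = M. of_bool (p = (?w \<nu> T, ?w \<mu> U))) = (of_bool (?w \<nu> T + ?w \<mu> U = M) :: real)"
      using sum.delta'[OF fin, of "(?w \<nu> T, ?w \<mu> U)" "\<lambda>_. 1 :: real"] by (simp add: of_bool_def eq_commute)
  qed
  also have "\<dots> = coeff (G_poly \<nu> n (kronecker B) * G_poly \<mu> n (kronecker B)) (encode B n (count M))"
    unfolding G_poly_kronecker sum_product coeff_sum
  proof (intro sum.cong refl)
    fix T U assume T: "T \<in> bounded_tableaux \<nu> n" and U: "U \<in> bounded_tableaux \<mu> n"
    have "encode B n (count (?w \<nu> T)) + encode B n (count (?w \<mu> U)) = encode B n (count (?w \<nu> T + ?w \<mu> U))"
      by (simp add: encode_def sum.distrib add_mult_distrib)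
    moreover have "count (?w \<nu> T + ?w \<mu> U) i < B" for i
      using count_tableau_weight_le[OF bounded_tableauxD(1)[OF T], of i]
        count_tableau_weight_le[OF bounded_tableauxD(1)[OF U], of i] B by simp
    then have "encode B n (count (?w \<nu> T + ?w \<mu> U)) = encode B n (count M) \<longleftrightarrow> ?w \<nu> T + ?w \<mu> U = M"
      using bounded_set_mset_tableau_weight[OF T] bounded_set_mset_tableau_weight[OF U] M le_less_trans[OF count_le_size[of M] M(2)]
      by (intro encode_count_eq_iff) auto
    ultimately show "of_bool (?w \<nu> T + ?w \<mu> U = M) =
        coeff (monom (1::real) (encode B n (count (?w \<nu> T))) * monom 1 (encode B n (count (?w \<mu> U)))) (encode B n (count M))"
      by (simp add: mult_monom)
  qed
  finally show ?thesis ..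
qed

text \<open>Coefficients are compared at one monomial \<open>M\<close> at a time, with
  \<open>n\<close> and \<open>B\<close> chosen depending on \<open>M\<close>. If \<open>M\<close>
  contains the variable with index 0, both coefficients vanish because tableau entries are
  positive.\<close>

theorem G_tilde_product:
  "G_tilde \<nu> * G_tilde \<mu> = (\<Sum>T\<in>littlewood_richardson \<nu> \<mu>. G_tilde (add_content \<nu> T))"
proof -
  have "coefficient (G_tilde \<nu> * G_tilde \<mu>) M =
      coefficient (\<Sum>T\<in>littlewood_richardson \<nu> \<mu>. G_tilde (add_content \<nu> T)) M" for M
  proof (cases "0 \<in># M")
    case False
    obtain n0 where n0: "\<And>n. n0 \<le> n \<Longrightarrow>
        littlewood_richardson \<nu> \<mu> = {T \<in> bounded_tableaux \<mu> n. yamanouchi \<nu> T}"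
      using littlewood_richardson_bounded by blast
    obtain l where l: "\<And>i. l \<le> i \<Longrightarrow> part \<nu> i = 0" using part_eventually_0 by blast
    \<comment> \<open>Large enough for the index set to be stable, for \<nu> to have at most
      \<open>n\<close> rows, and for all variables of \<open>M\<close>.\<close>
    define n where "n = n0 + l + (\<Sum>x\<in>set_mset M. x)"
    let ?LR = "littlewood_richardson \<nu> \<mu>"
    define B where "B = n + size M + card (diagram \<nu>) + card (diagram \<mu>) +
      (\<Sum>T\<in>?LR. card (diagram (add_content \<nu> T))) + 1"
    have LR: "?LR = {T. T \<in> bounded_tableaux \<mu> n \<and> yamanouchi \<nu> T}" using n0[of n] by (simp add: n_def)
    have M: "set_mset M \<subseteq> {1..n}"
    proof
      fix x assume x: "x \<in># M"
      then have "x \<le> (\<Sum>x\<in>set_mset M. x)" by (intro member_le_sum) auto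
      moreover have "x \<noteq> 0" using x False by metis
      ultimately show "x \<in> {1..n}" by (simp add: n_def)
    qed
    have "coefficient (G_tilde \<nu> * G_tilde \<mu>) M =
        coeff (G_poly \<nu> n (kronecker B) * G_poly \<mu> n (kronecker B)) (encode B n (count M))"
      by (rule coeff_G_poly_mult[symmetric, OF M]) (auto simp: B_def)
    also have "G_poly \<nu> n (kronecker B) * G_poly \<mu> n (kronecker B) =
        (\<Sum>T\<in>?LR. G_poly (add_content \<nu> T) n (kronecker B))"
      unfolding LR
      by (rule G_poly_product[OF _ shape_alternant_nonzero]) (use l in \<open>auto simp: B_def n_def\<close>)
    also have "coeff \<dots> (encode B n (count M)) = (\<Sum>T\<in>?LR. coefficient (G_tilde (add_content \<nu> T)) M)"
      unfolding coeff_sum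
    proof (rule sum.cong[OF refl])
      fix T assume T: "T \<in> ?LR"
      have "card (diagram (add_content \<nu> T)) \<le> (\<Sum>T\<in>?LR. card (diagram (add_content \<nu> T)))"
        by (rule member_le_sum[OF T]) (auto simp: finite_littlewood_richardson)
      then show "coeff (G_poly (add_content \<nu> T) n (kronecker B)) (encode B n (count M)) =
          coefficient (G_tilde (add_content \<nu> T)) M"
        by (intro coeff_G_poly M) (auto simp: B_def)
    qed
    finally show ?thesis by (simp add: coefficient_sum)
  next
    case True
    have zero: "coefficient (G_tilde \<kappa>) A = 0" if "0 \<in># A" for \<kappa> A
    proof -
      have "tableau_weight \<kappa> T \<noteq> A" if T: "set_valued_tableau \<kappa> T" for T
        using set_mset_tableau_weight[OF T] tableau_entry_pos[OF T] \<open>0 \<in># A\<close> by fastforce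
      then have "{T. set_valued_tableau \<kappa> T \<and> tableau_weight \<kappa> T = A} = {}" by blast
      then show ?thesis by (simp only: coefficient_G_tilde card.empty of_nat_0)
    qed
    have "(\<Sum>(A, C) | A + C = M. coefficient (G_tilde \<nu>) A * coefficient (G_tilde \<mu>) C) = 0"
    proof (rule sum.neutral, rule ballI)
      fix p assume "p \<in> {(A, C). A + C = M}"
      then obtain A C where p: "p = (A, C)" "A + C = M" by blast
      with True have "0 \<in># A \<or> 0 \<in># C" by auto
      then show "(case p of (A, C) \<Rightarrow> coefficient (G_tilde \<nu>) A * coefficient (G_tilde \<mu>) C) = 0"
        using zero p(1) by auto
    qed
    then show ?thesis
      using zero[OF True] by (simp add: coefficient_sum times_power_series.rep_eq)
  qed
  then show ?thesis by (metis coefficient_inject ext)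
qed

corollary G_tilde_one_box_times: "G_tilde \<nu> * G_tilde one_box = (\<Sum>\<mu> | young_arc \<nu> \<mu>. G_tilde \<mu>)"
  unfolding G_tilde_product using sum.reindex_bij_betw[OF bij_betw_one_box, of G_tilde] .

text \<open>
  \<open>row_content \<kappa>\<close> is the monomial of the tableau filling row \<open>i\<close> with \<open>i + 1\<close>, whose entries
  are the smallest possible ones; hence it is a leading monomial for the order by \<open>row_weight\<close>.
\<close>

definition row_content :: "partition \<Rightarrow> nat multiset" where
  "row_content \<kappa> = tableau_weight \<kappa> (row_tableau \<kappa>)"

definition row_weight :: "partition \<Rightarrow> nat" where
  "row_weight \<kappa> = (\<Sum>b\<in>diagram \<kappa>. Suc (fst b))"

lemma row_tableau_box: "b \<in> diagram \<kappa> \<Longrightarrow> row_tableau \<kappa> b = {Suc (fst b)}"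
  by (cases b) (simp add: row_tableau_def)

lemma sum_mset_tableau_weight:
  "set_valued_tableau \<kappa> T \<Longrightarrow> sum_mset (tableau_weight \<kappa> T) = (\<Sum>b\<in>diagram \<kappa>. \<Sum>x\<in>T b. x)"
proof -
  have "sum_mset (\<Sum>b\<in>A. f b) = (\<Sum>b\<in>A. sum_mset (f b))"
    for A and f :: "nat \<times> nat \<Rightarrow> nat multiset"
    by (induction A rule: infinite_finite_induct) auto
  then show ?thesis unfolding tableau_weight_def by (simp add: sum_unfold_sum_mset)
qed

text \<open>Compare the sums of all letters. An entry in row \<open>i\<close> (counted from 0) is at
  least \<open>i + 1\<close>, so \<open>row_weight \<mu>\<close> is the smallest sum for shape
  \<mu>, and equality forces every box of row \<open>i\<close> to be the singleton of
  \<open>i + 1\<close>.\<close>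

lemma row_weight_le:
  assumes T: "set_valued_tableau \<mu> T" and w: "tableau_weight \<mu> T = row_content \<kappa>"
  shows "row_weight \<mu> \<le> row_weight \<kappa>" "row_weight \<mu> = row_weight \<kappa> \<Longrightarrow> \<mu> = \<kappa>"
proof -
  have tot: "(\<Sum>b\<in>diagram \<mu>. \<Sum>x\<in>T b. x) = row_weight \<kappa>"
  proof -
    have "(\<Sum>b\<in>diagram \<mu>. \<Sum>x\<in>T b. x) = sum_mset (row_content \<kappa>)"
      using sum_mset_tableau_weight[OF T] w by simp
    also have "\<dots> = (\<Sum>b\<in>diagram \<kappa>. \<Sum>x\<in>row_tableau \<kappa> b. x)"
      unfolding row_content_def by (rule sum_mset_tableau_weight[OF row_tableau])
    also have "\<dots> = row_weight \<kappa>" by (simp add: row_weight_def row_tableau_box)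
    finally show ?thesis .
  qed
  have ge: "Suc (fst b) \<le> (\<Sum>x\<in>T b. x)" if b: "b \<in> diagram \<mu>" for b
  proof -
    obtain x where x: "x \<in> T b" using T b tableau_nonempty by blast
    have "Suc (fst b) \<le> x" using tableau_row_ge[OF T, of x "fst b" "snd b"] x by simp
    also have "x \<le> (\<Sum>x\<in>T b. x)" using tableau_box(2)[OF T b] x by (intro member_le_sum) auto
    finally show ?thesis .
  qed
  have "row_weight \<mu> \<le> (\<Sum>b\<in>diagram \<mu>. \<Sum>x\<in>T b. x)"
    unfolding row_weight_def by (rule sum_mono) (rule ge)
  then show "row_weight \<mu> \<le> row_weight \<kappa>" by (simp only: tot)
  assume eq: "row_weight \<mu> = row_weight \<kappa>"
  have eqb: "(\<Sum>x\<in>T b. x) = Suc (fst b)" if b: "b \<in> diagram \<mu>" for b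
  proof (rule ccontr)
    assume "(\<Sum>x\<in>T b. x) \<noteq> Suc (fst b)"
    with ge[OF b] have "Suc (fst b) < (\<Sum>x\<in>T b. x)" by simp
    then have "row_weight \<mu> < (\<Sum>b\<in>diagram \<mu>. \<Sum>x\<in>T b. x)"
      unfolding row_weight_def by (intro sum_strict_mono_ex1) (use ge b in auto)
    then show False using tot eq by simp
  qed
  have "T b = row_tableau \<mu> b" for b
  proof (cases "b \<in> diagram \<mu>")
    case True
    obtain x where x: "x \<in> T b" using T True tableau_nonempty by blast
    have fin: "finite (T b)" using tableau_box(2)[OF T True] .
    have "y = Suc (fst b)" if y: "y \<in> T b" for y
    proof -
      have "y \<le> (\<Sum>x\<in>T b. x)" using fin y by (intro member_le_sum) auto
      moreover have "Suc (fst b) \<le> y" using tableau_row_ge[OF T, of y "fst b" "snd b"] y by simp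
      ultimately show ?thesis using eqb[OF True] by simp
    qed
    with x show ?thesis unfolding row_tableau_box[OF True] by blast
  next
    case False
    then show ?thesis using tableau_outside[OF T] tableau_outside[OF row_tableau] by simp
  qed
  then have "T = row_tableau \<mu>" by (rule ext)
  then have "row_content \<mu> = row_content \<kappa>" using w by (simp add: row_content_def)
  then have "cell_count (row_tableau \<mu>) 0 i = cell_count (row_tableau \<kappa>) 0 i" for i
    by (simp add: cell_count_0[OF row_tableau] row_content_def)
  then show "\<mu> = \<kappa>" by (intro part_eqI) (metis cell_count_row_tableau)
qed

lemma coefficient_row_content:
  "coefficient (G_tilde \<kappa>) (row_content \<kappa>) \<noteq> 0"
  "row_weight \<kappa> \<le> row_weight \<mu> \<Longrightarrow> \<mu> \<noteq> \<kappa> \<Longrightarrow> coefficient (G_tilde \<mu>) (row_content \<kappa>) = 0"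
proof -
  have "row_tableau \<kappa> \<in> {T. set_valued_tableau \<kappa> T \<and> tableau_weight \<kappa> T = row_content \<kappa>}"
    using row_tableau by (simp add: row_content_def)
  then show "coefficient (G_tilde \<kappa>) (row_content \<kappa>) \<noteq> 0"
    unfolding coefficient_G_tilde using finite_tableaux_of_weight[of \<kappa> "row_content \<kappa>"]
    by (metis card_0_eq empty_iff of_nat_eq_0_iff)
  assume "row_weight \<kappa> \<le> row_weight \<mu>" "\<mu> \<noteq> \<kappa>"
  then have "{T. set_valued_tableau \<mu> T \<and> tableau_weight \<mu> T = row_content \<kappa>} = {}"
    using row_weight_le le_antisym by blast
  then show "coefficient (G_tilde \<mu>) (row_content \<kappa>) = 0"
    by (simp only: coefficient_G_tilde card.empty of_nat_0)
qed

lemma inj_G_tilde: "inj G_tilde"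
proof (rule injI)
  fix \<kappa> \<mu> assume "G_tilde \<kappa> = G_tilde \<mu>"
  then show "\<kappa> = \<mu>" using coefficient_row_content by (metis linear)
qed

lemma coefficient_scaleR: "coefficient (c *\<^sub>R f) M = c * coefficient f M"
  by (simp add: scaleR_power_series.rep_eq)

text \<open>Triangularity: in a vanishing combination take \<kappa> of least
  \<open>row_weight\<close> with nonzero coefficient. No other term contains the monomial
  \<open>row_content \<kappa>\<close>.\<close>

lemma independent_G_tilde: "independent (range G_tilde)"
  unfolding independent_explicit_finite_subsets
proof (intro allI impI ballI)
  fix A u v assume A: "A \<subseteq> range G_tilde" "finite A" and 0: "(\<Sum>v\<in>A. u v *\<^sub>R v) = 0" and v: "v \<in> A"
  show "u v = 0"
  proof (rule ccontr)
    assume nz: "u v \<noteq> 0"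
    let ?S = "{\<kappa>. G_tilde \<kappa> \<in> A \<and> u (G_tilde \<kappa>) \<noteq> 0}"
    obtain \<kappa>0 where "\<kappa>0 \<in> ?S" using v nz A by blast
    then obtain \<kappa> where \<kappa>: "\<kappa> \<in> ?S" and min: "\<And>\<mu>. \<mu> \<in> ?S \<Longrightarrow> row_weight \<kappa> \<le> row_weight \<mu>"
      using ex_has_least_nat[of "\<lambda>\<kappa>. \<kappa> \<in> ?S" \<kappa>0 row_weight] by blast
    let ?c = "\<lambda>f. coefficient f (row_content \<kappa>)"
    have "0 = ?c (\<Sum>v\<in>A. u v *\<^sub>R v)" using 0 by (simp add: zero_power_series.rep_eq)
    also have "\<dots> = (\<Sum>v\<in>A. u v * ?c v)" by (simp add: coefficient_sum coefficient_scaleR)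
    also have "\<dots> = (\<Sum>v\<in>{G_tilde \<kappa>}. u v * ?c v)"
    proof (rule sum.mono_neutral_right[OF A(2)])
      show "\<forall>v\<in>A - {G_tilde \<kappa>}. u v * ?c v = 0"
      proof
        fix v assume v: "v \<in> A - {G_tilde \<kappa>}"
        then obtain \<mu> where \<mu>: "v = G_tilde \<mu>" "\<mu> \<noteq> \<kappa>" using A by blast
        show "u v * ?c v = 0"
          using coefficient_row_content(2)[of \<kappa> \<mu>] min[of \<mu>] v \<mu> by (cases "u v = 0") auto
      qed
    qed (use \<kappa> in simp)
    finally show False using \<kappa> coefficient_row_content(1)[of \<kappa>] by simp
  qed
qed

section \<open>Harmonic functions and homomorphisms\<close>

lemma Gamma_algI [simp]: "G_tilde \<kappa> \<in> Gamma_alg"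
  by (simp add: Gamma_alg_def span_base)

lemma Gamma_alg_add: "f \<in> Gamma_alg \<Longrightarrow> g \<in> Gamma_alg \<Longrightarrow> f + g \<in> Gamma_alg"
  by (simp add: Gamma_alg_def span_add)

lemma Gamma_alg_scale: "f \<in> Gamma_alg \<Longrightarrow> c *\<^sub>R f \<in> Gamma_alg"
  by (simp add: Gamma_alg_def span_scale)

lemma Gamma_alg_diff: "f \<in> Gamma_alg \<Longrightarrow> g \<in> Gamma_alg \<Longrightarrow> f - g \<in> Gamma_alg"
  by (simp add: Gamma_alg_def span_diff)

lemma Gamma_alg_0 [simp]: "0 \<in> Gamma_alg"
  by (simp add: Gamma_alg_def span_zero)

lemma Gamma_alg_1 [simp]: "1 \<in> Gamma_alg"
  using Gamma_algI[of empty_partition] by (simp add: G_tilde_empty)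

lemma Gamma_alg_sum: "(\<And>a. a \<in> A \<Longrightarrow> f a \<in> Gamma_alg) \<Longrightarrow> (\<Sum>a\<in>A. f a) \<in> Gamma_alg"
  by (simp add: Gamma_alg_def span_sum)

lemma Gamma_alg_induct [consumes 1, case_names zero add scale G]:
  assumes f: "f \<in> Gamma_alg" and 0: "P 0"
    and add: "\<And>f g. f \<in> Gamma_alg \<Longrightarrow> g \<in> Gamma_alg \<Longrightarrow> P f \<Longrightarrow> P g \<Longrightarrow> P (f + g)"
    and scale: "\<And>c f. f \<in> Gamma_alg \<Longrightarrow> P f \<Longrightarrow> P (c *\<^sub>R f)"
    and G: "\<And>\<kappa>. P (G_tilde \<kappa>)"
  shows "P f"
proof -
  have "f \<in> Gamma_alg \<and> P f"
    using f unfolding Gamma_alg_def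
  proof (rule span_induct)
    show "subspace {f. f \<in> span (range G_tilde) \<and> P f}"
      using 0 add scale unfolding Gamma_alg_def subspace_def
      by (auto intro: span_add span_scale span_zero)
  qed (use G in \<open>auto intro: span_base\<close>)
  then show ?thesis ..
qed

lemma Gamma_alg_mult:
  assumes f: "f \<in> Gamma_alg" and g: "g \<in> Gamma_alg"
  shows "f * g \<in> Gamma_alg"
  using f
proof (induction rule: Gamma_alg_induct)
  case (G \<kappa>)
  show ?case
    using g
  proof (induction rule: Gamma_alg_induct)
    case (G \<mu>)
    show ?case unfolding G_tilde_product by (rule Gamma_alg_sum) simp
  qed (simp_all add: distrib_left Gamma_alg_add Gamma_alg_scale)
qed (simp_all add: distrib_right Gamma_alg_add Gamma_alg_scale)

lemma Gamma_alg_power: "f \<in> Gamma_alg \<Longrightarrow> f ^ n \<in> Gamma_alg"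
  by (induction n) (simp_all add: Gamma_alg_mult)

section \<open>The cone of nonnegative combinations and its order unit\<close>

inductive_set G_cone :: "power_series set" where
  zero: "0 \<in> G_cone"
| add: "f \<in> G_cone \<Longrightarrow> g \<in> G_cone \<Longrightarrow> f + g \<in> G_cone"
| G: "0 \<le> c \<Longrightarrow> c *\<^sub>R G_tilde \<kappa> \<in> G_cone"

lemma G_cone_G_tilde [simp]: "G_tilde \<kappa> \<in> G_cone"
  using G_cone.G[of 1 \<kappa>] by simp

lemma G_cone_subset: "f \<in> G_cone \<Longrightarrow> f \<in> Gamma_alg"
  by (induction rule: G_cone.induct) (simp_all add: Gamma_alg_add Gamma_alg_scale)

lemma G_cone_sum: "(\<And>a. a \<in> A \<Longrightarrow> f a \<in> G_cone) \<Longrightarrow> (\<Sum>a\<in>A. f a) \<in> G_cone"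
  by (induction A rule: infinite_finite_induct) (simp_all add: G_cone.zero G_cone.add)

lemma G_cone_scale: "f \<in> G_cone \<Longrightarrow> 0 \<le> c \<Longrightarrow> c *\<^sub>R f \<in> G_cone"
  by (induction rule: G_cone.induct) (simp_all add: G_cone.intros scaleR_add_right)

lemma G_cone_mult:
  assumes f: "f \<in> G_cone" and g: "g \<in> G_cone"
  shows "f * g \<in> G_cone"
  using f
proof (induction rule: G_cone.induct)
  case (G c \<kappa>)
  have "G_tilde \<kappa> * g \<in> G_cone"
    using g
  proof (induction rule: G_cone.induct)
    case (G c' \<mu>)
    have "G_tilde \<kappa> * G_tilde \<mu> \<in> G_cone" unfolding G_tilde_product by (rule G_cone_sum) simp
    then show ?case using G by (simp add: G_cone_scale)
  qed (simp_all add: distrib_left G_cone.zero G_cone.add)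
  then show ?case using G by (simp add: G_cone_scale)
qed (simp_all add: distrib_right G_cone.zero G_cone.add)

lemma exists_arc_below:
  assumes "\<kappa> \<noteq> empty_partition"
  shows "\<exists>\<nu>. young_arc \<nu> \<kappa>"
proof -
  obtain l where l: "\<And>i. l \<le> i \<Longrightarrow> part \<kappa> i = 0" using part_eventually_0 by blast
  have "\<exists>i. part \<kappa> i \<noteq> 0"
  proof (rule ccontr)
    assume "\<nexists>i. part \<kappa> i \<noteq> 0"
    then have "\<kappa> = empty_partition" by (intro part_eqI) simp
    with assms show False ..
  qed
  then obtain i0 where i0: "part \<kappa> i0 \<noteq> 0" by blast
  have "\<exists>r. part \<kappa> r \<noteq> 0 \<and> (\<forall>i. part \<kappa> i \<noteq> 0 \<longrightarrow> i \<le> r)"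
  proof (rule ex_has_greatest_nat[of "\<lambda>i. part \<kappa> i \<noteq> 0" i0 "\<lambda>i. i" l])
    show "\<forall>i. part \<kappa> i \<noteq> 0 \<longrightarrow> i < l" using l by (metis not_le)
  qed (rule i0)
  then obtain r where r: "part \<kappa> r \<noteq> 0" "\<And>i. part \<kappa> i \<noteq> 0 \<Longrightarrow> i \<le> r" by blast
  \<comment> \<open>Remove the last box of the last nonempty row.\<close>
  define f where "f = (part \<kappa>)(r := part \<kappa> r - 1)"
  have "f (Suc i) \<le> f i" for i
  proof (cases "i = r")
    case True
    have "part \<kappa> (Suc r) = 0" using r(2)[of "Suc r"] by auto
    then show ?thesis using True by (simp add: f_def)
  next
    case False
    then show ?thesis using part_antimono[of i "Suc i" \<kappa>] by (auto simp: f_def)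
  qed
  moreover have "finite {i. f i \<noteq> 0}"
    by (rule finite_subset[OF _ finite_part_support[of \<kappa>]]) (auto simp: f_def split: if_splits)
  ultimately have part: "part (Partition f) = f" by (rule part_Partition)
  have "Partition f \<noteq> \<kappa>"
  proof
    assume "Partition f = \<kappa>"
    then have "f r = part \<kappa> r" using part by simp
    then show False using r(1) by (simp add: f_def)
  qed
  moreover have "f r < f k" if "r = Suc k" for k
    using part_antimono[of k r \<kappa>] that r(1) by (simp add: f_def)
  ultimately have "young_arc (Partition f) \<kappa>"
    unfolding young_arc_iff part using r(1) by (auto simp: f_def)
  then show ?thesis ..
qed

text \<open>\<kappa> is reached from the empty shape along arcs, and each multiplication by
  \<open>G_tilde one_box\<close> yields all arc targets. Since states do not see factors
  \<open>G_tilde one_box\<close>, every basis element gets a complement in the cone, like an event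
  in probability.\<close>

lemma power_minus_G_tilde_in_G_cone: "\<exists>n. G_tilde one_box ^ n - G_tilde \<kappa> \<in> G_cone"
proof (induction "card (diagram \<kappa>)" arbitrary: \<kappa> rule: less_induct)
  case less
  show ?case
  proof (cases "\<kappa> = empty_partition")
    case True
    then show ?thesis by (intro exI[of _ 0]) (simp add: G_tilde_empty G_cone.zero)
  next
    case False
    then obtain \<nu> where \<nu>: "young_arc \<nu> \<kappa>" using exists_arc_below by blast
    have "diagram \<nu> \<noteq> diagram \<kappa>"
    proof
      assume eq: "diagram \<nu> = diagram \<kappa>"
      have "part \<nu> i = part \<kappa> i" for i
        using eq diagram_iff[of i _ \<nu>] diagram_iff[of i _ \<kappa>] by (metis linorder_neqE_nat less_irrefl)
      then show False using \<nu> part_eqI[of \<kappa> \<nu>] by (simp add: young_arc_def)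
    qed
    then have "diagram \<nu> \<subset> diagram \<kappa>" using \<nu> by (auto simp: young_arc_def)
    then have "card (diagram \<nu>) < card (diagram \<kappa>)" by (simp add: psubset_card_mono)
    then obtain n where n: "G_tilde one_box ^ n - G_tilde \<nu> \<in> G_cone" using less by blast
    have "G_tilde \<nu> * G_tilde one_box - G_tilde \<kappa> = (\<Sum>\<mu>\<in>{\<mu>. young_arc \<nu> \<mu>} - {\<kappa>}. G_tilde \<mu>)"
      unfolding G_tilde_one_box_times using \<nu> sum.remove[OF finite_young_arcs, of \<kappa> \<nu> G_tilde] by simp
    also have "\<dots> \<in> G_cone" by (rule G_cone_sum) simp
    finally have "(G_tilde one_box ^ n - G_tilde \<nu>) * G_tilde one_box +
        (G_tilde \<nu> * G_tilde one_box - G_tilde \<kappa>) \<in> G_cone"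
      using n by (intro G_cone.add G_cone_mult) simp_all
    then show ?thesis by (intro exI[of _ "Suc n"]) (simp add: algebra_simps)
  qed
qed

text \<open>The functionals corresponding to harmonic functions: positive normalized functionals on
  \<open>\<Gamma> / (G\<^sub>1 - 1)\<close>.\<close>

definition states :: "(power_series \<Rightarrow> real) set" where
  "states = {\<psi>. linear_on_Gamma \<psi> \<and> G_positive \<psi> \<and> \<psi> 1 = 1 \<and>
     (\<forall>f\<in>Gamma_alg. \<psi> (f * G_tilde one_box) = \<psi> f)}"

lemma linear_on_Gamma_add: "linear_on_Gamma \<psi> \<Longrightarrow> f \<in> Gamma_alg \<Longrightarrow> g \<in> Gamma_alg \<Longrightarrow> \<psi> (f + g) = \<psi> f + \<psi> g"
  and linear_on_Gamma_scale: "linear_on_Gamma \<psi> \<Longrightarrow> f \<in> Gamma_alg \<Longrightarrow> \<psi> (c *\<^sub>R f) = c * \<psi> f"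
  by (simp_all add: linear_on_Gamma_def)

lemma linear_on_Gamma_0: "linear_on_Gamma \<psi> \<Longrightarrow> \<psi> 0 = 0"
  using linear_on_Gamma_scale[of \<psi> 0 0] by simp

lemma linear_on_Gamma_diff:
  "linear_on_Gamma \<psi> \<Longrightarrow> f \<in> Gamma_alg \<Longrightarrow> g \<in> Gamma_alg \<Longrightarrow> \<psi> (f - g) = \<psi> f - \<psi> g"
  using linear_on_Gamma_add[of \<psi> "f - g" g] by (simp add: Gamma_alg_diff)

lemma linear_on_Gamma_sum:
  "linear_on_Gamma \<psi> \<Longrightarrow> (\<And>a. a \<in> A \<Longrightarrow> f a \<in> Gamma_alg) \<Longrightarrow> \<psi> (\<Sum>a\<in>A. f a) = (\<Sum>a\<in>A. \<psi> (f a))"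
  by (induction A rule: infinite_finite_induct)
    (simp_all add: linear_on_Gamma_0 linear_on_Gamma_add Gamma_alg_sum)

lemma statesD:
  assumes "\<psi> \<in> states"
  shows "linear_on_Gamma \<psi>" "\<psi> 1 = 1" "f \<in> Gamma_alg \<Longrightarrow> \<psi> (f * G_tilde one_box) = \<psi> f"
    "0 \<le> \<psi> (G_tilde \<kappa>)"
  using assms by (simp_all add: states_def G_positive_def)

lemma states_nonneg:
  assumes "\<psi> \<in> states" "f \<in> G_cone" shows "0 \<le> \<psi> f"
  using assms(2)
  by (induction rule: G_cone.induct)
    (simp_all add: statesD[OF assms(1)] G_cone_subset linear_on_Gamma_0 linear_on_Gamma_add linear_on_Gamma_scale)

lemma states_power:
  assumes \<psi>: "\<psi> \<in> states" and f: "f \<in> Gamma_alg" shows "\<psi> (f * G_tilde one_box ^ n) = \<psi> f"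
proof (induction n)
  case (Suc n)
  have "\<psi> (f * G_tilde one_box ^ Suc n) = \<psi> (f * G_tilde one_box ^ n * G_tilde one_box)"
    by (simp add: mult_ac)
  also have "\<dots> = \<psi> (f * G_tilde one_box ^ n)"
    by (rule statesD(3)[OF \<psi>]) (simp add: f Gamma_alg_mult Gamma_alg_power)
  finally show ?case using Suc by simp
qed simp

lemma harmonic_states:
  assumes "\<phi> \<in> harmonic_functions" "linear_on_Gamma \<psi>" "\<And>\<kappa>. \<psi> (G_tilde \<kappa>) = \<phi> \<kappa>"
  shows "\<psi> \<in> states"
proof -
  have h: "\<phi> \<kappa> = (\<Sum>\<mu> | young_arc \<kappa> \<mu>. \<phi> \<mu>)" "0 \<le> \<phi> \<kappa>" "\<phi> empty_partition = 1" for \<kappa>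
    using assms(1) unfolding harmonic_functions_def by blast+
  have "\<psi> (f * G_tilde one_box) = \<psi> f" if "f \<in> Gamma_alg" for f
    using that
  proof (induction rule: Gamma_alg_induct)
    case (G \<kappa>)
    show ?case
      unfolding G_tilde_one_box_times assms(3) h(1)[of \<kappa>]
      by (subst linear_on_Gamma_sum[OF assms(2)]) (simp_all add: assms(3))
  qed (simp_all add: distrib_right linear_on_Gamma_add[OF assms(2)] linear_on_Gamma_scale[OF assms(2)] Gamma_alg_mult)
  moreover have "\<psi> 1 = 1" using assms(3)[of empty_partition] h(3) by (simp add: G_tilde_empty)
  ultimately show ?thesis using assms h(2) by (simp add: states_def G_positive_def)
qed

lemma states_harmonic:
  assumes "\<psi> \<in> states" shows "(\<lambda>\<kappa>. \<psi> (G_tilde \<kappa>)) \<in> harmonic_functions"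
proof -
  have "\<psi> (G_tilde \<kappa>) = (\<Sum>\<mu> | young_arc \<kappa> \<mu>. \<psi> (G_tilde \<mu>))" for \<kappa>
  proof -
    have "\<psi> (G_tilde \<kappa>) = \<psi> (G_tilde \<kappa> * G_tilde one_box)" by (simp add: statesD(3)[OF assms])
    also have "\<dots> = (\<Sum>\<mu> | young_arc \<kappa> \<mu>. \<psi> (G_tilde \<mu>))"
      unfolding G_tilde_one_box_times by (rule linear_on_Gamma_sum[OF statesD(1)[OF assms]]) simp
    finally show ?thesis .
  qed
  moreover have "\<psi> (G_tilde empty_partition) = 1" by (simp add: G_tilde_empty statesD(2)[OF assms])
  ultimately show ?thesis
    unfolding harmonic_functions_def using statesD(4)[OF assms] by blast
qed

text \<open>Positivity after multiplication by \<open>c\<close> is where the nonnegative structure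
  constants enter, through \<open>G_cone_mult\<close>.\<close>

lemma states_condition:
  assumes \<psi>: "\<psi> \<in> states" and c: "c \<in> G_cone" and p: "0 < \<psi> c"
  shows "(\<lambda>f. \<psi> (f * c) / \<psi> c) \<in> states"
proof -
  note lin = statesD(1)[OF \<psi>]
  have cG: "c \<in> Gamma_alg" using c by (rule G_cone_subset)
  have "\<psi> (f * G_tilde one_box * c) = \<psi> (f * c)" if "f \<in> Gamma_alg" for f
    using statesD(3)[OF \<psi> Gamma_alg_mult[OF that cG]] by (simp add: mult_ac)
  then show ?thesis
    using p cG c
    by (auto simp: states_def linear_on_Gamma_def G_positive_def distrib_right add_divide_distrib
        linear_on_Gamma_add[OF lin] linear_on_Gamma_scale[OF lin] Gamma_alg_mult
        intro!: divide_nonneg_pos states_nonneg[OF \<psi>] G_cone_mult)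
qed

text \<open>Here \<open>p\<close>, \<open>m\<close>, \<open>u\<close> stand for the values of a
  state at c, c^2, c^3. The first two terms are the defects conditioned on \<open>c\<close> and on
  its complement; the last is the variance of the conditional means \<open>m / p\<close> and
  \<open>(p - m) / (1 - p)\<close>.\<close>

lemma total_variance:
  fixes p m u :: real
  assumes "0 < p" "p < 1"
  shows "m - p\<^sup>2 = p * (u / p - (m / p)\<^sup>2) +
    (1 - p) * ((m - u) / (1 - p) - ((p - m) / (1 - p))\<^sup>2) + (m - p\<^sup>2)\<^sup>2 / (p * (1 - p))"
proof -
  have nz: "p \<noteq> 0" "1 - p \<noteq> 0" using assms by auto
  have scale: "q * (a / q - (b / q)\<^sup>2) = a - b\<^sup>2 / q" if "q \<noteq> 0" for a b q :: real
    using that by (simp add: right_diff_distrib power2_eq_square)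
  have "p * (u / p - (m / p)\<^sup>2) = u - m\<^sup>2 / p" by (rule scale[OF nz(1)])
  moreover have "(1 - p) * ((m - u) / (1 - p) - ((p - m) / (1 - p))\<^sup>2) = m - u - (p - m)\<^sup>2 / (1 - p)"
    by (rule scale[OF nz(2)])
  moreover have "m\<^sup>2 / p = m\<^sup>2 * (1 - p) / (p * (1 - p))" "(p - m)\<^sup>2 / (1 - p) = p * (p - m)\<^sup>2 / (p * (1 - p))"
    using nz by simp_all
  moreover have "m\<^sup>2 * (1 - p) / (p * (1 - p)) + p * (p - m)\<^sup>2 / (p * (1 - p)) - (m - p\<^sup>2)\<^sup>2 / (p * (1 - p)) = p\<^sup>2"
  proof -
    have "m\<^sup>2 * (1 - p) + p * (p - m)\<^sup>2 - (m - p\<^sup>2)\<^sup>2 = p\<^sup>2 * (p * (1 - p))"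
      by (simp add: power2_eq_square algebra_simps)
    then show ?thesis
      using nz by (simp only: add_divide_distrib[symmetric] diff_divide_distrib[symmetric]) simp
  qed
  ultimately show ?thesis by linarith
qed

text \<open>
  Conditioning a state on \<open>c\<close> and on \<open>d\<close> is a law of total variance: the defect
  \<open>\<psi> (c\<^sup>2) - \<psi> (c)\<^sup>2\<close> is the mean of the defects of the two conditioned states plus a
  nonnegative multiple of its own square, so its infimum over all states cannot be negative.
\<close>

lemma states_square:
  assumes \<psi>0: "\<psi>0 \<in> states" and c: "c \<in> G_cone" and d: "d \<in> G_cone" and cd: "c + d = G_tilde one_box ^ n"
  shows "(\<psi>0 c)\<^sup>2 \<le> \<psi>0 (c * c)"
proof -
  define v where "v \<psi> = \<psi> (c * c) - (\<psi> c)\<^sup>2" for \<psi> :: "power_series \<Rightarrow> real"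
  define \<delta> where "\<delta> = Inf (v ` states)"
  have cG: "c \<in> Gamma_alg" and dG: "d \<in> Gamma_alg" using c d by (simp_all add: G_cone_subset)
  have split: "\<psi> (f * d) = \<psi> f - \<psi> (f * c)" if \<psi>: "\<psi> \<in> states" and f: "f \<in> Gamma_alg" for \<psi> f
  proof -
    have "\<psi> f = \<psi> (f * c + f * d)"
      using states_power[OF \<psi> f, of n] by (simp add: cd[symmetric] distrib_left)
    then show ?thesis
      using cG dG f by (simp add: linear_on_Gamma_add[OF statesD(1)[OF \<psi>]] Gamma_alg_mult)
  qed
  have pq: "\<psi> d = 1 - \<psi> c" "0 \<le> \<psi> c" "\<psi> c \<le> 1" if \<psi>: "\<psi> \<in> states" for \<psi>
  proof -
    show 1: "\<psi> d = 1 - \<psi> c" using split[OF \<psi>, of 1] statesD(2)[OF \<psi>] by simp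
    show "0 \<le> \<psi> c" by (rule states_nonneg[OF \<psi> c])
    show "\<psi> c \<le> 1" using states_nonneg[OF \<psi> d] 1 by simp
  qed
  have bdd: "bdd_below (v ` states)"
  proof (rule bdd_belowI2)
    fix \<psi> assume \<psi>: "\<psi> \<in> states"
    have "(\<psi> c)\<^sup>2 \<le> 1" using pq[OF \<psi>] by (simp add: power_le_one)
    moreover have "0 \<le> \<psi> (c * c)" by (rule states_nonneg[OF \<psi> G_cone_mult[OF c c]])
    ultimately show "- 1 \<le> v \<psi>" by (simp add: v_def)
  qed
  have lower: "\<delta> \<le> v \<psi>" if "\<psi> \<in> states" for \<psi>
    unfolding \<delta>_def using bdd that by (simp add: cInf_lower)
  \<comment> \<open>The constant 4 comes from \<open>p * (1 - p) \<le> 1 / 4\<close> in the last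
    term of \<open>total_variance\<close>.\<close>
  have improve: "\<delta> + 4 * (v \<psi>)\<^sup>2 \<le> v \<psi>" if \<psi>: "\<psi> \<in> states" for \<psi>
  proof -
    let ?p = "\<psi> c" and ?m = "\<psi> (c * c)" and ?u = "\<psi> (c * c * c)"
    have m: "0 \<le> ?m" "?m \<le> ?p"
      using states_nonneg[OF \<psi> G_cone_mult[OF c c]] states_nonneg[OF \<psi> G_cone_mult[OF c d]]
        split[OF \<psi> cG] by simp_all
    \<comment> \<open>Conditioning requires both weights to be positive. In the two extreme cases
      the defect itself is 0.\<close>
    consider "?p = 0" | "?p = 1" | "0 < ?p" "?p < 1" using pq[OF \<psi>] by linarith
    then show ?thesis
    proof cases
      case 1
      then have "v \<psi> = 0" using m by (simp add: v_def)
      then show ?thesis using lower[OF \<psi>] by simp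
    next
      case 2
      have "0 \<le> \<psi> d - \<psi> (c * d)"
        using states_nonneg[OF \<psi> G_cone_mult[OF d d]] split[OF \<psi> dG] by (simp add: mult.commute)
      then have "?m = ?p" using split[OF \<psi> cG] pq(1)[OF \<psi>] 2 m by simp
      then have "v \<psi> = 0" using 2 by (simp add: v_def)
      then show ?thesis using lower[OF \<psi>] by simp
    next
      case 3
      let ?q = "1 - ?p"
      let ?\<psi>c = "\<lambda>f. \<psi> (f * c) / ?p" and ?\<psi>d = "\<lambda>f. \<psi> (f * d) / ?q"
      have sc: "?\<psi>c \<in> states" by (rule states_condition[OF \<psi> c 3(1)])
      have sd: "?\<psi>d \<in> states"
        using states_condition[OF \<psi> d] pq(1)[OF \<psi>] 3 by simp
      have "v ?\<psi>c = ?u / ?p - (?m / ?p)\<^sup>2" by (simp only: v_def)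
      moreover have "v ?\<psi>d = (?m - ?u) / ?q - ((?p - ?m) / ?q)\<^sup>2"
        by (simp only: v_def split[OF \<psi> cG] split[OF \<psi> Gamma_alg_mult[OF cG cG]])
      ultimately have "v \<psi> = ?p * v ?\<psi>c + ?q * v ?\<psi>d + (v \<psi>)\<^sup>2 / (?p * ?q)"
        unfolding v_def[of \<psi>] using total_variance[OF 3, of ?m ?u] by simp
      moreover have "?p * \<delta> + ?q * \<delta> \<le> ?p * v ?\<psi>c + ?q * v ?\<psi>d"
        using lower[OF sc] lower[OF sd] 3 by (intro add_mono mult_left_mono) auto
      moreover have "?p * \<delta> + ?q * \<delta> = \<delta>" by (simp add: algebra_simps)
      moreover have "4 * (v \<psi>)\<^sup>2 \<le> (v \<psi>)\<^sup>2 / (?p * ?q)"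
      proof -
        have "4 * (?p * ?q) \<le> 1"
          using zero_le_power2[of "2 * ?p - 1"] by (simp add: power2_eq_square algebra_simps)
        then have "4 * (?p * ?q) * (v \<psi>)\<^sup>2 \<le> 1 * (v \<psi>)\<^sup>2" by (intro mult_right_mono) auto
        moreover have "4 * (v \<psi>)\<^sup>2 * (?p * ?q) = 4 * (?p * ?q) * (v \<psi>)\<^sup>2" by (simp only: mult_ac)
        moreover have "0 < ?p * ?q" using 3 by simp
        ultimately show ?thesis by (simp only: pos_le_divide_eq mult_1_left)
      qed
      ultimately show ?thesis by linarith
    qed
  qed
  have "0 \<le> \<delta>"
  proof (rule ccontr)
    assume neg: "\<not> 0 \<le> \<delta>"
    \<comment> \<open>The first bound gives \<open>v \<psi> < \<delta> / 2 < 0\<close>, hence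
      \<open>4 * (v \<psi>)\<^sup>2 \<ge> \<delta>\<^sup>2\<close>; the second bound then
      contradicts \<open>improve\<close>.\<close>
    define \<epsilon> where "\<epsilon> = min (- \<delta> / 2) (\<delta>\<^sup>2)"
    have "0 < \<epsilon>" using neg by (simp add: \<epsilon>_def)
    then have "Inf (v ` states) < \<delta> + \<epsilon>" by (simp add: \<delta>_def)
    then obtain \<psi> where \<psi>: "\<psi> \<in> states" "v \<psi> < \<delta> + \<epsilon>"
      using cInf_lessD[of "v ` states" "\<delta> + \<epsilon>"] \<psi>0 by auto
    have "v \<psi> < \<delta> / 2" using \<psi>(2) by (simp add: \<epsilon>_def min_def split: if_splits)
    then have "(- \<delta> / 2)\<^sup>2 \<le> (- v \<psi>)\<^sup>2" using neg by (intro power_mono) auto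
    then have "\<delta>\<^sup>2 \<le> 4 * (v \<psi>)\<^sup>2" by (simp add: power_divide)
    moreover have "\<epsilon> \<le> \<delta>\<^sup>2" by (simp add: \<epsilon>_def)
    ultimately show False using improve[OF \<psi>(1)] \<psi>(2) by linarith
  qed
  then show ?thesis using lower[OF \<psi>0] by (simp add: v_def)
qed

lemma states_G_tilde_square: "\<psi> \<in> states \<Longrightarrow> (\<psi> (G_tilde \<kappa>))\<^sup>2 \<le> \<psi> (G_tilde \<kappa> * G_tilde \<kappa>)"
proof -
  assume \<psi>: "\<psi> \<in> states"
  obtain n where "G_tilde one_box ^ n - G_tilde \<kappa> \<in> G_cone"
    using power_minus_G_tilde_in_G_cone by blast
  then show ?thesis by (rule states_square[OF \<psi> G_cone_G_tilde, where n = n]) simp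
qed

text \<open>Sandwich: \<open>\<psi> (G_tilde \<kappa> * c)\<close> lies between 0 and the value at
  \<open>c * G_tilde one_box ^ n\<close>, which is \<open>\<psi> c\<close>.\<close>

lemma states_mult_eq_0:
  assumes \<psi>: "\<psi> \<in> states" and c: "c \<in> G_cone" and 0: "\<psi> c = 0"
  shows "\<psi> (G_tilde \<kappa> * c) = 0"
proof -
  obtain n where n: "G_tilde one_box ^ n - G_tilde \<kappa> \<in> G_cone"
    using power_minus_G_tilde_in_G_cone by blast
  have cG: "c \<in> Gamma_alg" using c by (rule G_cone_subset)
  have "0 \<le> \<psi> ((G_tilde one_box ^ n - G_tilde \<kappa>) * c)"
    by (rule states_nonneg[OF \<psi> G_cone_mult[OF n c]])
  also have "(G_tilde one_box ^ n - G_tilde \<kappa>) * c = c * G_tilde one_box ^ n - G_tilde \<kappa> * c"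
    by (simp add: algebra_simps)
  also have "\<psi> \<dots> = \<psi> (c * G_tilde one_box ^ n) - \<psi> (G_tilde \<kappa> * c)"
    using cG by (intro linear_on_Gamma_diff[OF statesD(1)[OF \<psi>]] Gamma_alg_mult Gamma_alg_power) auto
  also have "\<psi> (c * G_tilde one_box ^ n) = 0" using states_power[OF \<psi> cG] 0 by simp
  finally show ?thesis
    using states_nonneg[OF \<psi> G_cone_mult[OF G_cone_G_tilde c], of \<kappa>] by simp
qed

section \<open>Extreme points and multiplicativity\<close>

lemma boundary_convex_combination:
  assumes \<phi>: "\<phi> \<in> young_boundary" and ab: "a \<in> harmonic_functions" "b \<in> harmonic_functions"
    and u: "0 < u" "u < 1" and eq: "\<And>\<kappa>. \<phi> \<kappa> = (1 - u) * a \<kappa> + u * b \<kappa>"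
  shows "a = \<phi>"
proof -
  have comb: "\<phi> = (1 - u) *\<^sub>R a + u *\<^sub>R b"
    by (rule ext) (simp add: eq scaleR_fun_def)
  have "\<phi> \<notin> open_segment a b"
    using \<phi> ab by (simp add: young_boundary_def extreme_point_of_def)
  then have "a = b" using u comb by (auto simp: in_segment)
  then show ?thesis using eq by (auto simp: fun_eq_iff algebra_simps)
qed

text \<open>\<open>?d\<close> is the complement of \<open>?c\<close>. When \<open>\<psi> ?c\<close>
  is 0 or 1, one of them is null and conditioning on it is impossible;
  \<open>states_mult_eq_0\<close> then gives the product directly.\<close>

lemma boundary_multiplicative:
  assumes \<phi>: "(\<lambda>\<kappa>. \<psi> (G_tilde \<kappa>)) \<in> young_boundary" and \<psi>: "\<psi> \<in> states"
  shows "\<psi> (G_tilde \<nu> * G_tilde \<kappa>) = \<psi> (G_tilde \<nu>) * \<psi> (G_tilde \<kappa>)"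
proof -
  let ?c = "G_tilde \<kappa>"
  obtain n where d: "G_tilde one_box ^ n - ?c \<in> G_cone" (is "?d \<in> _")
    using power_minus_G_tilde_in_G_cone by blast
  have split: "\<psi> (f * ?d) = \<psi> f - \<psi> (f * ?c)" if f: "f \<in> Gamma_alg" for f
  proof -
    have "\<psi> (f * ?d) = \<psi> (f * G_tilde one_box ^ n - f * ?c)" by (simp add: right_diff_distrib)
    also have "\<dots> = \<psi> (f * G_tilde one_box ^ n) - \<psi> (f * ?c)"
      using f by (intro linear_on_Gamma_diff[OF statesD(1)[OF \<psi>]] Gamma_alg_mult Gamma_alg_power) auto
    finally show ?thesis using states_power[OF \<psi> f] by simp
  qed
  have pd: "\<psi> ?d = 1 - \<psi> ?c" using split[of 1] statesD(2)[OF \<psi>] by simp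
  have p: "0 \<le> \<psi> ?c" "\<psi> ?c \<le> 1"
    using states_nonneg[OF \<psi> G_cone_G_tilde] states_nonneg[OF \<psi> d] pd by simp_all
  consider "\<psi> ?c = 0" | "\<psi> ?c = 1" | "0 < \<psi> ?c" "\<psi> ?c < 1" using p by linarith
  then show ?thesis
  proof cases
    case 1
    then show ?thesis using states_mult_eq_0[OF \<psi> G_cone_G_tilde] by simp
  next
    case 2
    then have "\<psi> (G_tilde \<nu> * ?d) = 0" using states_mult_eq_0[OF \<psi> d] pd by simp
    then show ?thesis using 2 split[of "G_tilde \<nu>"] by simp
  next
    case 3
    let ?a = "\<lambda>f. \<psi> (f * ?d) / \<psi> ?d" and ?b = "\<lambda>f. \<psi> (f * ?c) / \<psi> ?c"
    have b: "?b \<in> states" by (rule states_condition[OF \<psi> G_cone_G_tilde 3(1)])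
    have a: "?a \<in> states" by (rule states_condition[OF \<psi> d]) (use pd 3 in simp)
    have q: "0 < 1 - \<psi> ?c" "1 - \<psi> ?c < 1" using 3 by auto
    have eq: "\<psi> (G_tilde \<mu>) = (1 - (1 - \<psi> ?c)) * ?b (G_tilde \<mu>) + (1 - \<psi> ?c) * ?a (G_tilde \<mu>)" for \<mu>
      using 3 split[of "G_tilde \<mu>"] by (simp add: pd)
    have "(\<lambda>\<mu>. ?b (G_tilde \<mu>)) = (\<lambda>\<mu>. \<psi> (G_tilde \<mu>))"
      by (rule boundary_convex_combination[OF \<phi> states_harmonic[OF b] states_harmonic[OF a] q]) (rule eq)
    then have "?b (G_tilde \<nu>) = \<psi> (G_tilde \<nu>)" by (rule fun_cong)
    then show ?thesis using 3 by (simp add: field_simps)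
  qed
qed

text \<open>Independence and injectivity allow arbitrary values on the
  \<open>G_tilde \<kappa>\<close>. The extension is linear on all power series, with no control
  outside \<open>Gamma_alg\<close>.\<close>

lemma harmonic_functional:
  assumes "\<phi> \<in> harmonic_functions"
  obtains \<psi> where "\<psi> \<in> states" "\<And>\<kappa>. \<psi> (G_tilde \<kappa>) = \<phi> \<kappa>"
proof -
  obtain \<psi> :: "power_series \<Rightarrow> real" where lin: "linear \<psi>"
    and ext: "\<forall>x\<in>range G_tilde. \<psi> x = \<phi> (inv G_tilde x)"
    using linear_independent_extend[OF independent_G_tilde, of "\<lambda>x. \<phi> (inv G_tilde x)"] by blast
  have G: "\<psi> (G_tilde \<kappa>) = \<phi> \<kappa>" for \<kappa> using ext by (simp add: inj_G_tilde)
  have "linear_on_Gamma \<psi>"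
    using lin by (simp add: linear_on_Gamma_def linear_add linear_scale)
  then show ?thesis using harmonic_states[OF assms _ G] G that by blast
qed

lemma hom_in_boundary:
  assumes \<phi>: "\<phi> \<in> harmonic_functions" and G: "\<And>\<kappa>. \<psi> (G_tilde \<kappa>) = \<phi> \<kappa>" and hom: "Gamma_hom \<psi>"
  shows "\<phi> \<in> young_boundary"
proof -
  have "\<phi> \<notin> open_segment a b" if a: "a \<in> harmonic_functions" and b: "b \<in> harmonic_functions" for a b
  proof
    assume "\<phi> \<in> open_segment a b"
    then obtain u where ne: "a \<noteq> b" and u: "0 < u" "u < 1" and eq: "\<phi> = (1 - u) *\<^sub>R a + u *\<^sub>R b"
      by (auto simp: in_segment)
    have eq: "\<phi> \<kappa> = (1 - u) * a \<kappa> + u * b \<kappa>" for \<kappa> by (simp add: eq scaleR_fun_def)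
    \<comment> \<open>Functionals are needed because the square of a basis element is not a basis
      element in general.\<close>
    obtain \<alpha> where \<alpha>: "\<alpha> \<in> states" "\<And>\<kappa>. \<alpha> (G_tilde \<kappa>) = a \<kappa>" using harmonic_functional[OF a] by blast
    obtain \<beta> where \<beta>: "\<beta> \<in> states" "\<And>\<kappa>. \<beta> (G_tilde \<kappa>) = b \<kappa>" using harmonic_functional[OF b] by blast
    have lin: "linear_on_Gamma \<psi>" using hom by (simp add: Gamma_hom_def)
    have comb: "\<psi> f = (1 - u) * \<alpha> f + u * \<beta> f" if "f \<in> Gamma_alg" for f
      using that
    proof (induction rule: Gamma_alg_induct)
      case (G \<kappa>)
      then show ?case by (simp add: assms(2) \<alpha>(2) \<beta>(2) eq)
    next
      case (scale c f)
      then show ?case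
        by (simp add: linear_on_Gamma_scale lin statesD(1)[OF \<alpha>(1)] statesD(1)[OF \<beta>(1)]
            distrib_left mult.left_commute)
    qed (simp_all add: linear_on_Gamma_0 linear_on_Gamma_add lin
        statesD(1)[OF \<alpha>(1)] statesD(1)[OF \<beta>(1)] algebra_simps)
    have "a \<kappa> = b \<kappa>" for \<kappa>
    proof -
      have "((1 - u) * a \<kappa> + u * b \<kappa>)\<^sup>2 = \<psi> (G_tilde \<kappa> * G_tilde \<kappa>)"
        using hom by (simp add: Gamma_hom_def G eq power2_eq_square)
      also have "\<dots> = (1 - u) * \<alpha> (G_tilde \<kappa> * G_tilde \<kappa>) + u * \<beta> (G_tilde \<kappa> * G_tilde \<kappa>)"
        by (rule comb) (simp add: Gamma_alg_mult)
      also have "\<dots> \<ge> (1 - u) * (a \<kappa>)\<^sup>2 + u * (b \<kappa>)\<^sup>2"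
        using states_G_tilde_square[OF \<alpha>(1), of \<kappa>] states_G_tilde_square[OF \<beta>(1), of \<kappa>] u
        by (intro add_mono mult_left_mono) (simp_all add: \<alpha>(2) \<beta>(2))
      \<comment> \<open>Strict convexity in the form (1 - u) a^2 + u b^2 - ((1 - u) a + u b)^2 = u
        (1 - u) (a - b)^2.\<close>
      finally have "u * (1 - u) * (a \<kappa> - b \<kappa>)\<^sup>2 \<le> 0" by (simp add: power2_eq_square algebra_simps)
      then have "(a \<kappa> - b \<kappa>)\<^sup>2 \<le> 0" using u by (simp add: mult_le_0_iff)
      then show ?thesis by simp
    qed
    then show False using ne by auto
  qed
  then show ?thesis using \<phi> by (simp add: young_boundary_def extreme_point_of_def)
qed

theorem theorem1p6:
  fixes \<phi> :: "partition \<Rightarrow> real" and \<phi>_hat :: "power_series \<Rightarrow> real"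
  assumes "\<phi> \<in> harmonic_functions"
    and "linear_on_Gamma \<phi>_hat"
    and "\<And>\<kappa>. \<phi>_hat (G_tilde \<kappa>) = \<phi> \<kappa>"
  shows "\<phi> \<in> young_boundary \<longleftrightarrow>
    Gamma_hom \<phi>_hat \<and> G_positive \<phi>_hat \<and> normalized \<phi>_hat"
proof
  note lin = assms(2)
  have st: "\<phi>_hat \<in> states" by (rule harmonic_states[OF assms])
  assume b: "\<phi> \<in> young_boundary"
  have "\<phi> = (\<lambda>\<kappa>. \<phi>_hat (G_tilde \<kappa>))" by (simp add: assms(3))
  with b have mult: "\<phi>_hat (G_tilde \<nu> * G_tilde \<kappa>) = \<phi>_hat (G_tilde \<nu>) * \<phi>_hat (G_tilde \<kappa>)" for \<nu> \<kappa>
    using boundary_multiplicative[OF _ st] by simp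
  have "\<phi>_hat (f * g) = \<phi>_hat f * \<phi>_hat g" if f: "f \<in> Gamma_alg" and g: "g \<in> Gamma_alg" for f g
    using f
  proof (induction rule: Gamma_alg_induct)
    case (G \<nu>)
    show ?case
      using g
      by (induction rule: Gamma_alg_induct)
        (simp_all add: mult distrib_left Gamma_alg_mult linear_on_Gamma_0[OF lin]
          linear_on_Gamma_add[OF lin] linear_on_Gamma_scale[OF lin])
  qed (simp_all add: g distrib_right Gamma_alg_mult linear_on_Gamma_0[OF lin]
      linear_on_Gamma_add[OF lin] linear_on_Gamma_scale[OF lin])
  moreover have "\<phi>_hat (G_tilde one_box) = 1"
    using statesD(3)[OF st, of 1] statesD(2)[OF st] by simp
  ultimately show "Gamma_hom \<phi>_hat \<and> G_positive \<phi>_hat \<and> normalized \<phi>_hat"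
    using lin statesD(2,4)[OF st] by (simp add: Gamma_hom_def G_positive_def normalized_def)
next
  assume "Gamma_hom \<phi>_hat \<and> G_positive \<phi>_hat \<and> normalized \<phi>_hat"
  then show "\<phi> \<in> young_boundary" using hom_in_boundary[OF assms(1,3)] by blast
qed

end
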